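(* Let $N\ge 2$, $p>1$, $\theta,l\in\mathbb{R}$, and let $\Omega\subset\mathbb{R}^N$ be a domain (bounded or not). Let $v\in H^{1,\theta}_{loc}(\Omega)\cap L^\infty_{loc}(\Omega)$ be a stable solution of $-\mathrm{div}(|x|^\theta\nabla v)=|x|^l|v|^{p-1}v$ in $\Omega$. Then for any $\gamma\in[1,\,2p+2\sqrt{p(p-1)}-1)$ and any integer $m\ge\max\{\frac{p+\gamma}{p-1},2\}$ there exists a constant $C>0$ depending only on $p,m,\gamma,l$ and $\theta$ such that $$\int_\Omega\Big(|x|^\theta\big|\nabla(|v|^{\frac{\gamma-1}{2}}v)\big|^2+|x|^l|v|^{\gamma+p}\Big)|\psi|^{2m}\,dx\le C\int_\Omega|x|^{\frac{\theta(\gamma+p)-l(\gamma+1)}{p-1}}\Big(|\nabla\psi|^2+|\psi||\Delta\psi|+|\psi|\frac{|\nabla\psi|}{|x|}\Big)^{\frac{p+\gamma}{p-1}}dx$$ for all test functions $\psi\in C_0^2(\Omega)$ satisfying $|\psi|\le 1$ in $\Omega$.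
   Context: $H^{1,\theta}(\Omega)$ is the space of functions $\varphi$ with $|x|^{\theta/2}\varphi\in L^2(\Omega)$ and $|x|^{\theta/2}|\nabla\varphi|\in L^2(\Omega)$, with norm $\big(\int_\Omega|x|^\theta(\varphi^2+|\nabla\varphi|^2)dx\big)^{1/2}$; $H^{1,\theta}_{loc}(\Omega)$ is the corresponding local space, and $H^{1,\theta}_c(\Omega)$ is the subspace of functions in $H^{1,\theta}(\Omega)$ with compact support in $\Omega$. $C_0^2(\Omega)$ denotes the $C^2$ functions with compact support in $\Omega$. A function $v$ is a solution of $-\mathrm{div}(|x|^\theta\nabla v)=|x|^l|v|^{p-1}v$ in $\Omega$ if $v\in H^{1,\theta}_{loc}(\Omega)\cap L^\infty_{loc}(\Omega)$ and $\int_\Omega\big(|x|^\theta\nabla v\cdot\nabla\phi-|x|^l|v|^{p-1}v\phi\big)dx=0$ for all $\phi\in H^{1,\theta}_c(\Omega)\cap L^\infty_{loc}(\Omega)$. A solution $v$ is stable (in $\Omega$) if $Q_v(\psi):=\int_\Omega\big(|x|^\theta|\nabla\psi|^2-p|x|^l|v|^{p-1}\psi^2\big)dx\ge0$ for all $\psi\in H^{1,\theta}_c(\Omega)\cap L^\infty_{loc}(\Omega)$. *)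

theory Defs
  imports "HOL-Analysis.Analysis"
begin

text \<open>
  The constant in the theorem must not depend on the dimension, so the dimension has to be
  quantified inside the statement. Points of \<open>\<real>\<^sup>N\<close> are therefore functions of type
  \<^typ>\<open>nat \<Rightarrow> real\<close> that are extensional on \<open>{..<N}\<close>. This is the carrier both of the product
  topology and of the product measure on \<open>{..<N}\<close>. A vector field \<open>G\<close> has the
  components \<open>G x i\<close> for \<open>i < N\<close>.
\<close>

type_synonym point = "nat \<Rightarrow> real"

abbreviation Rn :: "nat \<Rightarrow> point topology" where
  "Rn N \<equiv> product_topology (\<lambda>_. euclideanreal) {..<N}"

definition leb :: "nat \<Rightarrow> point measure" where
  "leb N = completion (\<Pi>\<^sub>M i\<in>{..<N}. (lborel :: real measure))"

definition enorm :: "nat \<Rightarrow> (nat \<Rightarrow> real) \<Rightarrow> real" where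
  "enorm N x = L2_set x {..<N}"

definition dotp :: "nat \<Rightarrow> (nat \<Rightarrow> real) \<Rightarrow> (nat \<Rightarrow> real) \<Rightarrow> real" where
  "dotp N x y = (\<Sum>i<N. x i * y i)"

definition is_domain :: "nat \<Rightarrow> point set \<Rightarrow> bool" where
  "is_domain N \<Omega> \<longleftrightarrow> openin (Rn N) \<Omega> \<and> connectedin (Rn N) \<Omega> \<and> \<Omega> \<noteq> {}"


subsection \<open>Classical derivatives\<close>

definition partial :: "nat \<Rightarrow> (point \<Rightarrow> real) \<Rightarrow> point \<Rightarrow> real" where
  "partial i f x = deriv (\<lambda>t. f (x(i := t))) (x i)"

definition grad :: "(point \<Rightarrow> real) \<Rightarrow> point \<Rightarrow> nat \<Rightarrow> real" where
  "grad f x i = partial i f x"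

definition laplacian :: "nat \<Rightarrow> (point \<Rightarrow> real) \<Rightarrow> point \<Rightarrow> real" where
  "laplacian N f x = (\<Sum>i<N. partial i (partial i f) x)"

text \<open>For open \<open>\<Omega>\<close>: all partial derivatives up to order \<open>k\<close> exist and are continuous on \<open>\<Omega>\<close>.\<close>

primrec C_k :: "nat \<Rightarrow> nat \<Rightarrow> point set \<Rightarrow> (point \<Rightarrow> real) \<Rightarrow> bool" where
  "C_k 0 N \<Omega> f \<longleftrightarrow> continuous_map (subtopology (Rn N) \<Omega>) euclideanreal f"
| "C_k (Suc k) N \<Omega> f \<longleftrightarrow>
     continuous_map (subtopology (Rn N) \<Omega>) euclideanreal f \<and>
     (\<forall>i<N. (\<forall>x\<in>\<Omega>. (\<lambda>t. f (x(i := t))) differentiable (at (x i))) \<and>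
            C_k k N \<Omega> (partial i f))"

definition C_k_compact :: "nat \<Rightarrow> nat \<Rightarrow> point set \<Rightarrow> (point \<Rightarrow> real) set" where
  "C_k_compact k N \<Omega> =
     {f. C_k k N \<Omega> f \<and> (\<exists>K. compactin (Rn N) K \<and> K \<subseteq> \<Omega> \<and> (\<forall>x\<in>\<Omega> - K. f x = 0))}"

definition test_functions :: "nat \<Rightarrow> point set \<Rightarrow> (point \<Rightarrow> real) set" where
  "test_functions N \<Omega> = (\<Inter>k. C_k_compact k N \<Omega>)"


subsection \<open>Weak gradients\<close>

definition locally_integrable :: "nat \<Rightarrow> point set \<Rightarrow> (point \<Rightarrow> real) \<Rightarrow> bool" where
  "locally_integrable N \<Omega> u \<longleftrightarrow>
     (\<forall>K. compactin (Rn N) K \<and> K \<subseteq> \<Omega> \<longrightarrow> set_integrable (leb N) K u)"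

definition is_weak_grad ::
  "nat \<Rightarrow> point set \<Rightarrow> (point \<Rightarrow> real) \<Rightarrow> (point \<Rightarrow> nat \<Rightarrow> real) \<Rightarrow> bool" where
  "is_weak_grad N \<Omega> u G \<longleftrightarrow>
     locally_integrable N \<Omega> u \<and>
     (\<forall>i<N. locally_integrable N \<Omega> (\<lambda>x. G x i) \<and>
       (\<forall>\<eta>\<in>test_functions N \<Omega>.
          (LINT x:\<Omega>|leb N. u x * partial i \<eta> x) = - (LINT x:\<Omega>|leb N. G x i * \<eta> x)))"

definition weakly_differentiable :: "nat \<Rightarrow> point set \<Rightarrow> (point \<Rightarrow> real) \<Rightarrow> bool" where
  "weakly_differentiable N \<Omega> u \<longleftrightarrow> (\<exists>G. is_weak_grad N \<Omega> u G)"

text \<open>A weak gradient is unique up to null sets of \<open>\<Omega>\<close>; one representative is chosen.\<close>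

definition weak_grad :: "nat \<Rightarrow> point set \<Rightarrow> (point \<Rightarrow> real) \<Rightarrow> point \<Rightarrow> nat \<Rightarrow> real" where
  "weak_grad N \<Omega> u = (SOME G. is_weak_grad N \<Omega> u G)"


subsection \<open>Weighted Sobolev spaces\<close>

definition L2 :: "nat \<Rightarrow> point set \<Rightarrow> (point \<Rightarrow> real) set" where
  "L2 N A = {f. set_borel_measurable (leb N) A f \<and> set_integrable (leb N) A (\<lambda>x. (f x)\<^sup>2)}"

definition H1 :: "nat \<Rightarrow> real \<Rightarrow> point set \<Rightarrow> (point \<Rightarrow> real) set" where
  "H1 N \<theta> \<Omega> = {\<phi>. weakly_differentiable N \<Omega> \<phi> \<and>
     (\<lambda>x. enorm N x powr (\<theta>/2) * \<phi> x) \<in> L2 N \<Omega> \<and>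
     (\<lambda>x. enorm N x powr (\<theta>/2) * enorm N (weak_grad N \<Omega> \<phi> x)) \<in> L2 N \<Omega>}"

definition H1_loc :: "nat \<Rightarrow> real \<Rightarrow> point set \<Rightarrow> (point \<Rightarrow> real) set" where
  "H1_loc N \<theta> \<Omega> = {\<phi>. weakly_differentiable N \<Omega> \<phi> \<and>
     (\<forall>K. compactin (Rn N) K \<and> K \<subseteq> \<Omega> \<longrightarrow>
        (\<lambda>x. enorm N x powr (\<theta>/2) * \<phi> x) \<in> L2 N K \<and>
        (\<lambda>x. enorm N x powr (\<theta>/2) * enorm N (weak_grad N \<Omega> \<phi> x)) \<in> L2 N K)}"

definition H1_c :: "nat \<Rightarrow> real \<Rightarrow> point set \<Rightarrow> (point \<Rightarrow> real) set" where
  "H1_c N \<theta> \<Omega> = {\<phi> \<in> H1 N \<theta> \<Omega>.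
     \<exists>K. compactin (Rn N) K \<and> K \<subseteq> \<Omega> \<and> (AE x in leb N. x \<in> \<Omega> - K \<longrightarrow> \<phi> x = 0)}"

definition Linf_loc :: "nat \<Rightarrow> point set \<Rightarrow> (point \<Rightarrow> real) set" where
  "Linf_loc N \<Omega> = {\<phi>. set_borel_measurable (leb N) \<Omega> \<phi> \<and>
     (\<forall>K. compactin (Rn N) K \<and> K \<subseteq> \<Omega> \<longrightarrow>
        (\<exists>B. AE x in leb N. x \<in> K \<longrightarrow> \<bar>\<phi> x\<bar> \<le> B))}"


subsection \<open>Stable solutions\<close>

text \<open>
  Bochner integrals of non-integrable functions are \<open>0\<close> in the library. The weak formulation
  and the stability inequality are therefore accompanied by integrability. In the stability
  inequality the first summand is integrable and the second one is nonpositive, so integrability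
  only excludes the value \<open>-\<infinity>\<close> for the quadratic form.
\<close>

definition is_solution :: "nat \<Rightarrow> real \<Rightarrow> real \<Rightarrow> real \<Rightarrow> point set \<Rightarrow> (point \<Rightarrow> real) \<Rightarrow> bool" where
  "is_solution N p \<theta> l \<Omega> v \<longleftrightarrow>
     v \<in> H1_loc N \<theta> \<Omega> \<inter> Linf_loc N \<Omega> \<and>
     (\<forall>\<phi> \<in> H1_c N \<theta> \<Omega> \<inter> Linf_loc N \<Omega>.
        let F = (\<lambda>x. enorm N x powr \<theta> * dotp N (weak_grad N \<Omega> v x) (weak_grad N \<Omega> \<phi> x)
                     - enorm N x powr l * \<bar>v x\<bar> powr (p - 1) * v x * \<phi> x)
        in set_integrable (leb N) \<Omega> F \<and> (LINT x:\<Omega>|leb N. F x) = 0)"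

definition is_stable :: "nat \<Rightarrow> real \<Rightarrow> real \<Rightarrow> real \<Rightarrow> point set \<Rightarrow> (point \<Rightarrow> real) \<Rightarrow> bool" where
  "is_stable N p \<theta> l \<Omega> v \<longleftrightarrow>
     (\<forall>\<psi> \<in> H1_c N \<theta> \<Omega> \<inter> Linf_loc N \<Omega>.
        let F = (\<lambda>x. enorm N x powr \<theta> * (enorm N (weak_grad N \<Omega> \<psi> x))\<^sup>2
                     - p * enorm N x powr l * \<bar>v x\<bar> powr (p - 1) * (\<psi> x)\<^sup>2)
        in set_integrable (leb N) \<Omega> F \<and> (LINT x:\<Omega>|leb N. F x) \<ge> 0)"

end

theory Submission
  imports Defs
begin

text \<open>
  Write \<open>A = \<integral> |x|\<^sup>\<theta> |v|\<^sup>\<gamma>\<^sup>-\<^sup>1 |\<nabla>v|\<^sup>2 \<phi>\<^sup>2\<close>, \<open>B = \<integral> |x|\<^sup>l |v|\<^sup>\<gamma>\<^sup>+\<^sup>p \<phi>\<^sup>2\<close> and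
  \<open>D = \<integral> |x|\<^sup>\<theta> |v|\<^sup>\<gamma>\<^sup>+\<^sup>1 |\<nabla>\<phi>|\<^sup>2\<close> with \<open>\<phi> = \<psi>\<^sup>m\<close>. Testing the equation with \<open>|v|\<^sup>\<gamma>\<^sup>-\<^sup>1 v \<phi>\<^sup>2\<close> and the stability
  inequality with the square root analogue \<open>|v|\<^bsup>(\<gamma>-1)/2\<^esup> v \<phi>\<close>, and estimating the cross terms by the inequality of
  arithmetic and geometric means, gives \<open>(p \<gamma> - ((\<gamma> + 1) / 2)\<^sup>2 - \<epsilon>) A \<le> C D\<close> and \<open>B \<le> C (A + D)\<close>. The bracket is positive
  for small \<open>\<epsilon>\<close> because the range of \<open>\<gamma>\<close> is open at the top, so \<open>A\<close> and \<open>B\<close> are controlled by \<open>D\<close>, and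
  Young's inequality absorbs \<open>D\<close> into \<open>B\<close> and the term \<open>|\<nabla>\<psi>|\<^sup>2\<close> of the right-hand side. No integration by parts is
  needed, hence no regularity of the weight at the origin; the Laplacian is simply dropped.

  The test functions are admissible by a chain and product rule for weak derivatives, which is
  obtained without mollification: \<open>v\<close> is absolutely continuous on almost every line parallel to an axis.
\<close>

subsection \<open>Smooth functions of one variable\<close>

text \<open>Testing the equation ties \<open>B\<close> to \<gamma> \<open>A\<close>, and stability
  bounds p \<open>B\<close> by ((\<gamma> + 1) / 2)^2 \<open>A\<close>, both up to multiples of one
  cross term; the factors come from the derivative of |s|^(\<gamma>-1) s and from the squared
  derivative of |s|^((\<gamma>-1)/2) s. Most of the work goes into admissibility: a weak gradient of
  |v|^a v \<phi> must be exhibited for a v that is only locally bounded with a weak gradient. Along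
  a line the chain rule concerns one real variable, and to show that v is a primitive on almost
  every line it is enough to test with products of one-variable functions supported in a box. Smooth
  functions are therefore built in one variable only. Local boundedness of v takes the place of
  truncation, since a continuous function of v is then essentially bounded on compact sets.
  Integrals over \<open>leb\<close> pass to the uncompleted product measure through representatives,
  and Fubini is applied there. Absorbing into \<open>B\<close> presupposes that \<open>B\<close> is
  finite; that comes from the integrability clause in the notion of solution.\<close>

primrec Dk :: "nat \<Rightarrow> (real \<Rightarrow> real) \<Rightarrow> bool" where
  "Dk 0 f \<longleftrightarrow> continuous_on UNIV f"
| "Dk (Suc k) f \<longleftrightarrow> (\<exists>f'. (\<forall>x. (f has_real_derivative f' x) (at x)) \<and> Dk k f')"

lemma Dk_SucD: "Dk (Suc k) f \<Longrightarrow> Dk k f"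
proof (induction k arbitrary: f)
  case 0
  then obtain f' where "\<And>x. (f has_real_derivative f' x) (at x)" by auto
  then show ?case
    by (auto intro!: continuous_at_imp_continuous_on DERIV_isCont)
next
  case (Suc k)
  then obtain f' where "\<forall>x. (f has_real_derivative f' x) (at x)" "Dk (Suc k) f'" by auto
  with Suc.IH[of f'] show ?case by auto
qed

lemma Dk_const: "Dk k (\<lambda>x. c)"
proof (induction k arbitrary: c)
  case (Suc k)
  show ?case using Suc[of 0] by (auto intro!: exI[of _ "\<lambda>_. 0"] derivative_eq_intros)
qed simp

lemma Dk_add: "Dk k f \<Longrightarrow> Dk k g \<Longrightarrow> Dk k (\<lambda>x. f x + g x)"
proof (induction k arbitrary: f g)
  case 0 then show ?case by (auto intro!: continuous_intros)
next
  case (Suc k)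
  then obtain f' g' where "\<forall>x. (f has_real_derivative f' x) (at x)" "Dk k f'"
    "\<forall>x. (g has_real_derivative g' x) (at x)" "Dk k g'" by auto
  with Suc.IH show ?case
    by (auto intro!: exI[of _ "\<lambda>x. f' x + g' x"] derivative_eq_intros)
qed

lemma Dk_mult: "Dk k f \<Longrightarrow> Dk k g \<Longrightarrow> Dk k (\<lambda>x. f x * g x)"
proof (induction k arbitrary: f g)
  case 0 then show ?case by (auto intro!: continuous_intros)
next
  case (Suc k)
  from Suc.prems obtain f' g' where *: "\<forall>x. (f has_real_derivative f' x) (at x)" "Dk k f'"
    "\<forall>x. (g has_real_derivative g' x) (at x)" "Dk k g'" by auto
  have "Dk k f" "Dk k g" using Suc.prems Dk_SucD by auto
  with Suc.IH * have "Dk k (\<lambda>x. f' x * g x + f x * g' x)"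
    by (intro Dk_add) auto
  with * show ?case
    by (auto intro!: exI[of _ "\<lambda>x. f' x * g x + f x * g' x"] derivative_eq_intros)
qed

lemma Dk_cmult: "Dk k f \<Longrightarrow> Dk k (\<lambda>x. c * f x)"
  by (intro Dk_mult Dk_const)

lemma Dk_affine: "Dk k f \<Longrightarrow> Dk k (\<lambda>x. f (c * x + d))"
proof (induction k arbitrary: f)
  case 0
  then show ?case
    by (auto intro!: continuous_intros continuous_on_compose2[of UNIV f])
next
  case (Suc k)
  then obtain f' where f': "\<And>x. (f has_real_derivative f' x) (at x)" "Dk k f'" by auto
  have "((\<lambda>x. f (c * x + d)) has_real_derivative c * f' (c * x + d)) (at x)" for x
  proof -
    have "((\<lambda>x. c * x + d) has_real_derivative c) (at x)" by (auto intro!: derivative_eq_intros)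
    from DERIV_chain2[OF f'(1) this] show ?thesis by (simp add: mult.commute)
  qed
  with Suc.IH[OF f'(2)] show ?case
    by (auto intro!: exI[of _ "\<lambda>x. c * f' (c * x + d)"] Dk_cmult)
qed

text \<open>The derivative of 1/f is a product of f' and two copies of 1/f, so order k for 1/f,
  which the induction hypothesis supplies, yields order k + 1.\<close>

lemma Dk_inverse: "Dk k f \<Longrightarrow> (\<And>x. f x \<noteq> 0) \<Longrightarrow> Dk k (\<lambda>x. inverse (f x))"
proof (induction k arbitrary: f)
  case 0 then show ?case by (auto intro!: continuous_intros)
next
  case (Suc k)
  then obtain f' where f': "\<And>x. (f has_real_derivative f' x) (at x)" "Dk k f'" by auto
  have "((\<lambda>x. inverse (f x)) has_real_derivative (-1) * (inverse (f x) * f' x * inverse (f x))) (at x)" for x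
    by (rule derivative_eq_intros f' refl | simp add: Suc.prems)+
  moreover have "Dk k (\<lambda>x. (-1) * (inverse (f x) * f' x * inverse (f x)))"
    using Suc.IH[OF Dk_SucD[OF Suc.prems(1)] Suc.prems(2)] f'(2)
    by (intro Dk_cmult Dk_mult) auto
  ultimately show ?case
    unfolding Dk.simps by (intro exI[of _ "\<lambda>x. (-1) * (inverse (f x) * f' x * inverse (f x))"]) blast
qed

section \<open>Flat functions, bumps, cutoffs and compactly supported primitives\<close>

definition flat :: "nat \<Rightarrow> real \<Rightarrow> real" where
  "flat n t = (if t > 0 then exp (- (1 / t)) * (1 / t) ^ n else 0)"

text \<open>This is the difference quotient of \<open>flat n\<close> at 0. From the right it equals
  (1/t)^(n+1) / exp (1/t), and the exponential beats every power.\<close>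

lemma flat_bound: "((\<lambda>t. flat n t / t) \<longlongrightarrow> 0) (at 0)"
proof -
  have 1: "((\<lambda>t::real. (1/t) ^ Suc n / exp (1/t)) \<longlongrightarrow> 0) (at_right 0)"
    by (rule filterlim_compose[OF tendsto_power_div_exp_0])
      (use filterlim_inverse_at_top_right in \<open>simp add: inverse_eq_divide\<close>)
  have 2: "((\<lambda>t. flat n t / t) \<longlongrightarrow> 0) (at_right 0)"
    by (rule Lim_transform_eventually[OF 1])
      (auto simp: flat_def eventually_at_filter exp_minus field_simps)
  have 3: "((\<lambda>t. flat n t / t) \<longlongrightarrow> 0) (at_left 0)"
    by (rule tendsto_eventually) (auto simp: flat_def eventually_at_filter)
  show ?thesis using 2 3 by (simp add: filterlim_split_at)
qed

text \<open>The powers of 1/t in \<open>flat\<close> are there for this formula: the family is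
  closed under differentiation up to linear combinations, so smoothness of all members is a single
  induction.\<close>

lemma flat_DERIV: "(flat n has_real_derivative flat (n+2) t - real n * flat (n+1) t) (at t)"
proof -
  consider "t > 0" | "t < 0" | "t = 0" by linarith
  then show ?thesis
  proof cases
    case 1
    have "((\<lambda>t. exp (- (1 / t)) * (1 / t) ^ n) has_real_derivative
       exp (- (1 / t)) * (1 / t) ^ (n+2) - real n * (exp (- (1 / t)) * (1 / t) ^ (n+1))) (at t)"
    proof -
      have "real n * (1 / t) ^ (n - 1) * (1 / t)\<^sup>2 = real n * (1 / t) ^ (n + 1)"
        by (cases n) (auto simp: power2_eq_square)
      then show ?thesis
        using 1 by (auto intro!: derivative_eq_intros simp: power2_eq_square algebra_simps divide_inverse)
    qed
    then show ?thesis
      using 1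
      by (auto simp: flat_def intro: has_field_derivative_transform_within_open[of _ _ _ "{0<..}"])
  next
    case 2
    have "((\<lambda>t. 0) has_real_derivative 0) (at t)" by simp
    then show ?thesis
      using 2 has_field_derivative_transform_within_open[of "\<lambda>_. 0" 0 t "{..<0}" "flat n"]
      by (auto simp: flat_def)
  next
    case 3
    then show ?thesis
      using flat_bound[of n] by (simp add: has_field_derivative_iff flat_def)
  qed
qed

lemma Dk_flat: "Dk k (flat n)"
proof (induction k arbitrary: n)
  case 0
  show ?case using flat_DERIV by (auto intro!: continuous_at_imp_continuous_on DERIV_isCont)
next
  case (Suc k)
  have "Dk k (\<lambda>t. flat (n+2) t + (- real n) * flat (n+1) t)"
    by (intro Dk_add Dk_cmult Suc)
  then show ?case
    using flat_DERIV by (auto intro!: exI[of _ "\<lambda>t. flat (n+2) t - real n * flat (n+1) t"])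
qed

definition smooth :: "(real \<Rightarrow> real) \<Rightarrow> bool" where
  "smooth f \<longleftrightarrow> (\<forall>k. Dk k f)"

lemma smooth_DERIV: assumes "smooth f" shows "(f has_real_derivative deriv f x) (at x)"
proof -
  have "Dk (Suc 0) f" using assms by (auto simp: smooth_def)
  then show ?thesis by (metis Dk.simps(2) DERIV_imp_deriv)
qed

lemma smooth_deriv: assumes "smooth f" shows "smooth (deriv f)"
  unfolding smooth_def
proof
  fix k
  have "Dk (Suc k) f" using assms by (auto simp: smooth_def)
  then obtain f' where *: "\<forall>x. (f has_real_derivative f' x) (at x)" "Dk k f'" by auto
  then have "f' = deriv f" by (metis DERIV_imp_deriv ext)
  with * show "Dk k (deriv f)" by simp
qed

lemma smooth_continuous: "smooth f \<Longrightarrow> continuous_on S f"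
  by (metis DERIV_isCont continuous_at_imp_continuous_on smooth_DERIV)

lemma smooth_antideriv:
  assumes "smooth f" "\<And>x. (F has_real_derivative f x) (at x)" shows "smooth F"
  unfolding smooth_def
proof
  fix k
  have "Dk (Suc k) F" using assms by (auto simp: smooth_def)
  then show "Dk k F" by (rule Dk_SucD)
qed

text \<open>Scaling by n + 1 inside \<open>flat 0\<close> drives both factors to 1 at every interior
  point while the zero set stays fixed. As n grows, the bumps are smooth approximations of the
  indicator of the open interval, all bounded by 1.\<close>

definition bump :: "real \<Rightarrow> real \<Rightarrow> nat \<Rightarrow> real \<Rightarrow> real" where
  "bump a b n t = flat 0 (real (Suc n) * (t - a)) * flat 0 (real (Suc n) * (b - t))"

lemma smooth_bump: "smooth (bump a b n)"
proof -
  have "Dk k (\<lambda>t. flat 0 (real (Suc n) * t + (- real (Suc n) * a)) *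
       flat 0 ((- real (Suc n)) * t + real (Suc n) * b))" for k
    by (intro Dk_mult Dk_affine Dk_flat)
  then show ?thesis
    by (auto simp: smooth_def bump_def[abs_def] algebra_simps)
qed

lemma flat0_range: "0 \<le> flat 0 t" "flat 0 t \<le> 1" by (auto simp: flat_def)

lemma bump_range: "0 \<le> bump a b n t" "bump a b n t \<le> 1"
  by (auto simp: bump_def flat0_range mult_le_one)

lemma bump_pos: "a < t \<Longrightarrow> t < b \<Longrightarrow> 0 < bump a b n t"
  by (auto simp: bump_def flat_def)

lemma bump_0: "t \<notin> {a<..<b} \<Longrightarrow> bump a b n t = 0"
  by (auto simp: bump_def flat_def zero_less_mult_iff)

lemma bump_lim: "(\<lambda>n. bump a b n t) \<longlonglongrightarrow> indicator {a<..<b} t"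
proof (cases "t \<in> {a<..<b}")
  case True
  have *: "(\<lambda>n. flat 0 (real (Suc n) * c)) \<longlonglongrightarrow> 1" if "c > 0" for c :: real
  proof -
    have "(\<lambda>n. inverse (real (Suc n))) \<longlonglongrightarrow> 0" by (rule LIMSEQ_inverse_real_of_nat)
    then have "(\<lambda>n. exp (- (inverse (real (Suc n)) * inverse c))) \<longlonglongrightarrow> exp (- (0 * inverse c))"
      by (intro tendsto_intros)
    moreover have "flat 0 (real (Suc n) * c) = exp (- (inverse (real (Suc n)) * inverse c))" for n
      using that by (auto simp: flat_def inverse_eq_divide)
    ultimately show ?thesis by simp
  qed
  have "(\<lambda>n. bump a b n t) \<longlonglongrightarrow> 1 * 1"
    unfolding bump_def using True by (intro tendsto_mult *) auto
  then show ?thesis using True by simp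
qed (auto simp: bump_0)

text \<open>The quotient h(t - a) / (h(t - a) + h(b - t)) with h = \<open>flat 0\<close>. As a < b,
  no t satisfies both t \<le> a and t \<ge> b, so the denominator is positive.\<close>

lemma smooth_step:
  assumes "a < (b::real)"
  obtains s where "smooth s" "\<And>t. t \<le> a \<Longrightarrow> s t = 0" "\<And>t. t \<ge> b \<Longrightarrow> s t = 1"
proof
  let ?d = "\<lambda>t. flat 0 (1 * t + (-a)) + flat 0 ((-1) * t + b)"
  have "?d t > 0" for t using assms by (auto simp: flat_def add_pos_nonneg add_pos_pos)
  then have nz: "?d t \<noteq> 0" for t by (metis less_irrefl)
  show "smooth (\<lambda>t. flat 0 (1 * t + (-a)) * inverse (?d t))"
    unfolding smooth_def by (intro allI Dk_mult Dk_inverse Dk_add Dk_affine Dk_flat nz)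
  show "flat 0 (1 * t + (-a)) * inverse (?d t) = 0" if "t \<le> a" for t
    using that by (auto simp: flat_def)
  show "flat 0 (1 * t + (-a)) * inverse (?d t) = 1" if "t \<ge> b" for t
    using that assms by (auto simp: flat_def)
qed

lemma smooth_mult: "smooth f \<Longrightarrow> smooth g \<Longrightarrow> smooth (\<lambda>x. f x * g x)"
  and smooth_add: "smooth f \<Longrightarrow> smooth g \<Longrightarrow> smooth (\<lambda>x. f x + g x)"
  and smooth_cmult: "smooth f \<Longrightarrow> smooth (\<lambda>x. c * f x)"
  and smooth_affine: "smooth f \<Longrightarrow> smooth (\<lambda>x. f (c * x + d))"
  by (auto simp: smooth_def intro: Dk_mult Dk_add Dk_cmult Dk_affine)

text \<open>A rising step times the reflection of a second rising step.\<close>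

lemma smooth_cutoff:
  assumes "a < a'" "b' < (b::real)"
  obtains s where "smooth s" "\<And>t. t \<notin> {a<..<b} \<Longrightarrow> s t = 0" "\<And>t. t \<in> {a'..b'} \<Longrightarrow> s t = 1"
proof -
  obtain s1 where s1: "smooth s1" "\<And>t. t \<le> a \<Longrightarrow> s1 t = 0" "\<And>t. t \<ge> a' \<Longrightarrow> s1 t = 1"
    using smooth_step[OF assms(1)] by blast
  obtain s2 where s2: "smooth s2" "\<And>t. t \<le> -b \<Longrightarrow> s2 t = 0" "\<And>t. t \<ge> -b' \<Longrightarrow> s2 t = 1"
    using smooth_step[of "-b" "-b'"] assms by auto
  have sm: "smooth (\<lambda>t. s1 t * s2 ((-1) * t + 0))"
    by (intro smooth_mult s1 smooth_affine s2)
  show ?thesis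
    by (rule that[OF sm]) (auto simp: s1 s2 not_less)
qed

text \<open>The integral from a vanishes to the left of a because f does, and to the right of b
  because the total integral is 0. Hence every bump-like function with mean zero is the derivative
  of one with the same support bounds, which is how one-variable factors of test functions are
  integrated later.\<close>

lemma smooth_primitive:
  assumes "smooth f" and f0: "\<And>t. t \<notin> {a<..<b} \<Longrightarrow> f t = 0" and "a < b" and int0: "integral {a..b} f = 0"
  obtains F where "smooth F" "deriv F = f" "\<And>t. t \<notin> {a<..<b} \<Longrightarrow> F t = 0"
proof -
  define F where "F t = integral {a..t} f" for t
  have cf: "continuous_on S f" for S using assms smooth_continuous by blast
  have Fa: "F t = 0" if "t \<le> a" for t
    using that by (cases "t = a") (auto simp: F_def)
  have Fb: "F t = 0" if "b \<le> t" for t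
  proof -
    have "integral {a..b} f + integral {b..t} f = integral {a..t} f"
      using that assms by (intro Henstock_Kurzweil_Integration.integral_combine integrable_continuous_interval cf) auto
    moreover have "integral {b..t} f = integral {b..t} (\<lambda>_. 0)"
      by (intro Henstock_Kurzweil_Integration.integral_cong f0) auto
    ultimately show ?thesis using int0 by (simp add: F_def)
  qed
  \<comment> \<open>Moving the base point to a - 1 makes a an interior point of the interval of
    integration, so the derivative at a is two-sided.\<close>
  have F': "F t = integral {a-1..t} f" if "t \<ge> a - 1" for t
  proof (cases "t \<ge> a")
    case True
    have "integral {a-1..a} f + integral {a..t} f = integral {a-1..t} f"
      using True by (intro Henstock_Kurzweil_Integration.integral_combine integrable_continuous_interval cf) auto
    moreover have "integral {a-1..a} f = integral {a-1..a} (\<lambda>_. 0)"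
      by (intro Henstock_Kurzweil_Integration.integral_cong f0) auto
    ultimately show ?thesis by (simp add: F_def)
  next
    case False
    have "integral {a-1..t} f = integral {a-1..t} (\<lambda>_. 0)"
      using False by (intro Henstock_Kurzweil_Integration.integral_cong f0) auto
    then show ?thesis using Fa[of t] False by simp
  qed
  have D: "(F has_real_derivative f t) (at t)" for t
  proof (cases "t < a")
    case True
    have "((\<lambda>t. 0) has_real_derivative 0) (at t)" by simp
    then show ?thesis
      using True f0[of t] Fa has_field_derivative_transform_within_open[of "\<lambda>_. 0" 0 t "{..<a}" F]
      by auto
  next
    case False
    have "((\<lambda>x. integral {a-1..x} f) has_real_derivative f t) (at t within {a-1..t+1})"
      using False by (intro integral_has_real_derivative cf) auto
    then have "((\<lambda>x. integral {a-1..x} f) has_real_derivative f t) (at t)"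
      using False by (subst (asm) at_within_interior) auto
    then show ?thesis
      using False F'
      by (auto intro: has_field_derivative_transform_within_open[of _ _ _ "{a-1<..}"])
  qed
  show ?thesis
  proof (rule that)
    show "smooth F" using assms(1) D by (rule smooth_antideriv)
    show "deriv F = f" using D by (auto simp: DERIV_imp_deriv)
    show "F t = 0" if "t \<notin> {a<..<b}" for t using Fa Fb that by force
  qed
qed

subsection \<open>Differentiable functions on open sets of the product space\<close>

lemma continuous_map_upd:
  assumes "x \<in> extensional {..<N}" "i < N"
  shows "continuous_map euclideanreal (Rn N) (\<lambda>t. x(i := t))"
  using assms by (auto simp: continuous_map_componentwise extensional_def)

lemma open_upd:
  assumes "openin (Rn N) \<Omega>" "x \<in> extensional {..<N}" "i < N"
  shows "open {t. x(i := t) \<in> \<Omega>}"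
  using openin_continuous_map_preimage[OF continuous_map_upd[OF assms(2,3)] assms(1)] by simp

lemma openin_Rn_extensional: "openin (Rn N) \<Omega> \<Longrightarrow> x \<in> \<Omega> \<Longrightarrow> x \<in> extensional {..<N}"
  by (auto dest!: openin_subset simp: PiE_def)

lemma open_upd':
  assumes "openin (Rn N) \<Omega>" "x \<in> \<Omega>" "i < N"
  shows "open {t. x(i := t) \<in> \<Omega>}" "x i \<in> {t. x(i := t) \<in> \<Omega>}"
  using open_upd[OF assms(1) openin_Rn_extensional[OF assms(1,2)] assms(3)] assms(2) by auto

lemma eventually_upd:
  assumes "openin (Rn N) \<Omega>" "x \<in> \<Omega>" "i < N"
  shows "eventually (\<lambda>t. x(i := t) \<in> \<Omega>) (nhds (x i))"
  using eventually_nhds_in_open[OF open_upd'[OF assms]] by simp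

section \<open>Partial derivatives and the classes \<open>C_k\<close>\<close>

lemma partial_cong:
  assumes "openin (Rn N) \<Omega>" "x \<in> \<Omega>" "i < N" "\<And>x. x \<in> \<Omega> \<Longrightarrow> f x = g x"
  shows "partial i f x = partial i g x"
  unfolding partial_def
  by (rule deriv_cong_ev[OF eventually_mono[OF eventually_upd[OF assms(1-3)]]]) (auto simp: assms)

lemma differentiable_upd_cong:
  assumes "openin (Rn N) \<Omega>" "x \<in> \<Omega>" "i < N" "\<And>x. x \<in> \<Omega> \<Longrightarrow> f x = g x"
    and "(\<lambda>t. f (x(i := t))) differentiable (at (x i))"
  shows "(\<lambda>t. g (x(i := t))) differentiable (at (x i))"
proof -
  from assms(5) obtain D where "((\<lambda>t. f (x(i := t))) has_derivative D) (at (x i))"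
    by (auto simp: differentiable_def)
  then have "((\<lambda>t. g (x(i := t))) has_derivative D) (at (x i))"
    by (rule has_derivative_transform_within_open[OF _ open_upd'[OF assms(1-3)]]) (auto simp: assms)
  then show ?thesis by (auto simp: differentiable_def)
qed

text \<open>Openness of \<open>\<Omega>\<close> keeps a short segment around each point inside
  \<open>\<Omega>\<close>, so equality on \<open>\<Omega>\<close> passes to the partial derivatives
  and from there to every order.\<close>

lemma C_k_cong:
  assumes "openin (Rn N) \<Omega>"
  shows "(\<And>x. x \<in> \<Omega> \<Longrightarrow> f x = g x) \<Longrightarrow> C_k k N \<Omega> f \<Longrightarrow> C_k k N \<Omega> g"
proof (induction k arbitrary: f g)
  case 0
  then show ?case by (auto elim!: continuous_map_eq)
next
  case (Suc k)
  have *: "continuous_map (subtopology (Rn N) \<Omega>) euclideanreal g"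
    using Suc.prems by (auto elim!: continuous_map_eq)
  have "(\<lambda>t. g (x(i := t))) differentiable (at (x i))" if "i < N" "x \<in> \<Omega>" for i x
  proof (rule differentiable_upd_cong[OF assms that(2,1) Suc.prems(1)])
    show "(\<lambda>t. f (x(i := t))) differentiable (at (x i))" using Suc.prems(2) that by auto
  qed
  moreover have "C_k k N \<Omega> (partial i g)" if "i < N" for i
  proof (rule Suc.IH)
    show "C_k k N \<Omega> (partial i f)" using Suc.prems(2) that by auto
    show "partial i f x = partial i g x" if "x \<in> \<Omega>" for x
      by (rule partial_cong[OF assms that \<open>i < N\<close> Suc.prems(1)])
  qed
  ultimately show ?case using * by auto
qed

lemma C_k_SucD: "C_k (Suc k) N \<Omega> f \<Longrightarrow> C_k k N \<Omega> f"
  by (induction k arbitrary: f) auto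

lemma C_k_Suc_DERIV:
  assumes "C_k (Suc k) N \<Omega> f" "x \<in> \<Omega>" "i < N"
  shows "((\<lambda>t. f (x(i := t))) has_real_derivative partial i f x) (at (x i))"
  using assms unfolding partial_def by (auto intro: DERIV_deriv_iff_real_differentiable[THEN iffD2])

lemma C_k_partial: "C_k (Suc k) N \<Omega> f \<Longrightarrow> i < N \<Longrightarrow> C_k k N \<Omega> (partial i f)"
  by auto

lemma C_k_imp_continuous: "C_k k N \<Omega> f \<Longrightarrow> continuous_map (subtopology (Rn N) \<Omega>) euclideanreal f"
  by (cases k) auto

text \<open>Membership in \<open>C_k\<close> can be shown with explicitly named derivatives f'
  instead of \<open>partial\<close>; the two agree on \<open>\<Omega>\<close>, and
  \<open>C_k\<close> sees nothing else.\<close>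

lemma C_k_SucI:
  assumes "openin (Rn N) \<Omega>" "continuous_map (subtopology (Rn N) \<Omega>) euclideanreal f"
    and D: "\<And>i x. i < N \<Longrightarrow> x \<in> \<Omega> \<Longrightarrow> ((\<lambda>t. f (x(i := t))) has_real_derivative f' i x) (at (x i))"
    and "\<And>i. i < N \<Longrightarrow> C_k k N \<Omega> (f' i)"
  shows "C_k (Suc k) N \<Omega> f"
proof -
  have "partial i f x = f' i x" if "i < N" "x \<in> \<Omega>" for i x
    using D[OF that] unfolding partial_def by (rule DERIV_imp_deriv)
  with assms show ?thesis
    by (auto intro: C_k_cong[OF assms(1), of "f' _"] simp: real_differentiable_def)
qed

lemma partialI: "((\<lambda>t. f (x(i := t))) has_real_derivative D) (at (x i)) \<Longrightarrow> partial i f x = D"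
  unfolding partial_def by (rule DERIV_imp_deriv)

lemma C_k_const: assumes "openin (Rn N) \<Omega>" shows "C_k k N \<Omega> (\<lambda>x. c)"
proof (induction k arbitrary: c)
  case (Suc k)
  show ?case by (rule C_k_SucI[OF assms, where f' = "\<lambda>_ _. 0"]) (auto simp: Suc)
qed simp

lemma C_k_add:
  assumes "openin (Rn N) \<Omega>"
  shows "C_k k N \<Omega> f \<Longrightarrow> C_k k N \<Omega> g \<Longrightarrow> C_k k N \<Omega> (\<lambda>x. f x + g x)"
proof (induction k arbitrary: f g)
  case 0
  then show ?case by (auto intro: continuous_intros)
next
  case (Suc k)
  show ?case
  proof (rule C_k_SucI[OF assms, where f' = "\<lambda>i x. partial i f x + partial i g x"])
    fix i x assume i: "i < N" and x: "x \<in> \<Omega>"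
    show "((\<lambda>t. f (x(i := t)) + g (x(i := t))) has_real_derivative partial i f x + partial i g x) (at (x i))"
      by (intro DERIV_add C_k_Suc_DERIV[OF Suc.prems(1) x i] C_k_Suc_DERIV[OF Suc.prems(2) x i])
  next
    fix i assume i: "i < N"
    show "C_k k N \<Omega> (\<lambda>x. partial i f x + partial i g x)"
      by (intro Suc.IH C_k_partial[OF _ i] Suc.prems)
  qed (intro continuous_map_add C_k_imp_continuous[OF Suc.prems(1)] C_k_imp_continuous[OF Suc.prems(2)])
qed

lemma C_k_mult:
  assumes "openin (Rn N) \<Omega>"
  shows "C_k k N \<Omega> f \<Longrightarrow> C_k k N \<Omega> g \<Longrightarrow> C_k k N \<Omega> (\<lambda>x. f x * g x)"
proof (induction k arbitrary: f g)
  case 0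
  then show ?case by (auto intro: continuous_intros)
next
  case (Suc k)
  show ?case
  proof (rule C_k_SucI[OF assms, where f' = "\<lambda>i x. partial i f x * g x + f x * partial i g x"])
    fix i x assume i: "i < N" and x: "x \<in> \<Omega>"
    show "((\<lambda>t. f (x(i := t)) * g (x(i := t))) has_real_derivative
        partial i f x * g x + f x * partial i g x) (at (x i))"
      by (rule DERIV_cong[OF DERIV_mult[OF C_k_Suc_DERIV[OF Suc.prems(1) x i] C_k_Suc_DERIV[OF Suc.prems(2) x i]]]) simp
  next
    fix i assume i: "i < N"
    show "C_k k N \<Omega> (\<lambda>x. partial i f x * g x + f x * partial i g x)"
      by (intro C_k_add[OF assms] Suc.IH C_k_partial[OF _ i] C_k_SucD[OF Suc.prems(1)]
          C_k_SucD[OF Suc.prems(2)] Suc.prems)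
  qed (intro continuous_map_real_mult C_k_imp_continuous[OF Suc.prems(1)] C_k_imp_continuous[OF Suc.prems(2)])
qed

lemma partial_mult:
  assumes "C_k (Suc k) N \<Omega> f" "C_k (Suc k) N \<Omega> g" "x \<in> \<Omega>" "i < N"
  shows "partial i (\<lambda>x. f x * g x) x = partial i f x * g x + f x * partial i g x"
  using C_k_Suc_DERIV[OF assms(1,3,4)] C_k_Suc_DERIV[OF assms(2,3,4)]
  by (auto intro!: partialI derivative_eq_intros)

lemma C_k_power:
  assumes "openin (Rn N) \<Omega>" "C_k k N \<Omega> f" shows "C_k k N \<Omega> (\<lambda>x. f x ^ m)"
  by (induction m) (auto intro: C_k_const C_k_mult assms)

lemma partial_power:
  assumes "C_k (Suc k) N \<Omega> f" "x \<in> \<Omega>" "i < N"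
  shows "partial i (\<lambda>x. f x ^ m) x = real m * f x ^ (m - 1) * partial i f x"
  using C_k_Suc_DERIV[OF assms] by (auto intro!: partialI derivative_eq_intros)

section \<open>Products of one-variable functions\<close>

definition tensor :: "nat \<Rightarrow> (nat \<Rightarrow> real \<Rightarrow> real) \<Rightarrow> point \<Rightarrow> real" where
  "tensor N b x = (\<Prod>j<N. b j (x j))"

lemma tensor_split: "i < N \<Longrightarrow> tensor N b (x(i := t)) = b i t * (\<Prod>j\<in>{..<N}-{i}. b j (x j))"
  unfolding tensor_def by (subst prod.remove[of _ i]) (auto intro!: prod.cong)

lemma tensor_DERIV:
  assumes "smooth (b i)" "i < N"
  shows "((\<lambda>t. tensor N b (x(i := t))) has_real_derivative tensor N (b(i := deriv (b i))) x) (at (x i))"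
proof -
  have "tensor N (b(i := deriv (b i))) x = deriv (b i) (x i) * (\<Prod>j\<in>{..<N}-{i}. b j (x j))"
    using tensor_split[OF assms(2), of "b(i := deriv (b i))" x "x i"] by (auto intro!: prod.cong)
  then show ?thesis
    using smooth_DERIV[OF assms(1)]
    by (auto simp: tensor_split[OF assms(2)] intro!: derivative_eq_intros)
qed

lemma partial_tensor:
  assumes "smooth (b i)" "i < N" shows "partial i (tensor N b) x = tensor N (b(i := deriv (b i))) x"
  by (rule partialI tensor_DERIV assms)+

lemma continuous_map_tensor:
  assumes "\<And>j. j < N \<Longrightarrow> smooth (b j)"
  shows "continuous_map (Rn N) euclideanreal (tensor N b)"
  unfolding tensor_def
proof (intro continuous_map_prod)
  fix j assume j: "j \<in> {..<N}"
  have "continuous_map euclideanreal euclideanreal (b j)"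
    using smooth_continuous assms j by auto
  then show "continuous_map (Rn N) euclideanreal (\<lambda>x. b j (x j))"
    using continuous_map_compose[of "Rn N" euclideanreal "\<lambda>x. x j" euclideanreal "b j"] j
    by (auto simp: o_def intro!: continuous_map_product_projection)
qed auto

text \<open>A partial derivative of a product is again a product, with one factor differentiated;
  the induction over k therefore runs over all families b at once.\<close>

lemma C_k_tensor:
  assumes "openin (Rn N) \<Omega>"
  shows "(\<And>j. j < N \<Longrightarrow> smooth (b j)) \<Longrightarrow> C_k k N \<Omega> (tensor N b)"
proof (induction k arbitrary: b)
  case 0
  then show ?case by (auto intro: continuous_map_from_subtopology continuous_map_tensor)
next
  case (Suc k)
  show ?case
  proof (rule C_k_SucI[OF assms, where f' = "\<lambda>i. tensor N (b(i := deriv (b i)))"])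
    show "C_k k N \<Omega> (tensor N (b(i := deriv (b i))))" if "i < N" for i
      by (rule Suc.IH) (use Suc.prems that in \<open>auto intro: smooth_deriv\<close>)
    show "((\<lambda>t. tensor N b (x(i := t))) has_real_derivative tensor N (b(i := deriv (b i))) x) (at (x i))"
      if "i < N" for i x
      by (rule tensor_DERIV) (use Suc.prems that in auto)
  qed (use Suc.prems in \<open>auto intro: continuous_map_from_subtopology continuous_map_tensor\<close>)
qed

section \<open>Boxes: topology, countable covers and measurability\<close>

abbreviation obox :: "nat \<Rightarrow> (nat \<Rightarrow> real) \<Rightarrow> (nat \<Rightarrow> real) \<Rightarrow> point set" where
  "obox N a b \<equiv> (\<Pi>\<^sub>E j\<in>{..<N}. {a j<..<b j})"

abbreviation box_closed :: "nat \<Rightarrow> (nat \<Rightarrow> real) \<Rightarrow> (nat \<Rightarrow> real) \<Rightarrow> point set" where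
  "box_closed N a b \<equiv> (\<Pi>\<^sub>E j\<in>{..<N}. {a j..b j})"

abbreviation PN :: "nat \<Rightarrow> point measure" where
  "PN N \<equiv> (\<Pi>\<^sub>M i\<in>{..<N}. (lborel :: real measure))"

text \<open>Corners are kept extensional on \<open>{..<N}\<close>: with arbitrary values beyond N
  there would be uncountably many corners for countably many boxes.\<close>

definition rats :: "nat \<Rightarrow> point set" where "rats N = (\<Pi>\<^sub>E j\<in>{..<N}. \<rat>)"

lemma countable_rats: "countable (rats N)"
  unfolding rats_def by (intro countable_PiE) (auto simp: countable_rat)

lemma obox_subset: "obox N a b \<subseteq> box_closed N a b"
  by (auto simp: PiE_def Pi_def intro: less_imp_le)

lemma openin_obox: "openin (Rn N) (obox N a b)"
  by (auto simp: openin_PiE)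

lemma compactin_box: "compactin (Rn N) (box_closed N a b)"
  by (auto simp: compactin_PiE)

text \<open>Each clause has its use: rational corners make covers countable, the open box is a
  neighbourhood, and the closed box is a compact subset of \<open>\<Omega>\<close> on which local
  integrability can be invoked.\<close>

lemma box_nbhd:
  assumes "openin (Rn N) \<Omega>" "x \<in> \<Omega>"
  obtains a b where "a \<in> rats N" "b \<in> rats N" "x \<in> obox N a b" "box_closed N a b \<subseteq> \<Omega>"
proof -
  obtain U where U: "\<And>j. j < N \<Longrightarrow> open (U j)" "x \<in> Pi\<^sub>E {..<N} U" "Pi\<^sub>E {..<N} U \<subseteq> \<Omega>"
    using assms unfolding openin_product_topology_alt by (metis lessThan_iff open_openin)
  have "\<exists>ab. fst ab \<in> \<rat> \<and> snd ab \<in> \<rat> \<and> fst ab < x j \<and> x j < snd ab \<and> {fst ab..snd ab} \<subseteq> U j" if j: "j < N" for j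
  proof -
    have "x j \<in> U j" using U(2) j by auto
    with U(1)[OF j] obtain e where e: "e > 0" "ball (x j) e \<subseteq> U j"
      using open_contains_ball by blast
    obtain p where p: "p \<in> \<rat>" "x j - e < p" "p < x j"
      using Rats_dense_in_real[of "x j - e" "x j"] e by auto
    obtain q where q: "q \<in> \<rat>" "x j < q" "q < x j + e"
      using Rats_dense_in_real[of "x j" "x j + e"] e by auto
    have "{p..q} \<subseteq> ball (x j) e" using p q by (auto simp: dist_real_def)
    with p q e show ?thesis by (intro exI[of _ "(p,q)"]) auto
  qed
  then obtain ab where ab: "\<And>j. j < N \<Longrightarrow> fst (ab j) \<in> \<rat> \<and> snd (ab j) \<in> \<rat> \<and> fst (ab j) < x j
      \<and> x j < snd (ab j) \<and> {fst (ab j)..snd (ab j)} \<subseteq> U j"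
    by metis
  let ?a = "\<lambda>j\<in>{..<N}. fst (ab j)" and ?b = "\<lambda>j\<in>{..<N}. snd (ab j)"
  have "x \<in> extensional {..<N}" using assms openin_Rn_extensional by auto
  moreover have "box_closed N ?a ?b \<subseteq> Pi\<^sub>E {..<N} U"
    using ab by (intro PiE_mono) auto
  ultimately show ?thesis
    using ab U(3) by (intro that[of ?a ?b]) (auto simp: rats_def PiE_iff)
qed

lemma sets_obox[measurable]: "obox N a b \<in> sets (PN N)"
  and sets_box_closed[measurable]: "box_closed N a b \<in> sets (PN N)"
  by (auto intro!: sets_PiM_I_finite)

lemma open_eq_Union_boxes:
  assumes "openin (Rn N) \<Omega>"
  shows "\<Omega> = (\<Union>(a, b)\<in>{(a, b). (a, b) \<in> rats N \<times> rats N \<and> box_closed N a b \<subseteq> \<Omega>}. obox N a b)"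
proof (intro equalityI subsetI)
  fix x assume "x \<in> \<Omega>"
  from box_nbhd[OF assms this] obtain a b where "a \<in> rats N" "b \<in> rats N" "x \<in> obox N a b"
    "box_closed N a b \<subseteq> \<Omega>" by metis
  then show "x \<in> (\<Union>(a, b)\<in>{(a, b). (a, b) \<in> rats N \<times> rats N \<and> box_closed N a b \<subseteq> \<Omega>}. obox N a b)"
    by blast
next
  fix x assume "x \<in> (\<Union>(a, b)\<in>{(a, b). (a, b) \<in> rats N \<times> rats N \<and> box_closed N a b \<subseteq> \<Omega>}. obox N a b)"
  then obtain a b where "x \<in> obox N a b" "box_closed N a b \<subseteq> \<Omega>" by blast
  then show "x \<in> \<Omega>" using obox_subset[of N a b] by blast
qed

lemma countable_boxes: "countable {(a, b). (a, b) \<in> rats N \<times> rats N \<and> P a b}"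
  by (rule countable_subset[of _ "rats N \<times> rats N"]) (auto intro: countable_rats)

lemma sets_open: assumes "openin (Rn N) \<Omega>" shows "\<Omega> \<in> sets (PN N)"
  by (subst open_eq_Union_boxes[OF assms], rule sets.countable_UN'[OF countable_boxes])
    (auto intro!: sets_obox)

text \<open>Reduces almost-everywhere claims on \<open>\<Omega>\<close> to one box at a time:
  countably many rational boxes cover \<open>\<Omega>\<close>, and a countable union of null sets is
  null.\<close>

lemma AE_open:
  assumes "openin (Rn N) \<Omega>"
    and "\<And>a b. box_closed N a b \<subseteq> \<Omega> \<Longrightarrow> AE x in M. x \<in> obox N a b \<longrightarrow> P x"
  shows "AE x in M. x \<in> \<Omega> \<longrightarrow> P x"
proof -
  have "AE x in M. \<forall>(a, b)\<in>{(a, b). (a, b) \<in> rats N \<times> rats N \<and> box_closed N a b \<subseteq> \<Omega>}. x \<in> obox N a b \<longrightarrow> P x"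
    by (subst AE_ball_countable[OF countable_boxes]) (auto intro: assms)
  then show ?thesis
  proof (rule eventually_mono, safe)
    fix x assume *: "\<forall>(a, b)\<in>{(a, b). (a, b) \<in> rats N \<times> rats N \<and> box_closed N a b \<subseteq> \<Omega>}. x \<in> obox N a b \<longrightarrow> P x" "x \<in> \<Omega>"
    from box_nbhd[OF assms(1) this(2)] obtain a b where "a \<in> rats N" "b \<in> rats N" "x \<in> obox N a b"
      "box_closed N a b \<subseteq> \<Omega>" by metis
    with * show "P x" by blast
  qed
qed

lemma space_PN: "space (PN N) = topspace (Rn N)"
  by (auto simp: space_PiM)

lemma sets_compact: assumes "compactin (Rn N) K" shows "K \<in> sets (PN N)"
proof -
  have "Hausdorff_space (Rn N)" by (simp add: Hausdorff_space_product_topology)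
  then have "closedin (Rn N) K" using assms compactin_imp_closedin by blast
  then have K: "openin (Rn N) (topspace (Rn N) - K)" "K \<subseteq> space (PN N)"
    unfolding space_PN closedin_def by blast+
  have "space (PN N) - (topspace (Rn N) - K) \<in> sets (PN N)"
    by (intro sets.compl_sets sets_open K)
  moreover have "space (PN N) - (topspace (Rn N) - K) = K" using K(2) by (auto simp: space_PN)
  ultimately show ?thesis by simp
qed

text \<open>Nothing is known of f outside \<open>\<Omega>\<close>, hence the indicator. Inside,
  preimages of open sets are open relative to the open set \<open>\<Omega>\<close>, thus open and
  measurable.\<close>

lemma measurable_continuous_on_open:
  assumes "openin (Rn N) \<Omega>" "continuous_map (subtopology (Rn N) \<Omega>) euclideanreal f"
  shows "(\<lambda>x. indicator \<Omega> x * f x) \<in> borel_measurable (PN N)"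
proof -
  have "f \<in> borel_measurable (restrict_space (PN N) \<Omega>)"
  proof (rule borel_measurableI)
    fix S :: "real set" assume "open S"
    then have "openin (subtopology (Rn N) \<Omega>) {x \<in> topspace (subtopology (Rn N) \<Omega>). f x \<in> S}"
      by (intro openin_continuous_map_preimage[OF assms(2)]) auto
    moreover have *: "{x \<in> topspace (subtopology (Rn N) \<Omega>). f x \<in> S} = f -` S \<inter> space (restrict_space (PN N) \<Omega>)"
      by (auto simp: space_restrict_space space_PN)
    ultimately have "openin (Rn N) (f -` S \<inter> space (restrict_space (PN N) \<Omega>))"
      using assms(1) openin_trans_full by auto
    then have "f -` S \<inter> space (restrict_space (PN N) \<Omega>) \<in> sets (PN N)" by (rule sets_open)
    then show "f -` S \<inter> space (restrict_space (PN N) \<Omega>) \<in> sets (restrict_space (PN N) \<Omega>)"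
      by (subst sets_restrict_space_iff) (auto simp: space_restrict_space sets_open assms)
  qed
  then show ?thesis
    by (subst (asm) borel_measurable_restrict_space_iff) (auto simp: sets_open assms)
qed

lemma bounded_on_compact:
  assumes "compactin (Rn N) K" "K \<subseteq> \<Omega>" "continuous_map (subtopology (Rn N) \<Omega>) euclideanreal f"
  obtains B where "B > 0" "\<And>x. x \<in> K \<Longrightarrow> \<bar>f x\<bar> \<le> B"
proof -
  have "compactin (subtopology (Rn N) \<Omega>) K" using assms(1,2) by (simp add: compactin_subtopology)
  then have "compactin euclideanreal (f ` K)" using assms(3) by (rule image_compactin)
  then have "bounded (f ` K)" by (simp add: compact_imp_bounded)
  then show ?thesis using that unfolding bounded_pos by (auto simp: image_iff)
qed

subsection \<open>Primitives of integrable functions of one variable\<close>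

text \<open>Absolute continuity of V on [a, b] in integral form. No pointwise derivative of V is
  asserted; G is one only almost everywhere.\<close>

definition primitive_on :: "real \<Rightarrow> real \<Rightarrow> (real \<Rightarrow> real) \<Rightarrow> (real \<Rightarrow> real) \<Rightarrow> bool" where
  "primitive_on a b V G \<longleftrightarrow> set_integrable lborel {a..b} G \<and>
     (\<forall>s t. a \<le> s \<and> s \<le> t \<and> t \<le> b \<longrightarrow> V t - V s = integral {s..t} G)"

lemma primitive_onI:
  assumes G: "set_integrable lborel {a..b} G"
    and V: "\<And>t. a \<le> t \<Longrightarrow> t \<le> b \<Longrightarrow> V t = c + integral {a..t} G"
  shows "primitive_on a b V G"
  unfolding primitive_on_def
proof (intro conjI allI impI G)
  fix s t assume st: "a \<le> s \<and> s \<le> t \<and> t \<le> b"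
  have "G integrable_on {a..t}"
    by (rule integrable_subinterval_real[OF set_borel_integral_eq_integral(1)[OF G]]) (use st in auto)
  then have "integral {a..s} G + integral {s..t} G = integral {a..t} G"
    using st by (intro Henstock_Kurzweil_Integration.integral_combine) auto
  then show "V t - V s = integral {s..t} G"
    using V[of t] V[of s] st by auto
qed

lemma primitive_on_continuous:
  assumes "primitive_on a b V G" shows "continuous_on {a..b} V"
proof -
  have "continuous_on {a..b} (\<lambda>t. V a + integral {a..t} G)"
    using assms unfolding primitive_on_def
    by (intro continuous_intros indefinite_integral_continuous_1 set_borel_integral_eq_integral) auto
  moreover have "V t = V a + integral {a..t} G" if "t \<in> {a..b}" for t
    using assms that unfolding primitive_on_def by (smt (verit) atLeastAtMost_iff)
  ultimately show ?thesis using continuous_on_cong[OF refl, of "{a..b}" V "\<lambda>t. V a + integral {a..t} G"] by blast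
qed

lemma set_integrable_continuous_mult:
  fixes h G :: "real \<Rightarrow> real"
  assumes "continuous_on {a..b} h" "set_integrable lborel {a..b} G"
  shows "set_integrable lborel {a..b} (\<lambda>t. h t * G t)"
proof -
  have "bounded (h ` {a..b})"
    using assms(1) by (intro compact_imp_bounded compact_continuous_image) auto
  then obtain B where B: "\<And>t. t \<in> {a..b} \<Longrightarrow> \<bar>h t\<bar> \<le> B"
    unfolding bounded_iff by (metis imageI real_norm_def)
  have m: "(\<lambda>t. indicator {a..b} t * h t) \<in> borel_measurable lborel"
    using borel_integrable_atLeastAtMost'[OF assms(1)] unfolding set_integrable_def
    by (auto dest: borel_measurable_integrable)
  have iG: "integrable lborel (\<lambda>t. indicator {a..b} t * G t)"
    using assms(2) by (simp add: set_integrable_def)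
  have "integrable lborel (\<lambda>t. (indicator {a..b} t * h t) * (indicator {a..b} t * G t))"
  proof (rule Bochner_Integration.integrable_bound)
    show "integrable lborel (\<lambda>t. B * (indicator {a..b} t * G t))" using iG by auto
    show "(\<lambda>t. indicator {a..b} t * h t * (indicator {a..b} t * G t)) \<in> borel_measurable lborel"
      using m borel_measurable_integrable[OF iG] by measurable
    have "\<bar>indicator {a..b} t * h t * (indicator {a..b} t * G t)\<bar> \<le> \<bar>B * (indicator {a..b} t * G t)\<bar>" for t
      using B[of t] by (auto simp: indicator_def abs_mult intro!: mult_right_mono)
    then show "AE x in lborel. norm (indicator {a..b} x * h x * (indicator {a..b} x * G x))
        \<le> norm (B * (indicator {a..b} x * G x))" by simp
  qed
  then show ?thesis
    unfolding set_integrable_def by (rule back_subst[of "integrable lborel"]) (auto simp: indicator_def)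
qed

text \<open>By bisection: on short intervals both sides differ by at most \<open>\<epsilon>\<close> times the integral of \<open>\<bar>G\<bar>\<close>.\<close>

lemma primitive_on_chain:
  fixes f f' :: "real \<Rightarrow> real"
  assumes V: "primitive_on a b V G"
    and f: "\<And>x. (f has_real_derivative f' x) (at x)" and f': "continuous_on UNIV f'"
  shows "primitive_on a b (\<lambda>t. f (V t)) (\<lambda>t. f' (V t) * G t)"
proof -
  have cV: "continuous_on {a..b} V" by (rule primitive_on_continuous[OF V])
  have G: "set_integrable lborel {a..b} G" using V by (simp add: primitive_on_def)
  let ?H = "\<lambda>t. f' (V t) * G t"
  have H: "set_integrable lborel {a..b} ?H"
    by (intro set_integrable_continuous_mult G continuous_on_compose2[OF f' cV]) auto
  have absG: "set_integrable lborel {a..b} (\<lambda>t. \<bar>G t\<bar>)"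
    using set_integrable_abs[OF G] .
  have sub: "h integrable_on {s..t}" if "set_integrable lborel {a..b} h" "a \<le> s" "t \<le> b" for h :: "real \<Rightarrow> real" and s t
    by (rule integrable_subinterval_real[OF set_borel_integral_eq_integral(1)[OF that(1)]]) (use that in auto)
  have main: "\<bar>f (V t) - f (V s) - integral {s..t} ?H\<bar> \<le> e * integral {s..t} (\<lambda>r. \<bar>G r\<bar>)"
    if st: "a \<le> s" "s \<le> t" "t \<le> b" and e: "e > 0" for s t e
  proof -
    \<comment> \<open>The bisection principle quantifies over all short intervals around a point;
      the guard makes the claim vacuous for those that leave [a, b].\<close>
    let ?P = "\<lambda>s t. a \<le> s \<and> s \<le> t \<and> t \<le> b \<longrightarrow>
       \<bar>f (V t) - f (V s) - integral {s..t} ?H\<bar> \<le> e * integral {s..t} (\<lambda>r. \<bar>G r\<bar>)"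
    have "?P s t"
      using st(2)
    proof (induction rule: Bolzano)
      case (trans p q r)
      show ?case
      proof
        assume pr: "a \<le> p \<and> p \<le> r \<and> r \<le> b"
        have "integral {p..q} ?H + integral {q..r} ?H = integral {p..r} ?H"
          "integral {p..q} (\<lambda>r. \<bar>G r\<bar>) + integral {q..r} (\<lambda>r. \<bar>G r\<bar>) = integral {p..r} (\<lambda>r. \<bar>G r\<bar>)"
          using pr trans by (auto intro!: Henstock_Kurzweil_Integration.integral_combine sub H absG)
        moreover from this(2) have "e * integral {p..r} (\<lambda>r. \<bar>G r\<bar>) = e * integral {p..q} (\<lambda>r. \<bar>G r\<bar>) + e * integral {q..r} (\<lambda>r. \<bar>G r\<bar>)"
          by (metis distrib_left)
        ultimately show "\<bar>f (V r) - f (V p) - integral {p..r} ?H\<bar> \<le> e * integral {p..r} (\<lambda>r. \<bar>G r\<bar>)"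
          using trans pr by linarith
      qed
    next
      case (local x)
      then have x: "x \<in> {a..b}" using st by auto
      have "isCont f' (V x)" using f' by (simp add: continuous_on_eq_continuous_at)
      then obtain \<eta> where \<eta>: "\<eta> > 0" "\<And>w. \<bar>w - V x\<bar> < \<eta> \<Longrightarrow> \<bar>f' w - f' (V x)\<bar> < e / 2"
        unfolding continuous_at_real_range using e by (metis half_gt_zero real_norm_def)
      obtain d where d: "d > 0" "\<And>r. r \<in> {a..b} \<Longrightarrow> \<bar>r - x\<bar> < d \<Longrightarrow> \<bar>V r - V x\<bar> < \<eta>"
        using cV x \<eta>(1) unfolding continuous_on_iff dist_real_def by metis
      show ?case
      proof (intro exI conjI allI impI)
        show "d > 0" by fact
        fix p q assume pq: "p \<le> x \<and> x \<le> q \<and> q - p < d" and ab: "a \<le> p \<and> p \<le> q \<and> q \<le> b"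
        have near: "\<bar>V r - V x\<bar> < \<eta>" if "r \<in> {p..q}" for r
          using that pq ab by (intro d) auto
        have Vd: "V q - V p = integral {p..q} G" using V ab by (simp add: primitive_on_def)
        \<comment> \<open>The mean value theorem is applied to f between the values V p and V q,
          since V itself need not be differentiable. As both values lie within \<eta> of V x, so
          does z.\<close>
        obtain z where z: "f (V q) - f (V p) = f' z * (V q - V p)" "\<bar>z - V x\<bar> < \<eta>"
        proof -
          have np: "\<bar>V p - V x\<bar> < \<eta>" and nq: "\<bar>V q - V x\<bar> < \<eta>" using near pq by auto
          consider "V p < V q" | "V q < V p" | "V p = V q" by linarith
          then show ?thesis
          proof cases
            case 1
            from MVT2[OF 1, of f f'] f obtain z where "V p < z" "z < V q"
              "f (V q) - f (V p) = (V q - V p) * f' z" by blast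
            then show ?thesis using that[of z] np nq by (auto simp: mult.commute)
          next
            case 2
            from MVT2[OF 2, of f f'] f obtain z where "V q < z" "z < V p"
              "f (V p) - f (V q) = (V p - V q) * f' z" by blast
            then show ?thesis using that[of z] np nq by (auto simp: algebra_simps)
          next
            case 3 then show ?thesis using that[of "V p"] np by auto
          qed
        qed
        have Gi: "G integrable_on {p..q}" and Hi: "?H integrable_on {p..q}"
          and aGi: "(\<lambda>r. \<bar>G r\<bar>) integrable_on {p..q}"
          using ab by (auto intro!: sub G H absG)
        have "f (V q) - f (V p) - integral {p..q} ?H = integral {p..q} (\<lambda>r. f' z * G r - ?H r)"
          unfolding z(1) Vd using Gi Hi
          by (subst Henstock_Kurzweil_Integration.integral_diff) (auto intro!: integrable_on_mult_right)
        also have "\<bar>\<dots>\<bar> \<le> integral {p..q} (\<lambda>r. e * \<bar>G r\<bar>)"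
        proof (rule integral_norm_bound_integral[where 'a=real and 'n=real, unfolded real_norm_def])
          show "(\<lambda>r. f' z * G r - ?H r) integrable_on {p..q}"
            using Gi Hi by (intro integrable_diff integrable_on_mult_right) auto
          show "(\<lambda>r. e * \<bar>G r\<bar>) integrable_on {p..q}" using aGi by (rule integrable_on_mult_right)
          fix r assume r: "r \<in> {p..q}"
          have "\<bar>f' z - f' (V r)\<bar> \<le> e"
            using \<eta>(2)[OF z(2)] \<eta>(2)[OF near[OF r]] by linarith
          then have "\<bar>f' z - f' (V r)\<bar> * \<bar>G r\<bar> \<le> e * \<bar>G r\<bar>" by (rule mult_right_mono) simp
          then show "\<bar>f' z * G r - ?H r\<bar> \<le> e * \<bar>G r\<bar>"
            by (simp add: abs_mult[symmetric] left_diff_distrib)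
        qed
        finally show "\<bar>f (V q) - f (V p) - integral {p..q} ?H\<bar> \<le> e * integral {p..q} (\<lambda>r. \<bar>G r\<bar>)"
          by simp
      qed
    qed
    with st show ?thesis by blast
  qed
  show ?thesis
    unfolding primitive_on_def
  proof (intro conjI allI impI H)
    fix s t assume st: "a \<le> s \<and> s \<le> t \<and> t \<le> b"
    let ?D = "\<bar>f (V t) - f (V s) - integral {s..t} ?H\<bar>" and ?I = "integral {s..t} (\<lambda>r. \<bar>G r\<bar>)"
    have I0: "?I \<ge> 0" by (intro integral_nonneg sub absG) (use st in auto)
    have "?D \<le> e" if "e > 0" for e
    proof -
      \<comment> \<open>Adding 1 keeps the quotient defined when the integral of
        \<open>\<bar>G\<bar>\<close> is 0.\<close>
      have "?D \<le> e / (?I + 1) * ?I" using main[of s t "e / (?I + 1)"] st that I0 by simp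
      also have "\<dots> \<le> e" using that I0 by (simp add: field_simps)
      finally show ?thesis .
    qed
    then have "?D \<le> 0" by (meson field_le_epsilon add_0 le_less_linear linorder_not_le dense)
    then show "f (V t) - f (V s) = integral {s..t} ?H" by simp
  qed
qed

lemma primitive_on_lincomb:
  assumes "primitive_on a b V G" "primitive_on a b W K"
  shows "primitive_on a b (\<lambda>t. x * V t + y * W t) (\<lambda>t. x * G t + y * K t)"
  unfolding primitive_on_def
proof (intro conjI allI impI)
  have G: "set_integrable lborel {a..b} G" "set_integrable lborel {a..b} K"
    using assms by (auto simp: primitive_on_def)
  then show "set_integrable lborel {a..b} (\<lambda>t. x * G t + y * K t)"
    by (intro set_integral_add set_integrable_mult_right) auto
  fix s t assume st: "a \<le> s \<and> s \<le> t \<and> t \<le> b"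
  have "G integrable_on {s..t}" "K integrable_on {s..t}"
    by (rule integrable_subinterval_real[OF set_borel_integral_eq_integral(1)[OF G(1)]]
        integrable_subinterval_real[OF set_borel_integral_eq_integral(1)[OF G(2)]], use st in auto)+
  then have "integral {s..t} (\<lambda>t. x * G t + y * K t) = x * integral {s..t} G + y * integral {s..t} K"
    by (subst Henstock_Kurzweil_Integration.integral_add) (auto intro!: integrable_on_mult_right)
  also have "\<dots> = x * (V t - V s) + y * (W t - W s)"
    using assms st by (simp add: primitive_on_def)
  finally show "x * V t + y * W t - (x * V s + y * W s) = integral {s..t} (\<lambda>t. x * G t + y * K t)"
    by (simp add: algebra_simps)
qed

text \<open>By polarization from the chain rule for the square.\<close>

lemma primitive_on_mult:
  assumes "primitive_on a b V G" "primitive_on a b W K"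
  shows "primitive_on a b (\<lambda>t. V t * W t) (\<lambda>t. G t * W t + V t * K t)"
proof -
  have sq: "primitive_on a b (\<lambda>t. (U t)\<^sup>2) (\<lambda>t. 2 * U t * L t)" if "primitive_on a b U L" for U L
    by (rule primitive_on_chain[OF that, of "\<lambda>x. x\<^sup>2" "\<lambda>x. 2 * x"])
      (auto intro!: derivative_eq_intros continuous_intros)
  have "primitive_on a b (\<lambda>t. (1/4) * (1 * V t + 1 * W t)\<^sup>2 + (-1/4) * (1 * V t + (-1) * W t)\<^sup>2)
     (\<lambda>t. (1/4) * (2 * (1 * V t + 1 * W t) * (1 * G t + 1 * K t))
        + (-1/4) * (2 * (1 * V t + (-1) * W t) * (1 * G t + (-1) * K t)))"
    by (intro primitive_on_lincomb sq assms)
  moreover have "(1/4) * (1 * V t + 1 * W t)\<^sup>2 + (-1/4) * (1 * V t + (-1) * W t)\<^sup>2 = V t * W t" for t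
    by (simp add: power2_eq_square algebra_simps)
  moreover have "(1/4) * (2 * (1 * V t + 1 * W t) * (1 * G t + 1 * K t))
        + (-1/4) * (2 * (1 * V t + (-1) * W t) * (1 * G t + (-1) * K t)) = G t * W t + V t * K t" for t
    by (simp add: algebra_simps)
  ultimately show ?thesis by simp
qed

lemma primitive_on_C1:
  assumes "\<And>t. t \<in> {a..b} \<Longrightarrow> (F has_real_derivative F' t) (at t)" "continuous_on {a..b} F'"
  shows "primitive_on a b F F'"
  unfolding primitive_on_def
proof (intro conjI allI impI)
  show "set_integrable lborel {a..b} F'" by (rule borel_integrable_atLeastAtMost'[OF assms(2)])
  fix s t assume st: "a \<le> s \<and> s \<le> t \<and> t \<le> b"
  have "(F' has_integral (F t - F s)) {s..t}"
    using st by (intro fundamental_theorem_of_calculus)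
      (auto simp flip: has_real_derivative_iff_has_vector_derivative intro!: DERIV_subset[OF assms(1)])
  then show "F t - F s = integral {s..t} F'" by (simp add: integral_unique)
qed

text \<open>The integrand is the derivative of f(V) \<Phi> in the sense of
  \<open>primitive_on\<close>, and that product is 0 at both endpoints.\<close>

lemma primitive_on_by_parts:
  assumes V: "primitive_on a b V G" and ab: "a \<le> b"
    and f: "\<And>x. (f has_real_derivative f' x) (at x)" and f': "continuous_on UNIV f'"
    and \<Phi>: "\<And>t. t \<in> {a..b} \<Longrightarrow> (\<Phi> has_real_derivative \<Phi>' t) (at t)" "continuous_on {a..b} \<Phi>'"
    and 0: "\<Phi> a = 0" "\<Phi> b = 0"
  shows "(LINT t:{a..b}|lborel. f (V t) * \<Phi>' t + f' (V t) * G t * \<Phi> t) = 0"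
proof -
  have P: "primitive_on a b (\<lambda>t. f (V t) * \<Phi> t) (\<lambda>t. f' (V t) * G t * \<Phi> t + f (V t) * \<Phi>' t)"
    by (intro primitive_on_mult primitive_on_chain[OF V] primitive_on_C1 f f' \<Phi>)
  then have "(LINT t:{a..b}|lborel. f' (V t) * G t * \<Phi> t + f (V t) * \<Phi>' t) = 0"
    using ab 0 unfolding primitive_on_def
    by (metis (no_types, lifting) diff_self mult_zero_right order_refl set_borel_integral_eq_integral(2))
  then show ?thesis by (simp add: add.commute)
qed

subsection \<open>The fundamental lemma of the calculus of variations\<close>

lemma obox_Int: "obox N a b \<inter> obox N c d = obox N (\<lambda>j. max (a j) (c j)) (\<lambda>j. min (b j) (d j))"
proof -
  have "{a j<..<b j} \<inter> {c j<..<d j} = {max (a j) (c j)<..<min (b j) (d j)}" for j by auto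
  then show ?thesis by (simp only: PiE_Int)
qed

lemma in_large_obox:
  assumes "x \<in> topspace (Rn N)"
  obtains n0 :: nat where "\<And>n. n \<ge> n0 \<Longrightarrow> x \<in> obox N (\<lambda>_. - real n) (\<lambda>_. real n)"
proof -
  obtain n0 :: nat where n: "Max ((\<lambda>j. \<bar>x j\<bar>) ` {..<N}) < real n0" using reals_Archimedean2 by blast
  have *: "\<bar>x j\<bar> < real n0" if "j < N" for j
    using n that by (intro le_less_trans[OF Max_ge n]) auto
  have "x \<in> obox N (\<lambda>_. - real n) (\<lambda>_. real n)" if "n \<ge> n0" for n
    using * that assms unfolding topspace_product_topology PiE_iff
    by (fastforce simp: abs_less_iff intro: less_le_trans)
  then show ?thesis by (rule that)
qed

text \<open>A half-space c < w i is a countable union of boxes that grow in every direction except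
  that the lower end in coordinate i stays at c. So the boxes, which are stable under intersection,
  generate the product \<sigma>-algebra.\<close>

lemma sets_PN_boxes: "sets (PN N) = sigma_sets (topspace (Rn N)) (range (\<lambda>(a, b). obox N a b))"
proof
  let ?B = "sigma (topspace (Rn N)) (range (\<lambda>(a, b). obox N a b))"
  have sub: "range (\<lambda>(a, b). obox N a b) \<subseteq> Pow (topspace (Rn N))"
    by (auto simp: PiE_iff)
  have "sets (PN N) \<subseteq> sets ?B"
  proof (rule sets_PiM_in_sets)
    show "space ?B = (\<Pi>\<^sub>E i\<in>{..<N}. space lborel)" by (simp add: space_measure_of_conv)
    fix i A assume i: "i \<in> {..<N}" and A: "A \<in> sets (lborel :: real measure)"
    have "(\<lambda>x. x i) \<in> borel_measurable ?B"
      unfolding borel_measurable_iff_greater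
    proof
      fix c :: real
      have "{w \<in> space ?B. c < w i} = (\<Union>n::nat. obox N ((\<lambda>_. - real n)(i := c)) (\<lambda>_. real n))" (is "?L = ?R")
      proof (intro equalityI subsetI)
        fix w assume w: "w \<in> ?L"
        then have wt: "w \<in> topspace (Rn N)" by (simp add: space_measure_of_conv)
        obtain n where n: "w \<in> obox N (\<lambda>_. - real n) (\<lambda>_. real n)"
          by (rule in_large_obox[OF wt]) blast
        have "w \<in> obox N ((\<lambda>_. - real n)(i := c)) (\<lambda>_. real n)"
        proof (rule PiE_I)
          fix j assume "j \<in> {..<N}"
          with PiE_mem[OF n this] w show "w j \<in> {((\<lambda>_. - real n)(i := c)) j<..<real n}" by simp
        qed (use PiE_arb[OF n] in blast)
        then show "w \<in> ?R" by (rule UN_I[OF UNIV_I])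
      qed (use i in \<open>auto simp: PiE_iff space_measure_of_conv split: if_splits\<close>)
      also have "\<dots> \<in> sets ?B"
      proof (intro sets.countable_UN)
        have "obox N a b \<in> sets ?B" for a b
        proof -
          have "obox N a b \<in> range (\<lambda>(a, b). obox N a b)"
            by (rule image_eqI[of _ _ "(a, b)"]) simp_all
          then have "obox N a b \<in> sigma_sets (topspace (Rn N)) (range (\<lambda>(a, b). obox N a b))"
            by (rule sigma_sets.Basic)
          then show ?thesis by (simp only: sets_measure_of[OF sub])
        qed
        then show "range (\<lambda>n. obox N ((\<lambda>_. - real n)(i := c)) (\<lambda>_. real n)) \<subseteq> sets ?B"
          by (intro image_subsetI)
      qed
      finally show "{w \<in> space ?B. c < w i} \<in> sets ?B" .
    qed
    then have "(\<lambda>x. x i) -` A \<inter> space ?B \<in> sets ?B" by (rule measurable_sets) (use A in simp)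
    moreover have "(\<lambda>x. x i) -` A \<inter> space ?B = {x \<in> space ?B. x i \<in> A}" by blast
    ultimately show "{x \<in> space ?B. x i \<in> A} \<in> sets ?B" by argo
  qed
  then show "sets (PN N) \<subseteq> sigma_sets (topspace (Rn N)) (range (\<lambda>(a, b). obox N a b))"
    using sub by (simp add: sets_measure_of_conv)
  show "sigma_sets (topspace (Rn N)) (range (\<lambda>(a, b). obox N a b)) \<subseteq> sets (PN N)"
    unfolding space_PN[symmetric] by (intro sets.sigma_sets_subset) (auto intro: sets_obox)
qed

text \<open>A Dynkin argument: the sets over which f integrates to 0 contain the boxes and are
  closed under complements and disjoint unions, so they are all measurable sets. The sets where f is
  positive and where it is negative then give that the integral of \<open>\<bar>f\<bar>\<close> is
  0.\<close>

lemma AE_zero_boxes: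
  assumes f: "integrable (PN N) f"
    and box0: "\<And>a b. (LINT x:obox N a b|PN N. f x) = (0::real)"
  shows "AE x in PN N. f x = 0"
proof -
  have si: "set_integrable (PN N) A f" if "A \<in> sets (PN N)" for A
    unfolding set_integrable_def by (rule integrable_mult_indicator[OF that f])
  \<comment> \<open>The whole space is exhausted by boxes. Its integral is what the complement step
    of the induction subtracts from.\<close>
  have all: "(LINT x|PN N. f x) = 0"
  proof (rule LIMSEQ_unique)
    show "(\<lambda>n. LINT x:obox N (\<lambda>_. - real n) (\<lambda>_. real n)|PN N. f x) \<longlonglongrightarrow> (LINT x|PN N. f x)"
      unfolding set_lebesgue_integral_def
    proof (rule integral_dominated_convergence[where w = "\<lambda>x. \<bar>f x\<bar>"])
      show "AE x in PN N. (\<lambda>n. indicator (obox N (\<lambda>_. - real n) (\<lambda>_. real n)) x *\<^sub>R f x) \<longlonglongrightarrow> f x"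
      proof (rule AE_I2)
        fix x assume x: "x \<in> space (PN N)"
        obtain n0 where "x \<in> obox N (\<lambda>_. - real n) (\<lambda>_. real n)" if "n \<ge> n0" for n :: nat
          using in_large_obox x unfolding space_PN by blast
        then have "eventually (\<lambda>n. indicator (obox N (\<lambda>_. - real n) (\<lambda>_. real n)) x *\<^sub>R f x = f x) sequentially"
          by (intro eventually_sequentiallyI[of n0]) auto
        then show "(\<lambda>n. indicator (obox N (\<lambda>_. - real n) (\<lambda>_. real n)) x *\<^sub>R f x) \<longlonglongrightarrow> f x"
          by (rule tendsto_eventually)
      qed
    qed (use f in \<open>auto intro!: borel_measurable_scaleR borel_measurable_indicator sets_obox
        dest: borel_measurable_integrable simp: indicator_def\<close>)
    show "(\<lambda>n. LINT x:obox N (\<lambda>_. - real n) (\<lambda>_. real n)|PN N. f x) \<longlonglongrightarrow> 0"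
      by (simp add: box0)
  qed
  have st: "Int_stable (range (\<lambda>(a, b). obox N a b))"
    unfolding Int_stable_def using obox_Int by (fastforce intro: rev_image_eqI)
  have sub: "range (\<lambda>(a, b). obox N a b) \<subseteq> Pow (topspace (Rn N))"
    by (auto simp: PiE_iff)
  have A0: "(LINT x:A|PN N. f x) = 0" if "A \<in> sets (PN N)" for A
    using st sub that[unfolded sets_PN_boxes]
  proof (induction rule: sigma_sets_induct_disjoint)
    case (basic A)
    then show ?case using box0 by auto
  next
    case empty
    show ?case by (simp add: set_lebesgue_integral_def)
  next
    case (compl A)
    then have A: "A \<in> sets (PN N)" by (simp add: sets_PN_boxes)
    then have "A \<subseteq> space (PN N)" by (rule sets.sets_into_space)
    then have un: "A \<union> (topspace (Rn N) - A) = space (PN N)" by (auto simp: space_PN)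
    have "(LINT x:A \<union> (topspace (Rn N) - A)|PN N. f x)
        = (LINT x:A|PN N. f x) + (LINT x:topspace (Rn N) - A|PN N. f x)"
      using A by (intro set_integral_Un si) (auto simp flip: space_PN)
    moreover have "(LINT x:A \<union> (topspace (Rn N) - A)|PN N. f x) = (LINT x|PN N. f x)"
      unfolding un set_lebesgue_integral_def by (intro Bochner_Integration.integral_cong) auto
    ultimately show ?case using compl all by simp
  next
    case (union A)
    then have A: "A i \<in> sets (PN N)" for i by (auto simp: sets_PN_boxes)
    have "(LINT x:(\<Union>i. A i)|PN N. f x) = (\<Sum>i. (LINT x:(A i)|PN N. f x))"
      using union(1) A by (intro lebesgue_integral_countable_add si) (auto simp: disjoint_family_on_def)
    then show ?case using union by simp
  qed
  have fm[measurable]: "f \<in> borel_measurable (PN N)" using f by auto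
  have "(LINT x|PN N. \<bar>f x\<bar>) = (LINT x|PN N. indicator {x\<in>space (PN N). f x > 0} x *\<^sub>R f x
       - indicator {x\<in>space (PN N). f x < 0} x *\<^sub>R f x)"
    by (intro Bochner_Integration.integral_cong) (auto simp: indicator_def)
  also have "\<dots> = 0"
    using A0[of "{x\<in>space (PN N). f x > 0}"] A0[of "{x\<in>space (PN N). f x < 0}"]
      si[of "{x\<in>space (PN N). f x > 0}"] si[of "{x\<in>space (PN N). f x < 0}"]
    by (subst Bochner_Integration.integral_diff) (auto simp: set_lebesgue_integral_def set_integrable_def)
  finally have "(LINT x|PN N. \<bar>f x\<bar>) = 0" .
  then show ?thesis
    using integral_nonneg_eq_0_iff_AE[of "PN N" "\<lambda>x. \<bar>f x\<bar>"] f by simp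
qed

text \<open>Parametrises the product test functions \<open>tensor N \<beta>\<close>. Each factor
  vanishes at the endpoints of its side as well, which is what makes boundary terms
  disappear.\<close>

definition box_test :: "nat \<Rightarrow> (nat \<Rightarrow> real) \<Rightarrow> (nat \<Rightarrow> real) \<Rightarrow> (nat \<Rightarrow> real \<Rightarrow> real) \<Rightarrow> bool" where
  "box_test N a b \<beta> \<longleftrightarrow> (\<forall>j<N. smooth (\<beta> j) \<and> (\<forall>t. t \<notin> {a j<..<b j} \<longrightarrow> \<beta> j t = 0))"

lemma tensor_measurable:
  assumes "\<And>j. j < N \<Longrightarrow> smooth (\<beta> j)"
  shows "tensor N \<beta> \<in> borel_measurable (PN N)"
proof -
  have "(\<lambda>x. indicator (topspace (Rn N)) x * tensor N \<beta> x) \<in> borel_measurable (PN N)"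
    using assms by (intro measurable_continuous_on_open continuous_map_from_subtopology
        continuous_map_tensor openin_topspace) auto
  then show ?thesis
    by (rule measurable_cong[THEN iffD1, rotated]) (auto simp: space_PiM PiE_iff)
qed

lemma box_test_measurable[measurable]: "box_test N a b \<beta> \<Longrightarrow> tensor N \<beta> \<in> borel_measurable (PN N)"
  by (rule tensor_measurable) (simp add: box_test_def)

lemma tensor_zero:
  assumes "box_test N a b \<beta>" "x \<in> extensional {..<N}" "x \<notin> obox N a b" shows "tensor N \<beta> x = 0"
proof -
  from assms(2,3) obtain j where "j < N" "x j \<notin> {a j<..<b j}" by (auto simp: PiE_iff)
  with assms(1) show ?thesis by (auto simp: tensor_def box_test_def)
qed

lemma smooth_bounded:
  assumes "smooth f" "\<And>t. t \<notin> {a<..<b} \<Longrightarrow> f t = 0"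
  obtains B where "\<And>t. \<bar>f t\<bar> \<le> B"
proof -
  have "bounded (f ` {a..b})"
    using assms(1) by (intro compact_imp_bounded compact_continuous_image smooth_continuous) auto
  then obtain B where B: "\<And>t. t \<in> {a..b} \<Longrightarrow> \<bar>f t\<bar> \<le> B"
    unfolding bounded_iff by (metis imageI real_norm_def)
  have "\<bar>f t\<bar> \<le> max B 0" for t
    using B[of t] assms(2)[of t] by (cases "t \<in> {a<..<b}") auto
  then show ?thesis using that by blast
qed

lemma tensor_bounded:
  assumes "box_test N a b \<beta>" obtains B where "B \<ge> 0" "\<And>x. \<bar>tensor N \<beta> x\<bar> \<le> B"
proof -
  have "\<exists>B. \<forall>t. \<bar>\<beta> j t\<bar> \<le> B" if "j < N" for j
    using assms that smooth_bounded[of "\<beta> j" "a j" "b j"] unfolding box_test_def by metis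
  then obtain B where B: "\<And>j t. j < N \<Longrightarrow> \<bar>\<beta> j t\<bar> \<le> B j" by metis
  have "\<bar>tensor N \<beta> x\<bar> \<le> (\<Prod>j<N. B j)" for x
    unfolding tensor_def abs_prod using B by (intro prod_mono) auto
  then show ?thesis using that by (meson abs_ge_zero order_trans)
qed

text \<open>Products of bumps stay between 0 and 1 and converge to the indicator of a box, so
  dominated convergence turns vanishing tests into vanishing box integrals.\<close>

lemma AE_zero_box_tests:
  assumes z: "integrable (PN N) z"
    and tst: "\<And>\<beta>. box_test N a b \<beta> \<Longrightarrow> (LINT x|PN N. z x * tensor N \<beta> x) = 0"
  shows "AE x in PN N. x \<in> obox N a b \<longrightarrow> z x = 0"
proof -
  have zm[measurable]: "z \<in> borel_measurable (PN N)" using z by auto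
  have "AE x in PN N. indicator (obox N a b) x * z x = 0"
  proof (rule AE_zero_boxes)
    show "integrable (PN N) (\<lambda>x. indicator (obox N a b) x * z x)"
      using integrable_mult_indicator[OF sets_obox z] by simp
    fix c d
    \<comment> \<open>The sides of the intersection with the box (a, b), so that the bumps remain
      admissible there. A side may be empty, and then the bump is identically 0, as is the
      indicator.\<close>
    define p q where "p j = max (c j) (a j)" and "q j = min (d j) (b j)" for j
    define \<beta> where "\<beta> n j = bump (p j) (q j) n" for n :: nat and j :: nat
    have bt: "box_test N a b (\<beta> n)" for n
      unfolding box_test_def \<beta>_def by (auto intro!: smooth_bump bump_0 simp: p_def q_def)
    have lim: "(\<lambda>n. tensor N (\<beta> n) x) \<longlonglongrightarrow> indicator (obox N p q) x" if "x \<in> space (PN N)" for x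
    proof -
      have "(\<lambda>n. tensor N (\<beta> n) x) \<longlonglongrightarrow> (\<Prod>j<N. indicator {p j<..<q j} (x j))"
        unfolding tensor_def \<beta>_def by (intro tendsto_prod bump_lim)
      moreover have "(\<Prod>j<N. indicator {p j<..<q j} (x j)) = (indicator (obox N p q) x :: real)"
        using that unfolding space_PiM by (auto simp: indicator_def PiE_iff prod_zero_iff)
      ultimately show ?thesis by simp
    qed
    have le1: "\<bar>tensor N (\<beta> n) x\<bar> \<le> 1" for n x
      unfolding tensor_def abs_prod \<beta>_def by (intro prod_le_1) (auto simp: bump_range)
    have "(\<lambda>n. LINT x|PN N. z x * tensor N (\<beta> n) x) \<longlonglongrightarrow> (LINT x|PN N. z x * indicator (obox N p q) x)"
    proof (rule integral_dominated_convergence[where w = "\<lambda>x. \<bar>z x\<bar>"])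
      show "AE x in PN N. (\<lambda>n. z x * tensor N (\<beta> n) x) \<longlonglongrightarrow> z x * indicator (obox N p q) x"
        by (rule AE_I2) (intro tendsto_intros lim)
      show "AE x in PN N. norm (z x * tensor N (\<beta> n) x) \<le> \<bar>z x\<bar>" for n
        using le1[of n] by (intro AE_I2) (auto simp: abs_mult intro: mult_left_le)
      show "(\<lambda>x. z x * tensor N (\<beta> n) x) \<in> borel_measurable (PN N)" for n
        using box_test_measurable[OF bt[of n]] by measurable
      show "(\<lambda>x. z x * indicator (obox N p q) x) \<in> borel_measurable (PN N)"
        by (intro borel_measurable_times borel_measurable_indicator sets_obox zm)
    qed (use z in auto)
    then have "(LINT x|PN N. z x * indicator (obox N p q) x) = 0"
      by (simp add: tst[OF bt] LIMSEQ_const_iff)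
    moreover have "indicator (obox N c d) x * (indicator (obox N a b) x * z x) = z x * indicator (obox N p q) x" for x
      using obox_Int[of N c d a b] unfolding p_def q_def by (auto simp: indicator_def)
    ultimately show "(LINT x:obox N c d|PN N. indicator (obox N a b) x * z x) = 0"
      unfolding set_lebesgue_integral_def real_scaleR_def by presburger
  qed
  then show ?thesis by (auto simp: indicator_def)
qed

lemma tensor_zero_closed:
  assumes "openin (Rn N) \<Omega>" "box_test N a b \<beta>" "x \<in> \<Omega> - box_closed N a b"
  shows "tensor N \<beta> x = 0"
  using assms(3) obox_subset[of N a b] openin_Rn_extensional[OF assms(1)]
  by (intro tensor_zero[OF assms(2)]) auto

lemma box_test_function:
  assumes "openin (Rn N) \<Omega>" "box_closed N a b \<subseteq> \<Omega>" "box_test N a b \<beta>"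
  shows "tensor N \<beta> \<in> test_functions N \<Omega>"
proof -
  have "C_k k N \<Omega> (tensor N \<beta>)" for k
    using assms(3) by (intro C_k_tensor assms(1)) (auto simp: box_test_def)
  then have "tensor N \<beta> \<in> C_k_compact k N \<Omega>" for k
    unfolding C_k_compact_def mem_Collect_eq using tensor_zero_closed[OF assms(1,3)]
    by (intro conjI exI[of _ "box_closed N a b"] compactin_box assms(2)) auto
  then show ?thesis by (simp add: test_functions_def)
qed

section \<open>Passage between the completed measure and the product measure\<close>

lemma leb_sets: "A \<in> sets (PN N) \<Longrightarrow> A \<in> sets (leb N)"
  by (simp add: leb_def)

lemma leb_measurable: "f \<in> borel_measurable (PN N) \<Longrightarrow> f \<in> borel_measurable (leb N)"
  by (auto simp: leb_def intro: measurable_completion)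

lemma AE_leb: "(AE x in leb N. P x) \<longleftrightarrow> (AE x in PN N. P x)"
  unfolding leb_def by (rule AE_completion_iff)

lemma leb_integrable_rep:
  fixes g :: "point \<Rightarrow> real"
  assumes "integrable (leb N) g"
  obtains g' where "integrable (PN N) g'" "AE x in leb N. g x = g' x"
proof -
  have "g \<in> borel_measurable (completion (PN N))" using assms by (auto simp: leb_def)
  then obtain g' where g': "g' \<in> borel_measurable (PN N)" "AE x in PN N. g x = g' x"
    using completion_ex_borel_measurable_real by blast
  have ae: "AE x in leb N. g x = g' x" using g' by (simp add: AE_leb)
  then have "integrable (leb N) g'"
    using integrable_cong_AE_imp[OF assms leb_measurable[OF g'(1)]] by (simp add: eq_commute)
  then have "integrable (PN N) g'" using integrable_completion[OF g'(1)] by (simp add: leb_def)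
  with ae show ?thesis using that by blast
qed

lemma leb_integral: "f \<in> borel_measurable (PN N) \<Longrightarrow> integral\<^sup>L (leb N) f = (integral\<^sup>L (PN N) f :: real)"
  by (simp add: leb_def integral_completion)

lemma leb_integrable: "f \<in> borel_measurable (PN N) \<Longrightarrow> integrable (leb N) f \<longleftrightarrow> integrable (PN N) (f :: _ \<Rightarrow> real)"
  by (simp add: leb_def integrable_completion)

text \<open>Inside \<open>\<Omega>\<close> the factor h vanishes off the box, and off the box g'
  vanishes almost everywhere. So g may be replaced by a representative of its restriction to the
  box, and the integral moves to the product measure.\<close>

lemma LINT_box_rep:
  fixes g g' h :: "point \<Rightarrow> real"
  assumes ab: "box_closed N a b \<subseteq> \<Omega>"
    and gi: "integrable (leb N) (\<lambda>x. indicator (box_closed N a b) x * g x)"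
    and g': "g' \<in> borel_measurable (PN N)" "AE x in leb N. indicator (box_closed N a b) x * g x = g' x"
    and h: "h \<in> borel_measurable (PN N)" "\<And>x. x \<in> \<Omega> - box_closed N a b \<Longrightarrow> h x = 0"
  shows "(LINT x:\<Omega>|leb N. g x * h x) = (LINT x|PN N. g' x * h x)"
proof -
  have [measurable]: "h \<in> borel_measurable (PN N)" "g' \<in> borel_measurable (PN N)"
    using h g' by auto
  have "(LINT x|PN N. g' x * h x) = (LINT x|leb N. g' x * h x)"
    by (subst leb_integral) auto
  also have "\<dots> = (LINT x|leb N. (indicator (box_closed N a b) x * g x) * h x)"
  proof (rule integral_cong_AE)
    show "(\<lambda>x. g' x * h x) \<in> borel_measurable (leb N)" by (rule leb_measurable) measurable
    show "(\<lambda>x. indicator (box_closed N a b) x * g x * h x) \<in> borel_measurable (leb N)"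
      by (intro borel_measurable_times borel_measurable_integrable[OF gi] leb_measurable) measurable
  qed (use g'(2) in auto)
  also have "\<dots> = (LINT x:\<Omega>|leb N. g x * h x)"
    unfolding set_lebesgue_integral_def
  proof (rule Bochner_Integration.integral_cong[OF refl])
    fix x
    show "indicator (box_closed N a b) x * g x * h x = indicator \<Omega> x *\<^sub>R (g x * h x)"
      using ab h(2)[of x] by (auto simp: indicator_def)
  qed
  finally show ?thesis by simp
qed

text \<open>On a closed box g is integrable and has a representative for the product measure; there
  product test functions suffice, and they are test functions on all of
  \<open>\<Omega>\<close>.\<close>

lemma fundamental_lemma:
  assumes \<Omega>: "openin (Rn N) \<Omega>" and g: "locally_integrable N \<Omega> g"
    and tst: "\<And>\<eta>. \<eta> \<in> test_functions N \<Omega> \<Longrightarrow> (LINT x:\<Omega>|leb N. g x * \<eta> x) = 0"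
  shows "AE x in leb N. x \<in> \<Omega> \<longrightarrow> g x = 0"
proof (rule AE_open[OF \<Omega>])
  fix a b assume ab: "box_closed N a b \<subseteq> \<Omega>"
  have "set_integrable (leb N) (box_closed N a b) g"
    using g ab compactin_box unfolding locally_integrable_def by blast
  then have gi: "integrable (leb N) (\<lambda>x. indicator (box_closed N a b) x * g x)"
    by (simp add: set_integrable_def)
  obtain g' where g': "integrable (PN N) g'" "AE x in leb N. indicator (box_closed N a b) x * g x = g' x"
    by (rule leb_integrable_rep[OF gi])
  have "AE x in PN N. x \<in> obox N a b \<longrightarrow> g' x = 0"
  proof (rule AE_zero_box_tests[OF g'(1)])
    fix \<beta> assume \<beta>: "box_test N a b \<beta>"
    have "(LINT x|PN N. g' x * tensor N \<beta> x) = (LINT x:\<Omega>|leb N. g x * tensor N \<beta> x)"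
      by (rule LINT_box_rep[symmetric, OF ab gi borel_measurable_integrable[OF g'(1)] g'(2)
          box_test_measurable[OF \<beta>] tensor_zero_closed[OF \<Omega> \<beta>]])
    also have "\<dots> = 0" by (rule tst[OF box_test_function[OF \<Omega> ab \<beta>]])
    finally show "(LINT x|PN N. g' x * tensor N \<beta> x) = 0" .
  qed
  then have "AE x in leb N. x \<in> obox N a b \<longrightarrow> g' x = 0" by (simp add: AE_leb)
  with g'(2) show "AE x in leb N. x \<in> obox N a b \<longrightarrow> g x = 0"
    by eventually_elim (use obox_subset[of N a b] in \<open>auto simp: indicator_def split: if_splits\<close>)
qed

subsection \<open>Absolute continuity on lines\<close>

abbreviation PJ :: "nat \<Rightarrow> nat \<Rightarrow> point measure" where
  "PJ N i \<equiv> (\<Pi>\<^sub>M j\<in>{..<N}-{i}. (lborel :: real measure))"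

lemma pair_PJ: "pair_sigma_finite (PJ N i) (lborel :: real measure)"
proof -
  interpret product_sigma_finite "\<lambda>_::nat. lborel :: real measure" ..
  have "sigma_finite_measure (PJ N i)" by (rule sigma_finite) simp
  then show ?thesis by (intro pair_sigma_finite.intro sigma_finite_lborel)
qed

lemma measurable_upd[measurable]:
  assumes "i < N"
  shows "(\<lambda>(y, t). y(i := t)) \<in> PJ N i \<Otimes>\<^sub>M (lborel :: real measure) \<rightarrow>\<^sub>M PN N"
proof -
  have "(\<lambda>p. (fst p)(i := snd p)) \<in> PJ N i \<Otimes>\<^sub>M (lborel :: real measure) \<rightarrow>\<^sub>M PN N"
    by (rule measurable_fun_upd[where J = "{..<N} - {i}"]) (use assms in auto)
  then show ?thesis by (simp add: split_beta')
qed

text \<open>A product measure is determined by its values on rectangles, and the preimage of a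
  rectangle under \<open>y(i := t)\<close> is the rectangle with side i split off.\<close>

lemma distr_upd:
  assumes "i < N"
  shows "distr (PJ N i \<Otimes>\<^sub>M lborel) (PN N) (\<lambda>(y, t). y(i := t)) = PN N"
proof -
  interpret product_sigma_finite "\<lambda>_::nat. lborel :: real measure" ..
  interpret pair_sigma_finite "PJ N i" "lborel :: real measure" by (rule pair_PJ)
  show ?thesis
  proof (rule PiM_eqI)
    fix A :: "nat \<Rightarrow> real set" assume A: "\<And>j. j \<in> {..<N} \<Longrightarrow> A j \<in> sets lborel"
    have eq: "(\<lambda>(y, t). y(i := t)) -` Pi\<^sub>E {..<N} A \<inter> space (PJ N i \<Otimes>\<^sub>M lborel) = Pi\<^sub>E ({..<N} - {i}) A \<times> A i"
    proof (intro set_eqI iffI)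
      fix p assume "p \<in> (\<lambda>(y, t). y(i := t)) -` Pi\<^sub>E {..<N} A \<inter> space (PJ N i \<Otimes>\<^sub>M lborel)"
      then have p: "(fst p)(i := snd p) \<in> Pi\<^sub>E {..<N} A" "fst p \<in> extensional ({..<N} - {i})"
        unfolding space_pair_measure space_PiM by (simp_all add: split_beta' mem_Times_iff PiE_def)
      then have "fst p j \<in> A j" if "j \<in> {..<N} - {i}" for j
        using that PiE_mem[OF p(1), of j] by simp
      moreover have "snd p \<in> A i" using PiE_mem[OF p(1), of i] assms by simp
      ultimately show "p \<in> Pi\<^sub>E ({..<N} - {i}) A \<times> A i"
        using p(2) by (simp add: mem_Times_iff PiE_iff)
    next
      fix p assume "p \<in> Pi\<^sub>E ({..<N} - {i}) A \<times> A i"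
      then have p: "fst p \<in> extensional ({..<N} - {i})" "\<And>j. j \<in> {..<N} - {i} \<Longrightarrow> fst p j \<in> A j" "snd p \<in> A i"
        by (auto simp: mem_Times_iff PiE_iff)
      have "(fst p)(i := snd p) \<in> Pi\<^sub>E {..<N} A"
        using p assms by (auto simp: PiE_iff extensional_def)
      then show "p \<in> (\<lambda>(y, t). y(i := t)) -` Pi\<^sub>E {..<N} A \<inter> space (PJ N i \<Otimes>\<^sub>M lborel)"
        using p by (simp add: space_pair_measure space_PiM mem_Times_iff split_beta' PiE_iff)
    qed
    have "emeasure (distr (PJ N i \<Otimes>\<^sub>M lborel) (PN N) (\<lambda>(y, t). y(i := t))) (Pi\<^sub>E {..<N} A)
      = emeasure (PJ N i \<Otimes>\<^sub>M lborel) (Pi\<^sub>E ({..<N} - {i}) A \<times> A i)"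
      using A assms by (subst emeasure_distr) (auto simp: eq intro!: measurable_upd sets_PiM_I_finite)
    also have "\<dots> = emeasure (PJ N i) (Pi\<^sub>E ({..<N} - {i}) A) * emeasure lborel (A i)"
      using A assms by (intro sigma_finite_measure.emeasure_pair_measure_Times[OF sigma_finite_lborel]) (auto intro!: sets_PiM_I_finite)
    also have "\<dots> = (\<Prod>j\<in>{..<N} - {i}. emeasure lborel (A j)) * emeasure lborel (A i)"
      using A by (subst emeasure_PiM) auto
    also have "\<dots> = (\<Prod>j\<in>{..<N}. emeasure lborel (A j))"
      using assms by (subst (2) prod.remove[of _ i]) (auto simp: mult.commute)
    finally show "emeasure (distr (PJ N i \<Otimes>\<^sub>M lborel) (PN N) (\<lambda>(y, t). y(i := t))) (Pi\<^sub>E {..<N} A)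
      = (\<Prod>j\<in>{..<N}. emeasure lborel (A j))" .
  qed auto
qed

lemma upd_integrable:
  fixes f :: "point \<Rightarrow> real"
  assumes "i < N" "f \<in> borel_measurable (PN N)"
  shows "integrable (PN N) f \<longleftrightarrow> integrable (PJ N i \<Otimes>\<^sub>M lborel) (\<lambda>(y, t). f (y(i := t)))"
  using integrable_distr_eq[OF measurable_upd[OF assms(1)] assms(2)]
  unfolding distr_upd[OF assms(1)] by (simp add: split_beta')

lemma upd_integral:
  fixes f :: "point \<Rightarrow> real"
  assumes "i < N" "integrable (PN N) f"
  shows "integral\<^sup>L (PN N) f = (LINT y|PJ N i. LINT t|lborel. f (y(i := t)))"
proof -
  interpret pair_sigma_finite "PJ N i" "lborel :: real measure" by (rule pair_PJ)
  have m: "f \<in> borel_measurable (PN N)" using assms by auto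
  have "integral\<^sup>L (PN N) f = integral\<^sup>L (PJ N i \<Otimes>\<^sub>M lborel) (\<lambda>(y, t). f (y(i := t)))"
    using integral_distr[OF measurable_upd[OF assms(1)] m]
    unfolding distr_upd[OF assms(1)] by (simp add: split_beta')
  also have "\<dots> = (LINT y|PJ N i. LINT t|lborel. f (y(i := t)))"
    using integral_fst'[of "\<lambda>(y, t). f (y(i := t))"] upd_integrable[OF assms(1) m] assms by simp
  finally show ?thesis .
qed

lemma upd_AE_integrable:
  fixes f :: "point \<Rightarrow> real"
  assumes "i < N" "integrable (PN N) f"
  shows "AE y in PJ N i. integrable lborel (\<lambda>t. f (y(i := t)))"
proof -
  interpret pair_sigma_finite "PJ N i" "lborel :: real measure" by (rule pair_PJ)
  have m: "f \<in> borel_measurable (PN N)" using assms by auto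
  show ?thesis
    using AE_integrable_fst'[of "\<lambda>(y, t). f (y(i := t))"] upd_integrable[OF assms(1) m] assms by simp
qed

lemma upd_AE:
  assumes "i < N" "AE x in PN N. P x"
  shows "AE y in PJ N i. AE t in lborel. P (y(i := t))"
proof -
  interpret pair_sigma_finite "PJ N i" "lborel :: real measure" by (rule pair_PJ)
  have "AE x in distr (PJ N i \<Otimes>\<^sub>M lborel) (PN N) (\<lambda>(y, t). y(i := t)). P x"
    using assms by (simp only: distr_upd)
  then have "AE p in PJ N i \<Otimes>\<^sub>M lborel. P ((\<lambda>(y, t). y(i := t)) p)"
    by (rule AE_distrD[OF measurable_upd[OF assms(1)]])
  from AE_pair[OF this] show ?thesis by simp
qed

lemma pair_integrable_mult:
  fixes f :: "point \<Rightarrow> real" and h :: "real \<Rightarrow> real"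
  assumes f: "integrable (PJ N i) f" and h: "integrable lborel h"
  shows "integrable (PJ N i \<Otimes>\<^sub>M lborel) (\<lambda>(y, t). f y * h t)"
proof -
  interpret pair_sigma_finite "PJ N i" "lborel :: real measure" by (rule pair_PJ)
  have [measurable]: "f \<in> borel_measurable (PJ N i)" "h \<in> borel_measurable lborel" using assms by auto
  show ?thesis
    by (rule Fubini_integrable) (use assms in \<open>auto simp: abs_mult\<close>)
qed

lemma smooth_integrable:
  assumes "smooth f" "\<And>t. t \<notin> {a<..<b} \<Longrightarrow> f t = 0"
  shows "integrable lborel f" "(LINT t|lborel. f t) = integral {a..b} f"
proof -
  have *: "set_integrable lborel {a..b} f"
    by (intro borel_integrable_atLeastAtMost' smooth_continuous assms)
  have eq: "(\<lambda>t. indicator {a..b} t *\<^sub>R f t) = f"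
  proof
    fix t show "indicator {a..b} t *\<^sub>R f t = f t"
      using assms(2)[of t] by (cases "t \<in> {a..b}") auto
  qed
  show "integrable lborel f" using * unfolding set_integrable_def eq .
  show "(LINT t|lborel. f t) = integral {a..b} f"
    using set_borel_integral_eq_integral(2)[OF *] unfolding set_lebesgue_integral_def eq .
qed

text \<open>Allows a bump to be normalised to mass 1. A nonnegative function with integral 0 would
  vanish almost everywhere, yet \<open>bump\<close> is positive on all of (a, b).\<close>

lemma bump_integral_pos: assumes "a < b" shows "(LINT t|lborel. bump a b n t) > 0"
proof -
  have i: "integrable lborel (bump a b n)" by (rule smooth_integrable(1)[OF smooth_bump bump_0])
  have "(LINT t|lborel. bump a b n t) \<noteq> 0"
  proof
    assume "(LINT t|lborel. bump a b n t) = 0"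
    then have "AE t in lborel. bump a b n t = 0"
      using integral_nonneg_eq_0_iff_AE[OF i] by (auto simp: bump_range)
    then have "AE t in lborel. t \<notin> {a<..<b}"
      by eventually_elim (use bump_pos[of a _ b n] in force)
    then have "emeasure lborel {a<..<b} = 0"
      by (subst (asm) AE_iff_measurable[of "{a<..<b}"]) auto
    then show False using assms by simp
  qed
  moreover have "(LINT t|lborel. bump a b n t) \<ge> 0" by (simp add: bump_range)
  ultimately show ?thesis by linarith
qed

lemma integrable_mult_bounded:
  fixes f :: "'a \<Rightarrow> real"
  assumes "integrable M f" "h \<in> borel_measurable M" "\<And>x. \<bar>h x\<bar> \<le> (B::real)"
  shows "integrable M (\<lambda>x. f x * h x)"
proof (rule Bochner_Integration.integrable_bound)
  show "integrable M (\<lambda>x. f x * B)" using assms(1) by simp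
  show "AE x in M. norm (f x * h x) \<le> norm (f x * B)"
    using assms(3) by (intro AE_I2) (auto simp: abs_mult intro!: mult_left_mono intro: order_trans abs_ge_self)
qed (use assms in auto)

text \<open>Subtracting the primitive \<open>W\<close> of \<open>G\<close> along the lines leaves a function with vanishing weak
  \<open>i\<close>-th derivative. It equals its mean \<open>c\<close> against a bump \<open>\<rho>\<close>, because a product test function whose
  \<open>i\<close>-th factor has integral zero is the \<open>i\<close>-th derivative of a test function.\<close>

lemma absolutely_continuous_on_lines:
  assumes i: "i < N" and ab: "a i < b i" and v: "integrable (PN N) v" and G: "integrable (PN N) G"
    and weak: "\<And>\<beta>. box_test N a b \<beta> \<Longrightarrow>
      (LINT x|PN N. v x * tensor N (\<beta>(i := deriv (\<beta> i))) x) = - (LINT x|PN N. G x * tensor N \<beta> x)"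
  shows "AE y in PJ N i. (\<forall>j\<in>{..<N}-{i}. y j \<in> {a j<..<b j}) \<longrightarrow>
    integrable lborel (\<lambda>t. G (y(i := t))) \<and>
    (\<exists>c. AE t in lborel. t \<in> {a i<..<b i} \<longrightarrow> v (y(i := t)) = c + integral {a i..t} (\<lambda>s. G (y(i := s))))"
proof -
  interpret pair_sigma_finite "PJ N i" "lborel :: real measure" by (rule pair_PJ)
  let ?M = "PJ N i \<Otimes>\<^sub>M (lborel :: real measure)"
  let ?I = "{a i..b i}"
  have [measurable]: "v \<in> borel_measurable (PN N)" "G \<in> borel_measurable (PN N)" using v G by auto
  define v2 G2 where "v2 y t = v (y(i := t))" and "G2 y t = G (y(i := t))" for y t
  have v2: "integrable ?M (\<lambda>(y, t). v2 y t)" and G2: "integrable ?M (\<lambda>(y, t). G2 y t)"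
    using v G unfolding v2_def G2_def by (simp_all add: upd_integrable[OF i, symmetric])
  have [measurable]: "(\<lambda>(y, t). v2 y t) \<in> borel_measurable ?M" "(\<lambda>(y, t). G2 y t) \<in> borel_measurable ?M"
    using v2 G2 by auto
  \<comment> \<open>A Lebesgue integral with an indicator, rather than
    \<open>integral {a i..t}\<close>, so that joint measurability in (y, t) follows from that of
    parametrised integrals.\<close>
  define W where "W y t = (LINT s|lborel. indicator {a i..t} s * G2 y s)" for y t
  have W_meas[measurable]: "(\<lambda>(y, t). W y t) \<in> borel_measurable ?M"
  proof -
    have *: "(\<lambda>((y, t), s). indicator {a i..t} s * G2 y s) \<in> borel_measurable (?M \<Otimes>\<^sub>M lborel)"
    proof -
      have "(\<lambda>q. (\<lambda>(y, s). G2 y s) (fst (fst q), snd q)) \<in> borel_measurable (?M \<Otimes>\<^sub>M lborel)"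
        by measurable
      then have "(\<lambda>q. (if a i \<le> snd q \<and> snd q \<le> snd (fst q) then 1 else 0) * G2 (fst (fst q)) (snd q))
          \<in> borel_measurable (?M \<Otimes>\<^sub>M lborel)"
        by simp
      then show ?thesis
        by (rule measurable_cong[THEN iffD1, rotated]) (auto simp: indicator_def split_beta')
    qed
    have "(\<lambda>p. LINT s|lborel. indicator {a i..snd p} s * G2 (fst p) s) \<in> borel_measurable ?M"
      by (rule sigma_finite_measure.borel_measurable_lebesgue_integral[OF sigma_finite_lborel]) (use * in \<open>simp add: split_beta'\<close>)
    then show ?thesis by (simp add: W_def split_beta')
  qed
  \<comment> \<open>A bound for \<open>W y t\<close> that does not depend on t and is integrable in
    y; it makes the truncated \<open>W\<close> integrable on the product space.\<close>
  define g where "g y = (LINT s|lborel. \<bar>G2 y s\<bar>)" for y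
  have g: "integrable (PJ N i) g"
    using integrable_fst'[OF integrable_abs[OF G2]] by (simp add: g_def[abs_def])
  have G2_line: "AE y in PJ N i. integrable lborel (G2 y)"
    using AE_integrable_fst'[OF G2] by simp
  have W_bound: "\<bar>W y t\<bar> \<le> g y" if "integrable lborel (G2 y)" for y t
  proof -
    have ii: "integrable lborel (\<lambda>s. indicator {a i..t} s * G2 y s)"
      using integrable_mult_indicator[of "{a i..t}" lborel "G2 y"] that by simp
    have "\<bar>W y t\<bar> \<le> (LINT s|lborel. \<bar>indicator {a i..t} s * G2 y s\<bar>)"
      unfolding W_def using integral_norm_bound[of lborel "\<lambda>s. indicator {a i..t} s * G2 y s"] by simp
    also have "\<dots> \<le> g y"
      unfolding g_def using that ii
      by (intro integral_mono integrable_abs) (auto simp: indicator_def)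
    finally show ?thesis .
  qed
  have W_eq: "W y t = integral {a i..t} (G2 y)" if "integrable lborel (G2 y)" for y t
  proof -
    have "set_integrable lborel {a i..t} (G2 y)"
      unfolding set_integrable_def using that by (intro integrable_mult_indicator) auto
    from set_borel_integral_eq_integral(2)[OF this] show ?thesis
      by (simp add: W_def set_lebesgue_integral_def)
  qed
  have W_prim: "primitive_on (a i) (b i) (W y) (G2 y)" if "integrable lborel (G2 y)" for y
  proof (rule primitive_onI[where c = 0])
    show "set_integrable lborel {a i..b i} (G2 y)"
      unfolding set_integrable_def using that by (intro integrable_mult_indicator) auto
  qed (simp add: W_eq[OF that])
  have iW: "integrable ?M (\<lambda>(y, t). indicator ?I t * W y t)"
  proof (rule Fubini_integrable)
    show "(\<lambda>(y, t). indicator ?I t * W y t) \<in> borel_measurable ?M"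
      by measurable
    have line: "integrable lborel (\<lambda>t. indicator ?I t * W y t)" 
      "(LINT t|lborel. \<bar>indicator ?I t * W y t\<bar>) \<le> (b i - a i) * g y"
      if yG: "integrable lborel (G2 y)" and y: "y \<in> space (PJ N i)" for y
    proof -
      have m: "(\<lambda>t. W y t) \<in> borel_measurable lborel"
        using measurable_Pair2[OF W_meas y] by simp
      have b: "integrable lborel (\<lambda>t. indicator ?I t * g y)"
        using ab by (auto intro!: integrable_real_indicator)
      show 1: "integrable lborel (\<lambda>t. indicator ?I t * W y t)"
        by (rule Bochner_Integration.integrable_bound[OF b])
          (use m W_bound[OF yG] in \<open>auto simp: indicator_def intro: order_trans[OF _ abs_ge_self]\<close>)
      have "(LINT t|lborel. \<bar>indicator ?I t * W y t\<bar>) \<le> (LINT t|lborel. indicator ?I t * g y)"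
        by (rule integral_mono[OF integrable_abs[OF 1] b])
          (use W_bound[OF yG] in \<open>auto simp: indicator_def\<close>)
      then show "(LINT t|lborel. \<bar>indicator ?I t * W y t\<bar>) \<le> (b i - a i) * g y"
        using ab by simp
    qed
    show "integrable (PJ N i) (\<lambda>y. LINT t|lborel. norm (case (y, t) of (y, t) \<Rightarrow> indicator ?I t * W y t))"
    proof (rule Bochner_Integration.integrable_bound)
      show "integrable (PJ N i) (\<lambda>y. (b i - a i) * g y)" using g by simp
      show "(\<lambda>y. LINT t|lborel. norm (case (y, t) of (y, t) \<Rightarrow> indicator ?I t * W y t)) \<in> borel_measurable (PJ N i)"
        by measurable
      show "AE y in PJ N i. norm (LINT t|lborel. norm (case (y, t) of (y, t) \<Rightarrow> indicator ?I t * W y t)) \<le> norm ((b i - a i) * g y)"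
        using G2_line AE_space
      proof eventually_elim
        case (elim y)
        then show ?case using line(2)[OF elim] by (auto simp: abs_of_nonneg)
      qed
    qed
    show "AE y in PJ N i. integrable lborel (\<lambda>t. case (y, t) of (y, t) \<Rightarrow> indicator ?I t * W y t)"
      using G2_line AE_space by eventually_elim (use line(1) in auto)
  qed
  define u where "u y t = indicator ?I t * v2 y t - indicator ?I t * W y t" for y t
  have u: "integrable ?M (\<lambda>(y, t). u y t)"
  proof -
    have "integrable ?M (\<lambda>(y, t). indicator ?I t * v2 y t)"
    proof (rule Bochner_Integration.integrable_bound[OF v2])
      show "(\<lambda>(y, t). indicator ?I t * v2 y t) \<in> borel_measurable ?M" by measurable
    qed (auto simp: indicator_def)
    from Bochner_Integration.integrable_diff[OF this iW] show ?thesis by (simp add: u_def split_beta')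
  qed
  have [measurable]: "(\<lambda>(y, t). u y t) \<in> borel_measurable ?M" using u by auto
  define \<rho> where "\<rho> t = inverse (LINT t|lborel. bump (a i) (b i) 0 t) * bump (a i) (b i) 0 t" for t
  have \<rho>: "smooth \<rho>" "\<And>t. t \<notin> {a i<..<b i} \<Longrightarrow> \<rho> t = 0" "(LINT t|lborel. \<rho> t) = 1"
    using bump_integral_pos[OF ab, of 0] unfolding \<rho>_def[abs_def]
    by (auto intro!: smooth_cmult smooth_bump bump_0)
  have sm_meas: "f \<in> borel_measurable lborel" if "smooth f" for f
    using borel_measurable_continuous_onI[OF smooth_continuous[OF that]] by simp
  have sm_pair: "integrable ?M (\<lambda>(y, t). h y t * f t)" if sf: "smooth f" "\<And>t. t \<notin> {a i<..<b i} \<Longrightarrow> f t = 0"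
    "integrable ?M (\<lambda>(y, t). h y t)" for f h
  proof -
    obtain B where "\<And>t. \<bar>f t\<bar> \<le> B" using smooth_bounded[OF sf(1,2)] by blast
    moreover have "(\<lambda>p. f (snd p)) \<in> borel_measurable ?M" using sm_meas[OF that(1)] by measurable
    ultimately have "integrable ?M (\<lambda>p. (\<lambda>(y, t). h y t) p * f (snd p))"
      using that(3) by (intro integrable_mult_bounded) auto
    then show ?thesis by (simp add: split_beta')
  qed
  define c where "c y = (LINT t|lborel. u y t * \<rho> t)" for y
  have c: "integrable (PJ N i) c"
    using integrable_fst'[OF sm_pair[OF \<rho>(1,2) u]] by (simp add: c_def[abs_def])
  define z2 where "z2 y t = u y t - c y * indicator ?I t" for y t
  have z2: "integrable ?M (\<lambda>(y, t). z2 y t)"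
  proof -
    have "integrable lborel (indicator ?I :: real \<Rightarrow> real)"
      using ab by (intro integrable_real_indicator) auto
    from Bochner_Integration.integrable_diff[OF u pair_integrable_mult[OF c this]]
    show ?thesis by (simp add: z2_def split_beta')
  qed
  have [measurable]: "(\<lambda>(y, t). z2 y t) \<in> borel_measurable ?M" using z2 by auto
  \<comment> \<open>The function of (y, t) read as a function of the full point x, so that box tests
    on \<open>PN N\<close> apply to it.\<close>
  define z where "z x = z2 (restrict x ({..<N} - {i})) (x i)" for x
  have z_upd: "z (y(i := t)) = z2 y t" if "y \<in> space (PJ N i)" for y t
  proof -
    have "restrict (y(i := t)) ({..<N} - {i}) = y"
      using that unfolding space_PiM by (auto simp: fun_eq_iff restrict_def PiE_iff extensional_def)
    then show ?thesis by (simp add: z_def)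
  qed
  have z: "integrable (PN N) z"
  proof -
    have "(\<lambda>x. (restrict x ({..<N} - {i}), x i)) \<in> PN N \<rightarrow>\<^sub>M ?M"
      using i by (intro measurable_Pair measurable_restrict_subset measurable_component_singleton) auto
    then have "(\<lambda>x. (\<lambda>(y, t). z2 y t) (restrict x ({..<N} - {i}), x i)) \<in> borel_measurable (PN N)"
      by (rule measurable_compose) measurable
    then have m: "z \<in> borel_measurable (PN N)" by (simp add: z_def[abs_def])
    have "integrable ?M (\<lambda>(y, t). z (y(i := t)))"
      using z2 by (subst Bochner_Integration.integrable_cong[OF refl, of _ _ "\<lambda>(y, t). z2 y t"])
        (auto simp: z_upd space_pair_measure)
    then show ?thesis by (simp add: upd_integrable[OF i m])
  qed
  have "AE x in PN N. x \<in> obox N a b \<longrightarrow> z x = 0"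
  proof (rule AE_zero_box_tests[OF z])
    fix \<beta> assume \<beta>: "box_test N a b \<beta>"
    then have \<beta>i: "smooth (\<beta> i)" "\<And>t. t \<notin> {a i<..<b i} \<Longrightarrow> \<beta> i t = 0"
      using i by (auto simp: box_test_def)
    define \<kappa> where "\<kappa> = (LINT t|lborel. \<beta> i t)"
    \<comment> \<open>Removing the multiple \<kappa> of \<rho>, whose mass is 1, leaves mean zero.
      So \<alpha> has a compactly supported primitive B, and the hypothesis \<open>weak\<close> is
      used for \<beta> with its i-th factor replaced by B.\<close>
    define \<alpha> where "\<alpha> t = \<beta> i t + (- \<kappa>) * \<rho> t" for t
    have \<alpha>: "smooth \<alpha>" "\<And>t. t \<notin> {a i<..<b i} \<Longrightarrow> \<alpha> t = 0"
    proof -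
      show "smooth \<alpha>"
        unfolding \<alpha>_def[abs_def] by (intro smooth_add smooth_cmult \<beta>i \<rho>)
      show "\<alpha> t = 0" if "t \<notin> {a i<..<b i}" for t
        unfolding \<alpha>_def using \<beta>i(2)[OF that] \<rho>(2)[OF that] by simp
    qed
    have "(LINT t|lborel. \<alpha> t) = 0"
      unfolding \<alpha>_def using smooth_integrable(1)[OF \<beta>i] smooth_integrable(1)[OF \<rho>(1,2)] \<rho>(3)
      by (simp add: \<kappa>_def)
    then have "integral ?I \<alpha> = 0" using smooth_integrable(2)[OF \<alpha>] by simp
    from smooth_primitive[OF \<alpha> ab this] obtain B
      where B: "smooth B" "deriv B = \<alpha>" "\<And>t. t \<notin> {a i<..<b i} \<Longrightarrow> B t = 0" by blast
    let ?\<eta> = "\<lambda>y. \<Prod>j\<in>{..<N}-{i}. \<beta> j (y j)"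
    have btB: "box_test N a b (\<beta>(i := B))"
      using \<beta> B i by (auto simp: box_test_def)
    have bt\<alpha>: "box_test N a b (\<beta>(i := \<alpha>))"
      using \<beta> \<alpha> i by (auto simp: box_test_def)
    have tB: "tensor N (\<beta>(i := B)) (y(i := t)) = B t * ?\<eta> y" for y t
      by (subst tensor_split[OF i]) (auto intro!: prod.cong)
    have t\<alpha>: "tensor N (\<beta>(i := \<alpha>)) (y(i := t)) = \<alpha> t * ?\<eta> y" for y t
      by (subst tensor_split[OF i]) (auto intro!: prod.cong)
    have int_mult: "integrable (PN N) (\<lambda>x. h x * tensor N \<gamma> x)" if hg: "integrable (PN N) h" "box_test N a b \<gamma>" for h \<gamma>
    proof -
      obtain C where "\<And>x. \<bar>tensor N \<gamma> x\<bar> \<le> C" using tensor_bounded[OF hg(2)] by blast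
      then show ?thesis by (intro integrable_mult_bounded[OF that(1) box_test_measurable[OF that(2)]])
    qed
    have "(LINT x|PN N. z x * tensor N \<beta> x) = (LINT y|PJ N i. LINT t|lborel. z (y(i := t)) * tensor N \<beta> (y(i := t)))"
      by (rule upd_integral[OF i int_mult[OF z \<beta>]])
    also have "\<dots> = (LINT y|PJ N i. LINT t|lborel. v (y(i := t)) * tensor N (\<beta>(i := \<alpha>)) (y(i := t))
        + G (y(i := t)) * tensor N (\<beta>(i := B)) (y(i := t)))"
    proof (rule integral_cong_AE)
      have mm: "(\<lambda>y. LINT t|lborel. h (y(i := t))) \<in> borel_measurable (PJ N i)" if "h \<in> borel_measurable (PN N)" for h :: "point \<Rightarrow> real"
        using measurable_compose[OF measurable_upd[OF i] that]
        by (intro sigma_finite_measure.borel_measurable_lebesgue_integral[OF sigma_finite_lborel]) (simp add: split_beta')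
      have [measurable]: "tensor N \<beta> \<in> borel_measurable (PN N)" "tensor N (\<beta>(i := B)) \<in> borel_measurable (PN N)"
        "tensor N (\<beta>(i := \<alpha>)) \<in> borel_measurable (PN N)" "z \<in> borel_measurable (PN N)"
        using \<beta> btB bt\<alpha> z by auto
      show "(\<lambda>y. LINT t|lborel. z (y(i := t)) * tensor N \<beta> (y(i := t))) \<in> borel_measurable (PJ N i)"
        using mm[of "\<lambda>x. z x * tensor N \<beta> x"] by simp
      show "(\<lambda>y. LINT t|lborel. v (y(i := t)) * tensor N (\<beta>(i := \<alpha>)) (y(i := t))
        + G (y(i := t)) * tensor N (\<beta>(i := B)) (y(i := t))) \<in> borel_measurable (PJ N i)"
        using mm[of "\<lambda>x. v x * tensor N (\<beta>(i := \<alpha>)) x + G x * tensor N (\<beta>(i := B)) x"] by simp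
      show "AE y in PJ N i. (LINT t|lborel. z (y(i := t)) * tensor N \<beta> (y(i := t))) =
        (LINT t|lborel. v (y(i := t)) * tensor N (\<beta>(i := \<alpha>)) (y(i := t)) + G (y(i := t)) * tensor N (\<beta>(i := B)) (y(i := t)))"
        using G2_line AE_integrable_fst'[OF v2] AE_integrable_fst'[OF u] AE_space
      proof eventually_elim
        case (elim y)
        have yG: "integrable lborel (G2 y)" and yv: "integrable lborel (v2 y)" and yu: "integrable lborel (u y)"
          using elim by auto
        have im: "integrable lborel (\<lambda>t. h t * f t)" if sf: "integrable lborel h" "smooth f" "\<And>t. t \<notin> {a i<..<b i} \<Longrightarrow> f t = 0" for h f
        proof -
          obtain C where "\<And>t. \<bar>f t\<bar> \<le> C" using smooth_bounded[OF sf(2,3)] by blast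
          then show ?thesis by (intro integrable_mult_bounded[OF that(1) sm_meas[OF that(2)]])
        qed
        have "(LINT t|lborel. z (y(i := t)) * tensor N \<beta> (y(i := t))) = (LINT t|lborel. (u y t * \<beta> i t - c y * \<beta> i t) * ?\<eta> y)"
        proof (rule Bochner_Integration.integral_cong[OF refl])
          fix t
          show "z (y(i := t)) * tensor N \<beta> (y(i := t)) = (u y t * \<beta> i t - c y * \<beta> i t) * ?\<eta> y"
            using \<beta>i(2)[of t] by (cases "t \<in> ?I") (auto simp: z_upd elim tensor_split[OF i] z2_def algebra_simps)
        qed
        also have "\<dots> = ((LINT t|lborel. u y t * \<beta> i t) - c y * \<kappa>) * ?\<eta> y"
          using im[OF yu \<beta>i] smooth_integrable(1)[OF \<beta>i] by (simp add: \<kappa>_def)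
        \<comment> \<open>As \<open>c y\<close> is the integral of u against \<rho>, subtracting the
          mean from u is the same as subtracting \<kappa> \<rho> from the test factor.\<close>
        also have "(LINT t|lborel. u y t * \<beta> i t) - c y * \<kappa> = (LINT t|lborel. u y t * \<beta> i t + (- \<kappa>) * (u y t * \<rho> t))"
          using im[OF yu \<beta>i] im[OF yu \<rho>(1,2)] by (simp add: c_def)
        also have "\<dots> = (LINT t|lborel. u y t * \<alpha> t)"
          by (simp add: \<alpha>_def algebra_simps)
        \<comment> \<open>On the interval u is v minus W, and integration by parts turns the
          integral of - W \<alpha> into that of G B, because \<alpha> is the derivative of
          B.\<close>
        also have "\<dots> = (LINT t|lborel. v2 y t * \<alpha> t + G2 y t * B t)"
        proof -
          have by_parts: "(LINT t:?I|lborel. W y t * \<alpha> t + 1 * G2 y t * B t) = 0"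
            by (rule primitive_on_by_parts[OF W_prim[OF yG], where f = "\<lambda>x. x" and f' = "\<lambda>_. 1"])
              (use ab B smooth_DERIV[OF B(1)] in \<open>auto intro!: smooth_continuous smooth_deriv\<close>)
          have "(LINT t|lborel. v2 y t * \<alpha> t + G2 y t * B t) - (LINT t|lborel. u y t * \<alpha> t)
            = (LINT t|lborel. v2 y t * \<alpha> t + G2 y t * B t - u y t * \<alpha> t)"
            using im[OF yu \<alpha>] im[OF yv \<alpha>] im[OF yG B(1,3)] by simp
          also have "\<dots> = (LINT t:?I|lborel. W y t * \<alpha> t + 1 * G2 y t * B t)"
            unfolding set_lebesgue_integral_def
          proof (rule Bochner_Integration.integral_cong[OF refl])
            fix t show "v2 y t * \<alpha> t + G2 y t * B t - u y t * \<alpha> t = indicator ?I t *\<^sub>R (W y t * \<alpha> t + 1 * G2 y t * B t)"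
              using \<alpha>(2)[of t] B(3)[of t] by (cases "t \<in> ?I") (auto simp: u_def algebra_simps)
          qed
          finally show ?thesis using by_parts by simp
        qed
        also have "\<dots> * ?\<eta> y = (LINT t|lborel. (v2 y t * \<alpha> t + G2 y t * B t) * ?\<eta> y)" by simp
        also have "\<dots> = (LINT t|lborel. v (y(i := t)) * tensor N (\<beta>(i := \<alpha>)) (y(i := t)) + G (y(i := t)) * tensor N (\<beta>(i := B)) (y(i := t)))"
          unfolding tB t\<alpha> v2_def G2_def by (simp only: algebra_simps)
        finally show ?case .
      qed
    qed
    also have "\<dots> = (LINT x|PN N. v x * tensor N (\<beta>(i := \<alpha>)) x + G x * tensor N (\<beta>(i := B)) x)"
      by (rule upd_integral[OF i, symmetric]) (intro Bochner_Integration.integrable_add int_mult v G btB bt\<alpha>)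
    also have "\<dots> = (LINT x|PN N. v x * tensor N (\<beta>(i := \<alpha>)) x) + (LINT x|PN N. G x * tensor N (\<beta>(i := B)) x)"
      by (intro Bochner_Integration.integral_add int_mult v G btB bt\<alpha>)
    also have "\<dots> = 0" using weak[OF btB] B(2) by simp
    finally show "(LINT x|PN N. z x * tensor N \<beta> x) = 0" .
  qed
  from upd_AE[OF i this] G2_line AE_space show ?thesis
  proof eventually_elim
    case (elim y)
    show ?case
    proof (intro impI conjI)
      assume y: "\<forall>j\<in>{..<N}-{i}. y j \<in> {a j<..<b j}"
      show yG: "integrable lborel (\<lambda>t. G (y(i := t)))" using elim(2) by (simp add: G2_def[abs_def])
      show "\<exists>c. AE t in lborel. t \<in> {a i<..<b i} \<longrightarrow> v (y(i := t)) = c + integral {a i..t} (\<lambda>s. G (y(i := s)))"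
        using elim(1)
      proof (intro exI[of _ "c y"], eventually_elim)
        case (elim t)
        show ?case
        proof
          assume t: "t \<in> {a i<..<b i}"
          have "y(i := t) \<in> obox N a b"
            using y t i \<open>y \<in> space (PJ N i)\<close> unfolding space_PiM by (auto simp: PiE_iff extensional_def)
          with elim have "z2 y t = 0" using z_upd[OF \<open>y \<in> space (PJ N i)\<close>] by simp
          then show "v (y(i := t)) = c y + integral {a i..t} (\<lambda>s. G (y(i := s)))"
            using t W_eq[OF \<open>integrable lborel (G2 y)\<close>, of t] by (simp add: z2_def u_def v2_def G2_def[abs_def])
        qed
      qed
    qed
  qed
qed

subsection \<open>Weak gradients and local boundedness\<close>

lemma continuous_on_line:
  assumes \<Phi>: "continuous_map (subtopology (Rn N) \<Omega>) euclideanreal \<Phi>" and y: "y \<in> extensional {..<N}" and i: "i < N"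
    and in\<Omega>: "\<And>t. t \<in> S \<Longrightarrow> y(i := t) \<in> \<Omega>"
  shows "continuous_on S (\<lambda>t. \<Phi> (y(i := t)))"
proof -
  have "continuous_map (top_of_set S) (subtopology (Rn N) \<Omega>) (\<lambda>t. y(i := t))"
    using continuous_map_upd[OF y i] in\<Omega>
    by (auto simp: continuous_map_in_subtopology continuous_map_from_subtopology)
  from continuous_map_compose[OF this \<Phi>] show ?thesis by (simp add: o_def)
qed

lemma partial_zero:
  assumes "openin (Rn N) U" "x \<in> U" "i < N" "\<And>x. x \<in> U \<Longrightarrow> f x = 0"
  shows "partial i f x = 0"
  using partial_cong[OF assms(1-3), of f "\<lambda>_. 0"] assms(4) by (simp add: partial_def)

lemma openin_Diff_compact: "openin (Rn N) \<Omega> \<Longrightarrow> compactin (Rn N) K \<Longrightarrow> openin (Rn N) (\<Omega> - K)"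
  by (intro openin_diff compactin_imp_closedin) (auto simp: Hausdorff_space_product_topology)

section \<open>Essentially bounded multipliers of locally integrable functions\<close>

definition locally_bounded :: "nat \<Rightarrow> point set \<Rightarrow> (point \<Rightarrow> real) \<Rightarrow> bool" where
  "locally_bounded N \<Omega> h \<longleftrightarrow> (\<forall>K. compactin (Rn N) K \<and> K \<subseteq> \<Omega> \<longrightarrow>
     (\<lambda>x. indicator K x * h x) \<in> borel_measurable (leb N) \<and> (\<exists>B. AE x in leb N. x \<in> K \<longrightarrow> \<bar>h x\<bar> \<le> B))"

lemma locally_boundedD:
  assumes "locally_bounded N \<Omega> h" "compactin (Rn N) K" "K \<subseteq> \<Omega>"
  obtains B where "B > 0" "(\<lambda>x. indicator K x * h x) \<in> borel_measurable (leb N)"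
    "AE x in leb N. x \<in> K \<longrightarrow> \<bar>h x\<bar> \<le> B"
proof -
  obtain B where B: "(\<lambda>x. indicator K x * h x) \<in> borel_measurable (leb N)" "AE x in leb N. x \<in> K \<longrightarrow> \<bar>h x\<bar> \<le> B"
    using assms unfolding locally_bounded_def by blast
  from B(2) have "AE x in leb N. x \<in> K \<longrightarrow> \<bar>h x\<bar> \<le> max B 1" by eventually_elim auto
  with B(1) show ?thesis by (intro that[of "max B 1"]) auto
qed

lemma locally_bounded_continuous:
  assumes "openin (Rn N) \<Omega>" "continuous_map (subtopology (Rn N) \<Omega>) euclideanreal f"
  shows "locally_bounded N \<Omega> f"
  unfolding locally_bounded_def
proof (intro allI impI conjI)
  fix K assume K: "compactin (Rn N) K \<and> K \<subseteq> \<Omega>"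
  have "(\<lambda>x. indicator K x * (indicator \<Omega> x * f x)) \<in> borel_measurable (leb N)"
    by (intro leb_measurable borel_measurable_times borel_measurable_indicator sets_compact
        measurable_continuous_on_open[OF assms]) (use K in auto)
  moreover have "indicator K x * (indicator \<Omega> x * f x) = indicator K x * f x" for x
    using K by (auto simp: indicator_def)
  ultimately show "(\<lambda>x. indicator K x * f x) \<in> borel_measurable (leb N)" by simp
  obtain B where "B > 0" "\<And>x. x \<in> K \<Longrightarrow> \<bar>f x\<bar> \<le> B"
    using bounded_on_compact[of N K \<Omega> f] K assms(2) by blast
  then show "\<exists>B. AE x in leb N. x \<in> K \<longrightarrow> \<bar>f x\<bar> \<le> B" by auto
qed

lemma locally_bounded_mult:
  assumes "locally_bounded N \<Omega> f" "locally_bounded N \<Omega> g"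
  shows "locally_bounded N \<Omega> (\<lambda>x. f x * g x)"
  unfolding locally_bounded_def
proof (intro allI impI)
  fix K assume K: "compactin (Rn N) K \<and> K \<subseteq> \<Omega>"
  obtain B where B: "(\<lambda>x. indicator K x * f x) \<in> borel_measurable (leb N)" "AE x in leb N. x \<in> K \<longrightarrow> \<bar>f x\<bar> \<le> B"
    by (rule locally_boundedD[OF assms(1) conjunct1[OF K] conjunct2[OF K]])
  obtain C where C: "(\<lambda>x. indicator K x * g x) \<in> borel_measurable (leb N)" "AE x in leb N. x \<in> K \<longrightarrow> \<bar>g x\<bar> \<le> C"
    by (rule locally_boundedD[OF assms(2) conjunct1[OF K] conjunct2[OF K]])
  have "(\<lambda>x. (indicator K x * f x) * (indicator K x * g x)) \<in> borel_measurable (leb N)" using B C by measurable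
  moreover have "(indicator K x * f x) * (indicator K x * g x) = indicator K x * (f x * g x)" for x
    by (simp add: indicator_def)
  moreover have "AE x in leb N. x \<in> K \<longrightarrow> \<bar>f x * g x\<bar> \<le> B * C"
    using B(2) C(2) by eventually_elim (auto simp: abs_mult intro!: mult_mono intro: order_trans[OF abs_ge_zero])
  ultimately show "(\<lambda>x. indicator K x * (f x * g x)) \<in> borel_measurable (leb N)
      \<and> (\<exists>B. AE x in leb N. x \<in> K \<longrightarrow> \<bar>f x * g x\<bar> \<le> B)" by auto
qed

lemma locally_bounded_compose:
  fixes f :: "real \<Rightarrow> real"
  assumes "locally_bounded N \<Omega> v" "continuous_on UNIV f"
  shows "locally_bounded N \<Omega> (\<lambda>x. f (v x))"
  unfolding locally_bounded_def
proof (intro allI impI)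
  fix K assume K: "compactin (Rn N) K \<and> K \<subseteq> \<Omega>"
  obtain B where B: "(\<lambda>x. indicator K x * v x) \<in> borel_measurable (leb N)" "AE x in leb N. x \<in> K \<longrightarrow> \<bar>v x\<bar> \<le> B"
    by (rule locally_boundedD[OF assms(1) conjunct1[OF K] conjunct2[OF K]])
  have fm: "f \<in> borel_measurable borel" using assms(2) by (rule borel_measurable_continuous_onI)
  \<comment> \<open>Only the restriction of v to K is known to be measurable. The inner indicator
    makes the argument of f measurable, and the outer one hides the change off K.\<close>
  have "(\<lambda>x. indicator K x * f (indicator K x * v x)) \<in> borel_measurable (leb N)"
    by (intro borel_measurable_times borel_measurable_indicator leb_sets sets_compact measurable_compose[OF B(1) fm])
      (use K in auto)
  moreover have "indicator K x * f (indicator K x * v x) = indicator K x * f (v x)" for x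
    by (simp add: indicator_def)
  moreover have "\<exists>C. AE x in leb N. x \<in> K \<longrightarrow> \<bar>f (v x)\<bar> \<le> C"
  proof -
    have "bounded (f ` {-B..B})"
      by (intro compact_imp_bounded compact_continuous_image continuous_on_subset[OF assms(2)]) auto
    then obtain C where C: "\<And>s. s \<in> {-B..B} \<Longrightarrow> \<bar>f s\<bar> \<le> C"
      unfolding bounded_iff by (metis imageI real_norm_def)
    show ?thesis using B(2) by (intro exI[of _ C], eventually_elim) (auto intro!: C)
  qed
  ultimately show "(\<lambda>x. indicator K x * f (v x)) \<in> borel_measurable (leb N)
      \<and> (\<exists>B. AE x in leb N. x \<in> K \<longrightarrow> \<bar>f (v x)\<bar> \<le> B)" by simp
qed

lemma locally_integrable_mult:
  assumes "locally_bounded N \<Omega> h" "locally_integrable N \<Omega> g"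
  shows "locally_integrable N \<Omega> (\<lambda>x. h x * g x)"
  unfolding locally_integrable_def
proof (intro allI impI)
  fix K assume K: "compactin (Rn N) K \<and> K \<subseteq> \<Omega>"
  obtain B where B: "B > 0" "(\<lambda>x. indicator K x * h x) \<in> borel_measurable (leb N)" "AE x in leb N. x \<in> K \<longrightarrow> \<bar>h x\<bar> \<le> B"
    by (rule locally_boundedD[OF assms(1) conjunct1[OF K] conjunct2[OF K]])
  have g: "integrable (leb N) (\<lambda>x. indicator K x * g x)"
    using assms(2) K by (auto simp: locally_integrable_def set_integrable_def)
  have "integrable (leb N) (\<lambda>x. (indicator K x * h x) * (indicator K x * g x))"
  proof (rule Bochner_Integration.integrable_bound)
    show "integrable (leb N) (\<lambda>x. B * (indicator K x * g x))" using g by auto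
    show "(\<lambda>x. (indicator K x * h x) * (indicator K x * g x)) \<in> borel_measurable (leb N)"
      by (rule borel_measurable_times[OF B(2) borel_measurable_integrable[OF g]])
    show "AE x in leb N. norm ((indicator K x * h x) * (indicator K x * g x)) \<le> norm (B * (indicator K x * g x))"
      using B(3) by eventually_elim (use B(1) in \<open>auto simp: indicator_def abs_mult intro!: mult_right_mono\<close>)
  qed
  then show "set_integrable (leb N) K (\<lambda>x. h x * g x)"
    unfolding set_integrable_def by (rule back_subst[of "integrable (leb N)"]) (auto simp: indicator_def)
qed

text \<open>Compact sets have finite measure: their coordinate projections are bounded, so they lie
  in a box of finite volume.\<close>

lemma locally_integrable_const: "locally_integrable N \<Omega> (\<lambda>x. c)"
  unfolding locally_integrable_def set_integrable_def
proof (intro allI impI)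
  fix K assume K: "compactin (Rn N) K \<and> K \<subseteq> \<Omega>"
  have "\<exists>B. \<forall>x\<in>K. \<bar>x j\<bar> \<le> B" if "j < N" for j
  proof -
    have "continuous_map (Rn N) euclideanreal (\<lambda>x. x j)"
      using that by (intro continuous_map_product_projection) auto
    then have "compactin euclideanreal ((\<lambda>x. x j) ` K)" using K image_compactin by blast
    then have "bounded ((\<lambda>x. x j) ` K)" by (simp add: compact_imp_bounded)
    then show ?thesis by (simp add: bounded_iff)
  qed
  then obtain B where B: "\<And>j x. j < N \<Longrightarrow> x \<in> K \<Longrightarrow> \<bar>x j\<bar> \<le> B j" by metis
  interpret product_sigma_finite "\<lambda>_::nat. lborel :: real measure" ..
  have "K \<subseteq> topspace (Rn N)" using K compactin_subset_topspace by blast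
  have "K \<subseteq> box_closed N (\<lambda>j. - B j) B"
  proof
    fix x assume x: "x \<in> K"
    with \<open>K \<subseteq> topspace (Rn N)\<close> have "x \<in> extensional {..<N}" by (auto simp: PiE_def)
    moreover have "x j \<in> {- B j..B j}" if "j < N" for j
      using B[OF that x] by (simp add: abs_le_iff)
    ultimately show "x \<in> box_closed N (\<lambda>j. - B j) B" by (simp add: PiE_iff)
  qed
  then have "emeasure (PN N) K \<le> emeasure (PN N) (box_closed N (\<lambda>j. - B j) B)"
    by (intro emeasure_mono sets_box_closed)
  also have "\<dots> = (\<Prod>j<N. emeasure lborel {- B j..B j})"
    by (subst emeasure_PiM) auto
  also have "\<dots> < \<infinity>"
    by (auto simp: ennreal_prod_eq_top less_top[symmetric] emeasure_lborel_Icc_eq)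
  finally have "integrable (PN N) (indicator K :: _ \<Rightarrow> real)"
    using K by (intro integrable_real_indicator sets_compact) auto
  then have "integrable (leb N) (indicator K :: _ \<Rightarrow> real)"
    using K by (subst leb_integrable) (auto intro!: borel_measurable_indicator sets_compact)
  then show "integrable (leb N) (\<lambda>x. indicator K x *\<^sub>R c)" by simp
qed

lemma locally_bounded_integrable: "locally_bounded N \<Omega> h \<Longrightarrow> locally_integrable N \<Omega> h"
  using locally_integrable_mult[of N \<Omega> h "\<lambda>_. 1"] locally_integrable_const by simp

lemma locally_integrable_add:
  "locally_integrable N \<Omega> f \<Longrightarrow> locally_integrable N \<Omega> g \<Longrightarrow> locally_integrable N \<Omega> (\<lambda>x. f x + g x)"
  by (auto simp: locally_integrable_def)

lemma Linf_loc_bounded: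
  assumes "openin (Rn N) \<Omega>" "v \<in> Linf_loc N \<Omega>" shows "locally_bounded N \<Omega> v"
  unfolding locally_bounded_def
proof (intro allI impI conjI)
  fix K assume K: "compactin (Rn N) K \<and> K \<subseteq> \<Omega>"
  have "(\<lambda>x. indicator \<Omega> x * v x) \<in> borel_measurable (leb N)"
    using assms by (auto simp: Linf_loc_def set_borel_measurable_def)
  then have "(\<lambda>x. indicator K x * (indicator \<Omega> x * v x)) \<in> borel_measurable (leb N)"
    by (rule borel_measurable_times[rotated]) (use K in \<open>auto intro!: borel_measurable_indicator leb_sets sets_compact\<close>)
  moreover have "indicator K x * (indicator \<Omega> x * v x) = indicator K x * v x" for x
    using K by (auto simp: indicator_def)
  ultimately show "(\<lambda>x. indicator K x * v x) \<in> borel_measurable (leb N)" by simp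
  show "\<exists>B. AE x in leb N. x \<in> K \<longrightarrow> \<bar>v x\<bar> \<le> B"
    using assms(2) K by (auto simp: Linf_loc_def)
qed

lemma compact_support_integrable:
  assumes "locally_integrable N \<Omega> h" "compactin (Rn N) K" "K \<subseteq> \<Omega>" "\<And>x. x \<in> \<Omega> - K \<Longrightarrow> h x = 0"
  shows "set_integrable (leb N) \<Omega> h"
proof -
  have "set_integrable (leb N) K h" using assms by (auto simp: locally_integrable_def)
  then show ?thesis
    unfolding set_integrable_def
    by (rule back_subst[of "integrable (leb N)"]) (use assms(3,4) in \<open>auto simp: indicator_def fun_eq_iff\<close>)
qed

text \<open>This is how the chosen representative \<open>weak_grad\<close> is computed: it and H
  have the same integrals against every test function, so the fundamental lemma applies to the
  difference of their components.\<close>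

lemma weak_grad_unique:
  assumes \<Omega>: "openin (Rn N) \<Omega>" and H: "is_weak_grad N \<Omega> u H"
  shows "AE x in leb N. x \<in> \<Omega> \<longrightarrow> (\<forall>i<N. weak_grad N \<Omega> u x i = H x i)"
proof -
  let ?G = "weak_grad N \<Omega> u"
  have G: "is_weak_grad N \<Omega> u ?G" unfolding weak_grad_def using someI[of "is_weak_grad N \<Omega> u", OF H] .
  have "AE x in leb N. x \<in> \<Omega> \<longrightarrow> ?G x i - H x i = 0" if i: "i < N" for i
  proof (rule fundamental_lemma[OF \<Omega>])
    have li: "locally_integrable N \<Omega> (\<lambda>x. ?G x i)" "locally_integrable N \<Omega> (\<lambda>x. H x i)"
      using G H i by (auto simp: is_weak_grad_def)
    then show "locally_integrable N \<Omega> (\<lambda>x. ?G x i - H x i)"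
      by (auto simp: locally_integrable_def)
    fix \<eta> assume \<eta>: "\<eta> \<in> test_functions N \<Omega>"
    then have "\<eta> \<in> C_k_compact 0 N \<Omega>" by (auto simp: test_functions_def)
    then obtain K where K: "compactin (Rn N) K" "K \<subseteq> \<Omega>" "\<And>x. x \<in> \<Omega> - K \<Longrightarrow> \<eta> x = 0"
      and c: "continuous_map (subtopology (Rn N) \<Omega>) euclideanreal \<eta>"
      by (auto simp: C_k_compact_def)
    have ig: "set_integrable (leb N) \<Omega> (\<lambda>x. g x * \<eta> x)" if "locally_integrable N \<Omega> g" for g
      using locally_integrable_mult[OF locally_bounded_continuous[OF \<Omega> c] that]
      by (intro compact_support_integrable[OF _ K(1,2)]) (simp_all add: mult.commute K(3))
    have "(LINT x:\<Omega>|leb N. (?G x i - H x i) * \<eta> x) = (LINT x:\<Omega>|leb N. ?G x i * \<eta> x) - (LINT x:\<Omega>|leb N. H x i * \<eta> x)"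
      unfolding left_diff_distrib by (intro set_integral_diff ig li)
    also have "\<dots> = 0" using G H i \<eta> unfolding is_weak_grad_def by (metis cancel_comm_monoid_add_class.diff_cancel minus_equation_iff)
    finally show "(LINT x:\<Omega>|leb N. (?G x i - H x i) * \<eta> x) = 0" .
  qed
  then have "AE x in leb N. \<forall>i\<in>{..<N}. x \<in> \<Omega> \<longrightarrow> ?G x i - H x i = 0"
    by (subst AE_ball_countable) auto
  then show ?thesis by eventually_elim auto
qed

subsection \<open>Chain and product rule for weak gradients\<close>

lemma partial_zero_outside:
  assumes \<Omega>: "openin (Rn N) \<Omega>" and K: "compactin (Rn N) K" "\<And>x. x \<in> \<Omega> - K \<Longrightarrow> \<Phi> x = 0"
    and x: "x \<in> \<Omega> - K" and i: "i < N"
  shows "partial i \<Phi> x = 0"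
  by (rule partial_zero[OF openin_Diff_compact[OF \<Omega> K(1)] x i]) (rule K(2))

lemma C_k_compactE:
  assumes "\<Phi> \<in> C_k_compact k N \<Omega>"
  obtains K where "C_k k N \<Omega> \<Phi>" "compactin (Rn N) K" "K \<subseteq> \<Omega>" "\<And>x. x \<in> \<Omega> - K \<Longrightarrow> \<Phi> x = 0"
  using assms by (auto simp: C_k_compact_def)

text \<open>Integrability is settled before the identity itself, so that the integral can be split
  additively when \<Phi> is cut into pieces.\<close>

lemma chain_integrable:
  assumes \<Omega>: "openin (Rn N) \<Omega>" and i: "i < N"
    and G: "is_weak_grad N \<Omega> v G" and bd: "locally_bounded N \<Omega> v"
    and cf: "continuous_on UNIV f" and f': "continuous_on UNIV f'"
    and \<Phi>: "\<Phi> \<in> C_k_compact 1 N \<Omega>"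
  shows "set_integrable (leb N) \<Omega> (\<lambda>x. f (v x) * partial i \<Phi> x + f' (v x) * \<Phi> x * G x i)"
proof -
  obtain K where C1: "C_k 1 N \<Omega> \<Phi>" and K: "compactin (Rn N) K" "K \<subseteq> \<Omega>" "\<And>x. x \<in> \<Omega> - K \<Longrightarrow> \<Phi> x = 0"
    by (rule C_k_compactE[OF \<Phi>]) blast
  have C1: "C_k (Suc 0) N \<Omega> \<Phi>" using C1 by simp
  have c\<Phi>: "continuous_map (subtopology (Rn N) \<Omega>) euclideanreal \<Phi>" by (rule C_k_imp_continuous[OF C1])
  have cd\<Phi>: "continuous_map (subtopology (Rn N) \<Omega>) euclideanreal (partial i \<Phi>)"
    using C_k_partial[OF C1 i] by simp
  have "locally_integrable N \<Omega> (\<lambda>x. f (v x) * partial i \<Phi> x + f' (v x) * \<Phi> x * G x i)"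
  proof (rule locally_integrable_add[OF locally_bounded_integrable locally_integrable_mult])
    show "locally_bounded N \<Omega> (\<lambda>x. f (v x) * partial i \<Phi> x)"
      by (intro locally_bounded_mult locally_bounded_compose[OF bd cf] locally_bounded_continuous[OF \<Omega> cd\<Phi>])
    show "locally_bounded N \<Omega> (\<lambda>x. f' (v x) * \<Phi> x)"
      by (intro locally_bounded_mult locally_bounded_compose[OF bd f'] locally_bounded_continuous[OF \<Omega> c\<Phi>])
    show "locally_integrable N \<Omega> (\<lambda>x. G x i)"
      using G i by (auto simp: is_weak_grad_def)
  qed
  then show ?thesis
    by (rule compact_support_integrable[OF _ K(1,2)])
      (use K(3) partial_zero_outside[OF \<Omega> K(1,3) _ i] in simp)
qed

lemma AE_lborel_le: "(AE t in lborel. t \<in> {a<..<b} \<longrightarrow> P t) \<Longrightarrow> (AE t in lborel. t \<in> {a..b::real} \<longrightarrow> P t)"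
proof -
  assume *: "AE t in lborel. t \<in> {a<..<b} \<longrightarrow> P t"
  have "AE t in lborel. t \<noteq> a" "AE t in lborel. t \<noteq> b" by (rule AE_lborel_singleton)+
  with * show ?thesis by eventually_elim auto
qed

text \<open>Fubini in coordinate i. On almost every line through the box v agrees almost everywhere
  with a primitive V, the integrand is the derivative of f(V) \<Phi>, and \<Phi> is 0 at both ends
  of the side. All other lines contribute 0.\<close>

lemma chain_rule_in_box:
  assumes \<Omega>: "openin (Rn N) \<Omega>" and i: "i < N" and ab: "box_closed N a b \<subseteq> \<Omega>" "a i < b i"
    and G: "is_weak_grad N \<Omega> v G" and bd: "locally_bounded N \<Omega> v"
    and f: "\<And>x. (f has_real_derivative f' x) (at x)" and f': "continuous_on UNIV f'"
    and \<Phi>: "C_k 1 N \<Omega> \<Phi>" "\<And>x. x \<in> \<Omega> - obox N a b \<Longrightarrow> \<Phi> x = 0"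
  shows "(LINT x:\<Omega>|leb N. f (v x) * partial i \<Phi> x + f' (v x) * \<Phi> x * G x i) = 0"
proof -
  let ?Q = "box_closed N a b"
  have cf: "continuous_on UNIV f"
    using f by (auto intro!: continuous_at_imp_continuous_on DERIV_isCont)
  have C1: "C_k (Suc 0) N \<Omega> \<Phi>" using \<Phi>(1) by simp
  have c\<Phi>: "continuous_map (subtopology (Rn N) \<Omega>) euclideanreal \<Phi>" by (rule C_k_imp_continuous[OF C1])
  have cd\<Phi>: "continuous_map (subtopology (Rn N) \<Omega>) euclideanreal (partial i \<Phi>)"
    using C_k_partial[OF C1 i] by simp
  have \<Phi>Q: "\<Phi> x = 0" "partial i \<Phi> x = 0" if "x \<in> \<Omega> - ?Q" for x
  proof -
    have 0: "\<Phi> x = 0" if "x \<in> \<Omega> - ?Q" for x using \<Phi>(2) that obox_subset[of N a b] by blast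
    from 0[OF that] show "\<Phi> x = 0" .
    show "partial i \<Phi> x = 0" by (rule partial_zero_outside[OF \<Omega> compactin_box 0 that i])
  qed
  \<comment> \<open>If some other coordinate is outside its open side, the whole line misses the
    open box; \<Phi> then vanishes along it within \<open>\<Omega>\<close>, and so does its
    derivative in that direction.\<close>
  have \<Phi>line: "\<Phi> x = 0 \<and> partial i \<Phi> x = 0" if x: "x \<in> \<Omega>" and j: "j < N" "j \<noteq> i" "x j \<notin> {a j<..<b j}" for x j
  proof -
    have 0: "\<Phi> (x(i := t)) = 0" if "x(i := t) \<in> \<Omega>" for t
    proof -
      have "x(i := t) \<notin> obox N a b" using j by (auto simp: PiE_iff)
      with that show ?thesis by (intro \<Phi>(2)) simp
    qed
    have "deriv (\<lambda>t. \<Phi> (x(i := t))) (x i) = deriv (\<lambda>t. 0) (x i)"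
      by (rule deriv_cong_ev[OF eventually_mono[OF eventually_upd[OF \<Omega> x i]]]) (auto intro: 0)
    then show ?thesis using 0[of "x i"] x by (simp add: partial_def)
  qed
  have iv: "integrable (leb N) (\<lambda>x. indicator ?Q x * v x)" and iG: "integrable (leb N) (\<lambda>x. indicator ?Q x * G x i)"
    using G i ab(1) compactin_box[of N a b] by (auto simp: is_weak_grad_def locally_integrable_def set_integrable_def)
  obtain v' where v': "integrable (PN N) v'" "AE x in leb N. indicator ?Q x * v x = v' x"
    by (rule leb_integrable_rep[OF iv])
  obtain G' where G': "integrable (PN N) G'" "AE x in leb N. indicator ?Q x * G x i = G' x"
    by (rule leb_integrable_rep[OF iG])
  have v'm[measurable]: "v' \<in> borel_measurable (PN N)" and G'm[measurable]: "G' \<in> borel_measurable (PN N)" using v' G' by auto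
  have lines: "AE y in PJ N i. (\<forall>j\<in>{..<N}-{i}. y j \<in> {a j<..<b j}) \<longrightarrow>
    integrable lborel (\<lambda>t. G' (y(i := t))) \<and>
    (\<exists>c. AE t in lborel. t \<in> {a i<..<b i} \<longrightarrow> v' (y(i := t)) = c + integral {a i..t} (\<lambda>s. G' (y(i := s))))"
  proof (rule absolutely_continuous_on_lines[where a = a and b = b, OF i ab(2) v'(1) G'(1)])
    fix \<beta> assume \<beta>: "box_test N a b \<beta>"
    have si: "smooth (\<beta> i)" "\<And>t. t \<notin> {a i<..<b i} \<Longrightarrow> \<beta> i t = 0" using \<beta> i by (auto simp: box_test_def)
    have sm: "smooth ((\<beta>(i := deriv (\<beta> i))) j)" if "j < N" for j
      using \<beta> that smooth_deriv[OF si(1)] by (auto simp: box_test_def)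
    have z: "tensor N (\<beta>(i := deriv (\<beta> i))) x = 0" if "x \<in> \<Omega> - box_closed N a b" for x
    proof -
      have "partial i (tensor N \<beta>) x = 0"
        by (rule partial_zero_outside[OF \<Omega> compactin_box _ that i]) (rule tensor_zero_closed[OF \<Omega> \<beta>])
      then show ?thesis by (simp only: partial_tensor[where b = \<beta>, OF si(1) i])
    qed
    have "(LINT x|PN N. v' x * tensor N (\<beta>(i := deriv (\<beta> i))) x) = (LINT x:\<Omega>|leb N. v x * tensor N (\<beta>(i := deriv (\<beta> i))) x)"
      by (rule LINT_box_rep[symmetric, OF ab(1) iv v'm v'(2) tensor_measurable[OF sm] z])
    also have "\<dots> = (LINT x:\<Omega>|leb N. v x * partial i (tensor N \<beta>) x)"
      by (simp only: partial_tensor[where b = \<beta>, OF si(1) i])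
    also have "\<dots> = - (LINT x:\<Omega>|leb N. G x i * tensor N \<beta> x)"
      using G i box_test_function[OF \<Omega> ab(1) \<beta>] by (auto simp: is_weak_grad_def)
    also have "(LINT x:\<Omega>|leb N. G x i * tensor N \<beta> x) = (LINT x|PN N. G' x * tensor N \<beta> x)"
      by (rule LINT_box_rep[OF ab(1) iG G'm G'(2) box_test_measurable[OF \<beta>] tensor_zero_closed[OF \<Omega> \<beta>]])
    finally show "(LINT x|PN N. v' x * tensor N (\<beta>(i := deriv (\<beta> i))) x) = - (LINT x|PN N. G' x * tensor N \<beta> x)" .
  qed
  let ?\<Phi> = "\<lambda>x. indicator ?Q x * (indicator \<Omega> x * \<Phi> x)"
  let ?d\<Phi> = "\<lambda>x. indicator ?Q x * (indicator \<Omega> x * partial i \<Phi> x)"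
  have [measurable]: "?\<Phi> \<in> borel_measurable (PN N)" "?d\<Phi> \<in> borel_measurable (PN N)"
    by (intro borel_measurable_times borel_measurable_indicator sets_box_closed measurable_continuous_on_open[OF \<Omega>] c\<Phi> cd\<Phi>)+
  have fm[measurable]: "f \<in> borel_measurable borel" "f' \<in> borel_measurable borel"
    using cf f' borel_measurable_continuous_onI by auto
  \<comment> \<open>A version of the integrand that is measurable for the product measure and zero
    off the closed box.\<close>
  define H where "H x = f (v' x) * ?d\<Phi> x + f' (v' x) * ?\<Phi> x * G' x" for x
  have Hm[measurable]: "H \<in> borel_measurable (PN N)" unfolding H_def by measurable
  have "\<Phi> \<in> C_k_compact 1 N \<Omega>"
    unfolding C_k_compact_def using \<Phi>(1) \<Phi>Q(1) compactin_box[of N a b] ab(1) by blast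
  then have si: "set_integrable (leb N) \<Omega> (\<lambda>x. f (v x) * partial i \<Phi> x + f' (v x) * \<Phi> x * G x i)"
    by (rule chain_integrable[OF \<Omega> i G bd cf f'])
  have Hae: "AE x in leb N. indicator \<Omega> x *\<^sub>R (f (v x) * partial i \<Phi> x + f' (v x) * \<Phi> x * G x i) = H x"
    using v'(2) G'(2)
  proof eventually_elim
    case (elim x)
    show ?case
    proof (cases "x \<in> ?Q")
      case True
      then have "x \<in> \<Omega>" using ab by auto
      with True elim show ?thesis by (simp add: H_def)
    next
      case False
      then show ?thesis using \<Phi>Q[of x] by (cases "x \<in> \<Omega>") (simp_all add: H_def)
    qed
  qed
  have Hi: "integrable (leb N) H"
    using integrable_cong_AE_imp[OF si[unfolded set_integrable_def] leb_measurable[OF Hm]] Hae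
    by (simp add: eq_commute)
  then have HiP: "integrable (PN N) H" using leb_integrable[OF Hm] by simp
  have "(LINT x:\<Omega>|leb N. f (v x) * partial i \<Phi> x + f' (v x) * \<Phi> x * G x i) = (LINT x|leb N. H x)"
    unfolding set_lebesgue_integral_def
    by (rule integral_cong_AE) (use Hae si leb_measurable[OF Hm] in \<open>auto simp: set_integrable_def dest: borel_measurable_integrable\<close>)
  also have "\<dots> = (LINT x|PN N. H x)" by (rule leb_integral[OF Hm])
  also have "\<dots> = (LINT y|PJ N i. LINT t|lborel. H (y(i := t)))" by (rule upd_integral[OF i HiP])
  also have "\<dots> = (LINT y|PJ N i. 0)"
  proof (rule integral_cong_AE)
    show "(\<lambda>y. LINT t|lborel. H (y(i := t))) \<in> borel_measurable (PJ N i)"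
      using measurable_compose[OF measurable_upd[OF i] Hm]
      by (intro sigma_finite_measure.borel_measurable_lebesgue_integral[OF sigma_finite_lborel]) (simp add: split_beta')
    show "AE y in PJ N i. (LINT t|lborel. H (y(i := t))) = 0"
      using lines upd_AE_integrable[OF i HiP] AE_space
    proof eventually_elim
      case (elim y)
      have yx: "y \<in> extensional {..<N}"
        using elim(3) unfolding space_PiM by (auto simp: PiE_iff extensional_def)
      have ye: "y(i := t) \<in> extensional {..<N}" for t
        using yx i by (auto simp: extensional_def)
      show ?case
      proof (cases "\<forall>j\<in>{..<N}-{i}. y j \<in> {a j<..<b j}")
        case False
        then obtain j where j: "j < N" "j \<noteq> i" "y j \<notin> {a j<..<b j}" by auto
        have "H (y(i := t)) = 0" for t
          using \<Phi>line[of "y(i := t)" j] j by (cases "y(i := t) \<in> \<Omega>") (simp_all add: H_def)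
        then show ?thesis by simp
      next
        case True
        then obtain c where yG: "integrable lborel (\<lambda>t. G' (y(i := t)))" and
          c: "AE t in lborel. t \<in> {a i<..<b i} \<longrightarrow> v' (y(i := t)) = c + integral {a i..t} (\<lambda>s. G' (y(i := s)))"
          using elim(1) by blast
        \<comment> \<open>The absolutely continuous version of v on this line, equal to
          \<open>v'\<close> at almost every t of the side.\<close>
        define V where "V t = c + integral {a i..t} (\<lambda>s. G' (y(i := s)))" for t
        have P: "primitive_on (a i) (b i) V (\<lambda>s. G' (y(i := s)))"
        proof (rule primitive_onI[where c = c])
          show "set_integrable lborel {a i..b i} (\<lambda>s. G' (y(i := s)))"
            unfolding set_integrable_def by (rule integrable_mult_indicator[OF _ yG]) simp
        qed (simp add: V_def)
        have inQ: "y(i := t) \<in> ?Q \<longleftrightarrow> t \<in> {a i..b i}" for t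
          using True i ye(1)[of t] by (auto simp: PiE_iff less_imp_le split: if_splits)
        have in\<Omega>: "y(i := t) \<in> \<Omega>" if "t \<in> {a i..b i}" for t using inQ that ab by blast
        have cc: "continuous_on {a i..b i} (\<lambda>t. \<Phi> (y(i := t)))"
          by (rule continuous_on_line[OF c\<Phi> yx i in\<Omega>])
        have cd: "continuous_on {a i..b i} (\<lambda>t. partial i \<Phi> (y(i := t)))"
          by (rule continuous_on_line[OF cd\<Phi> yx i in\<Omega>])
        have "(LINT t|lborel. H (y(i := t))) = (LINT t:{a i..b i}|lborel. f (V t) * partial i \<Phi> (y(i := t)) + f' (V t) * G' (y(i := t)) * \<Phi> (y(i := t)))"
          unfolding set_lebesgue_integral_def
        proof (rule integral_cong_AE)
          show "(\<lambda>t. H (y(i := t))) \<in> borel_measurable lborel" using elim(2) by auto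
          have "set_integrable lborel {a i..b i} (\<lambda>t. f (V t) * partial i \<Phi> (y(i := t)) + f' (V t) * \<Phi> (y(i := t)) * G' (y(i := t)))"
          proof (rule set_integral_add(1)[OF borel_integrable_atLeastAtMost' set_integrable_continuous_mult])
            have cV: "continuous_on {a i..b i} (\<lambda>t. h (V t))" if "continuous_on UNIV h" for h :: "real \<Rightarrow> real"
              by (rule continuous_on_compose2[OF that primitive_on_continuous[OF P]]) simp
            show "continuous_on {a i..b i} (\<lambda>t. f (V t) * partial i \<Phi> (y(i := t)))"
              by (rule continuous_on_mult[OF cV[OF cf] cd])
            show "continuous_on {a i..b i} (\<lambda>t. f' (V t) * \<Phi> (y(i := t)))"
              by (rule continuous_on_mult[OF cV[OF f'] cc])
            show "set_integrable lborel {a i..b i} (\<lambda>t. G' (y(i := t)))"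
              using P by (simp add: primitive_on_def)
          qed
          then show "(\<lambda>t. indicator {a i..b i} t *\<^sub>R (f (V t) * partial i \<Phi> (y(i := t)) + f' (V t) * G' (y(i := t)) * \<Phi> (y(i := t)))) \<in> borel_measurable lborel"
            unfolding set_integrable_def by (auto simp: mult_ac dest: borel_measurable_integrable)
          show "AE t in lborel. H (y(i := t)) = indicator {a i..b i} t *\<^sub>R (f (V t) * partial i \<Phi> (y(i := t)) + f' (V t) * G' (y(i := t)) * \<Phi> (y(i := t)))"
            using AE_lborel_le[OF c]
          proof eventually_elim
            case (elim t)
            then show ?case using inQ[of t] in\<Omega>[of t] by (cases "t \<in> {a i..b i}") (simp_all add: H_def V_def)
          qed
        qed
        also have "\<dots> = 0"
        proof (rule primitive_on_by_parts[OF P _ f f'])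
          show "((\<lambda>t. \<Phi> (y(i := t))) has_real_derivative partial i \<Phi> (y(i := t))) (at t)" if "t \<in> {a i..b i}" for t
            using C_k_Suc_DERIV[OF C1 in\<Omega>[OF that] i] by simp
          show "continuous_on {a i..b i} (\<lambda>t. partial i \<Phi> (y(i := t)))"
            by (rule cd)
          have "y(i := t) \<notin> obox N a b" if "t \<notin> {a i<..<b i}" for t
          proof
            assume "y(i := t) \<in> obox N a b"
            then have "(y(i := t)) i \<in> {a i<..<b i}" by (rule PiE_mem) (simp add: i)
            with that show False by simp
          qed
          then show "\<Phi> (y(i := a i)) = 0" "\<Phi> (y(i := b i)) = 0"
            using in\<Omega>[of "a i"] in\<Omega>[of "b i"] ab(2) by (simp_all add: \<Phi>(2))
        qed (use ab in auto)
        finally show ?thesis .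
      qed
    qed
  qed auto
  finally show ?thesis by simp
qed

lemma partial_add:
  assumes "C_k (Suc k) N \<Omega> f" "C_k (Suc k) N \<Omega> g" "x \<in> \<Omega>" "i < N"
  shows "partial i (\<lambda>x. f x + g x) x = partial i f x + partial i g x"
  by (rule partialI[OF DERIV_add[OF C_k_Suc_DERIV[OF assms(1,3,4)] C_k_Suc_DERIV[OF assms(2-4)]]])

lemma C_k_compact_mult:
  assumes "openin (Rn N) \<Omega>" "\<Phi> \<in> C_k_compact k N \<Omega>" "C_k k N \<Omega> g"
  shows "(\<lambda>x. \<Phi> x * g x) \<in> C_k_compact k N \<Omega>"
proof -
  obtain K where "C_k k N \<Omega> \<Phi>" "compactin (Rn N) K" "K \<subseteq> \<Omega>" "\<And>x. x \<in> \<Omega> - K \<Longrightarrow> \<Phi> x = 0"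
    using C_k_compactE[OF assms(2)] by blast
  then show ?thesis
    using C_k_mult[OF assms(1) _ assms(3)] unfolding C_k_compact_def by auto
qed

text \<open>By induction on the number of boxes covering the support: a cutoff for one box splits \<open>\<Phi>\<close> into a
  part supported in that box and a part supported in the remaining ones.\<close>

lemma chain_rule_compact:
  assumes \<Omega>: "openin (Rn N) \<Omega>" and i: "i < N"
    and G: "is_weak_grad N \<Omega> v G" and bd: "locally_bounded N \<Omega> v"
    and f: "\<And>x. (f has_real_derivative f' x) (at x)" and f': "continuous_on UNIV f'"
    and \<Phi>: "\<Phi> \<in> C_k_compact 1 N \<Omega>"
  shows "(LINT x:\<Omega>|leb N. f (v x) * partial i \<Phi> x + f' (v x) * \<Phi> x * G x i) = 0"
proof -
  have cf: "continuous_on UNIV f"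
    using f by (auto intro!: continuous_at_imp_continuous_on DERIV_isCont)
  define T where "T \<Phi> = (LINT x:\<Omega>|leb N. f (v x) * partial i \<Phi> x + f' (v x) * \<Phi> x * G x i)" for \<Phi> :: "point \<Rightarrow> real"
  \<comment> \<open>A good box leaves room inside \<open>\<Omega>\<close>: a cutoff can be 1 on the
    box with corners c, d and still be supported in a larger box contained in
    \<open>\<Omega>\<close>.\<close>
  define good where "good c d \<longleftrightarrow> (\<exists>a b. box_closed N a b \<subseteq> \<Omega> \<and> (\<forall>j<N. a j < c j \<and> c j < d j \<and> d j < b j))" for c d :: "nat \<Rightarrow> real"
  have T_add: "T (\<lambda>x. \<Phi>1 x + \<Phi>2 x) = T \<Phi>1 + T \<Phi>2"
    if "\<Phi>1 \<in> C_k_compact 1 N \<Omega>" "\<Phi>2 \<in> C_k_compact 1 N \<Omega>" for \<Phi>1 \<Phi>2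
  proof -
    have C: "C_k (Suc 0) N \<Omega> \<Phi>1" "C_k (Suc 0) N \<Omega> \<Phi>2" using that by (auto simp: C_k_compact_def)
    have "T (\<lambda>x. \<Phi>1 x + \<Phi>2 x) = (LINT x:\<Omega>|leb N. (f (v x) * partial i \<Phi>1 x + f' (v x) * \<Phi>1 x * G x i)
       + (f (v x) * partial i \<Phi>2 x + f' (v x) * \<Phi>2 x * G x i))"
      unfolding T_def
      by (rule set_lebesgue_integral_cong) (auto simp: leb_sets sets_open \<Omega> partial_add[OF C _ i] algebra_simps)
    also have "\<dots> = T \<Phi>1 + T \<Phi>2"
      unfolding T_def by (intro set_integral_add chain_integrable[OF \<Omega> i G bd cf f'] that)
    finally show ?thesis .
  qed
  have cover: "\<forall>\<Phi>\<in>C_k_compact 1 N \<Omega>. (\<forall>(c, d)\<in>S. good c d) \<longrightarrow>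
      (\<forall>x\<in>\<Omega>. x \<notin> (\<Union>(c, d)\<in>S. box_closed N c d) \<longrightarrow> \<Phi> x = 0) \<longrightarrow> T \<Phi> = 0"
    if "finite S" for S :: "((nat \<Rightarrow> real) \<times> (nat \<Rightarrow> real)) set"
    using that
  proof (induction S rule: finite_induct)
    case empty
    show ?case
    proof (intro ballI impI)
      fix \<Phi> :: "point \<Rightarrow> real" assume "\<forall>x\<in>\<Omega>. x \<notin> (\<Union>(c, d)\<in>{}. box_closed N c d) \<longrightarrow> \<Phi> x = 0"
      then have 0: "\<Phi> x = 0" if "x \<in> \<Omega>" for x using that by simp
      have "T \<Phi> = (LINT x:\<Omega>|leb N. 0)"
        unfolding T_def
        by (rule set_lebesgue_integral_cong) (auto simp: leb_sets sets_open \<Omega> 0 partial_zero[OF \<Omega> _ i 0])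
      then show "T \<Phi> = 0" by simp
    qed
  next
    case (insert cd S)
    obtain c d where cd: "cd = (c, d)" by force
    show ?case
    proof (intro ballI impI)
      fix \<Phi> assume \<Phi>: "\<Phi> \<in> C_k_compact 1 N \<Omega>" and good: "\<forall>(c, d)\<in>insert cd S. good c d"
        and 0: "\<forall>x\<in>\<Omega>. x \<notin> (\<Union>(c, d)\<in>insert cd S. box_closed N c d) \<longrightarrow> \<Phi> x = 0"
      have "good c d" using good cd by simp
      then obtain a b where ab: "box_closed N a b \<subseteq> \<Omega>" "\<And>j. j < N \<Longrightarrow> a j < c j \<and> c j < d j \<and> d j < b j"
        unfolding good_def by blast
      have "\<exists>s. smooth s \<and> (\<forall>t. t \<notin> {a j<..<b j} \<longrightarrow> s t = 0) \<and> (\<forall>t. t \<in> {c j..d j} \<longrightarrow> s t = 1)" if "j < N" for j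
        using smooth_cutoff[of "a j" "c j" "d j" "b j"] ab(2)[OF that] by metis
      then obtain \<sigma> where \<sigma>: "\<And>j. j < N \<Longrightarrow> smooth (\<sigma> j) \<and> (\<forall>t. t \<notin> {a j<..<b j} \<longrightarrow> \<sigma> j t = 0) \<and> (\<forall>t. t \<in> {c j..d j} \<longrightarrow> \<sigma> j t = 1)"
        by metis
      define cut where "cut = tensor N \<sigma>"
      have bt: "box_test N a b \<sigma>" using \<sigma> by (auto simp: box_test_def)
      have Ccut: "C_k 1 N \<Omega> cut" unfolding cut_def using \<sigma> by (intro C_k_tensor[OF \<Omega>]) auto
      have Ccut': "C_k 1 N \<Omega> (\<lambda>x. 1 + (-1) * cut x)"
        by (intro C_k_add C_k_mult C_k_const \<Omega> Ccut)
      define \<Phi>1 where "\<Phi>1 x = \<Phi> x * cut x" for x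
      define \<Phi>2 where "\<Phi>2 x = \<Phi> x * (1 + (-1) * cut x)" for x
      have \<Phi>12: "\<Phi>1 \<in> C_k_compact 1 N \<Omega>" "\<Phi>2 \<in> C_k_compact 1 N \<Omega>"
        unfolding \<Phi>1_def[abs_def] \<Phi>2_def[abs_def] by (intro C_k_compact_mult[OF \<Omega> \<Phi>] Ccut Ccut')+
      have sum: "\<Phi> = (\<lambda>x. \<Phi>1 x + \<Phi>2 x)"
        by (rule ext) (simp add: \<Phi>1_def \<Phi>2_def algebra_simps)
      have "T \<Phi>1 = 0"
        unfolding T_def
      proof (rule chain_rule_in_box[OF \<Omega> i ab(1) _ G bd f f'])
        show "a i < b i" using ab(2)[OF i] by linarith
        show "C_k 1 N \<Omega> \<Phi>1" using \<Phi>12 by (simp add: C_k_compact_def)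
        show "\<Phi>1 x = 0" if "x \<in> \<Omega> - obox N a b" for x
        proof -
          have "tensor N \<sigma> x = 0"
            by (rule tensor_zero[OF bt]) (use that openin_Rn_extensional[OF \<Omega>] in blast)+
          then show ?thesis by (simp add: \<Phi>1_def cut_def)
        qed
      qed
      moreover have "T \<Phi>2 = 0"
      proof -
        have z: "\<Phi>2 x = 0" if x: "x \<in> \<Omega>" "x \<notin> (\<Union>(c, d)\<in>S. box_closed N c d)" for x
        proof (cases "x \<in> box_closed N c d")
          case True
          then have "x j \<in> {c j..d j}" if "j < N" for j using PiE_mem[OF True, of j] that by simp
          then have "tensor N \<sigma> x = 1"
            unfolding tensor_def using \<sigma> by (intro prod.neutral) auto
          then show ?thesis by (simp add: \<Phi>2_def cut_def)
        next
          case False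
          then have "x \<notin> (\<Union>(c, d)\<in>insert cd S. box_closed N c d)" using x by (simp add: cd)
          then show ?thesis using 0 x by (simp add: \<Phi>2_def)
        qed
        have "\<forall>(c, d)\<in>S. good c d" using good by blast
        with insert.IH \<Phi>12(2) z show ?thesis by blast
      qed
      ultimately show "T \<Phi> = 0" unfolding sum by (simp add: T_add[OF \<Phi>12])
    qed
  qed
  obtain K where K: "compactin (Rn N) K" "K \<subseteq> \<Omega>" "\<And>x. x \<in> \<Omega> - K \<Longrightarrow> \<Phi> x = 0"
    by (rule C_k_compactE[OF \<Phi>]) blast
  let ?U = "{(c, d). good c d}"
  have "K \<subseteq> \<Union>((\<lambda>(c, d). obox N c d) ` ?U)"
  proof
    fix x assume "x \<in> K"
    then have "x \<in> \<Omega>" using K by blast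
    from box_nbhd[OF \<Omega> this] obtain a b where ab: "x \<in> obox N a b" "box_closed N a b \<subseteq> \<Omega>" by metis
    \<comment> \<open>Midpoints between x and the corners, so that x is interior to the smaller box
      and a margin remains on every side.\<close>
    define c d where "c j = (a j + x j) / 2" and "d j = (x j + b j) / 2" for j
    have aj: "a j < x j \<and> x j < b j" if "j < N" for j using PiE_mem[OF ab(1), of j] that by simp
    then have lt: "a j < c j \<and> c j < d j \<and> d j < b j" if "j < N" for j
    proof -
      have "a j < x j" "x j < b j" using aj[OF that] by auto
      then show ?thesis unfolding c_def d_def by (intro conjI; simp)
    qed
    have "good c d" unfolding good_def using ab(2) lt by blast
    moreover have "x \<in> obox N c d"
    proof (rule PiE_I)
      fix j assume "j \<in> {..<N}"
      then show "x j \<in> {c j<..<d j}" using aj[of j] by (auto simp: c_def d_def)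
    next
      fix j assume "j \<notin> {..<N}"
      then show "x j = undefined" using ab(1) by (rule PiE_arb[rotated])
    qed
    ultimately show "x \<in> \<Union>((\<lambda>(c, d). obox N c d) ` ?U)" by blast
  qed
  moreover have "openin (Rn N) U" if "U \<in> (\<lambda>(c, d). obox N c d) ` ?U" for U
  proof -
    from that obtain p where "U = (\<lambda>(c, d). obox N c d) p" by (rule imageE)
    then have "U = obox N (fst p) (snd p)" by (simp only: split_beta)
    then show ?thesis using openin_obox[of N "fst p" "snd p"] by argo
  qed
  ultimately obtain \<F> where \<F>: "finite \<F>" "\<F> \<subseteq> (\<lambda>(c, d). obox N c d) ` ?U" "K \<subseteq> \<Union>\<F>"
    using compactinD[OF K(1), of "(\<lambda>(c, d). obox N c d) ` ?U"] by blast
  then obtain S where S: "S \<subseteq> ?U" "finite S" "\<F> = (\<lambda>(c, d). obox N c d) ` S"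
    using finite_subset_image[OF \<F>(1,2)] by blast
  have "\<Phi> x = 0" if "x \<in> \<Omega>" "x \<notin> (\<Union>(c, d)\<in>S. box_closed N c d)" for x
  proof (rule K(3))
    have "x \<notin> K"
    proof
      assume "x \<in> K"
      then obtain c d where "(c, d) \<in> S" "x \<in> obox N c d" using \<F>(3) S(3) by blast
      then show False using that(2) obox_subset[of N c d] by blast
    qed
    with that(1) show "x \<in> \<Omega> - K" by blast
  qed
  moreover have "\<forall>(c, d)\<in>S. good c d" using S(1) by blast
  ultimately have "T \<Phi> = 0" using cover[OF S(2)] \<Phi> by blast
  then show ?thesis by (simp add: T_def)
qed

text \<open>Testing with \<eta> amounts to the chain rule for v with \<Phi> = \<eta> \<phi>, whose
  product rule sorts the terms into the two required integrals. As \<phi> is only of class C^1, so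
  is \<eta> \<phi>; this is why the chain rule is proved for C^1 functions of compact support and
  not only for smooth ones.\<close>

lemma weak_grad_chain_product:
  assumes \<Omega>: "openin (Rn N) \<Omega>"
    and G: "is_weak_grad N \<Omega> v G" and bd: "locally_bounded N \<Omega> v"
    and f: "\<And>x. (f has_real_derivative f' x) (at x)" and f': "continuous_on UNIV f'"
    and \<phi>: "C_k 1 N \<Omega> \<phi>"
  shows "is_weak_grad N \<Omega> (\<lambda>x. f (v x) * \<phi> x) (\<lambda>x i. f' (v x) * \<phi> x * G x i + f (v x) * partial i \<phi> x)"
  unfolding is_weak_grad_def
proof (intro conjI allI impI ballI)
  have cf: "continuous_on UNIV f"
    using f by (auto intro!: continuous_at_imp_continuous_on DERIV_isCont)
  have C1: "C_k (Suc 0) N \<Omega> \<phi>" using \<phi> by simp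
  have c\<phi>: "continuous_map (subtopology (Rn N) \<Omega>) euclideanreal \<phi>" by (rule C_k_imp_continuous[OF C1])
  show "locally_integrable N \<Omega> (\<lambda>x. f (v x) * \<phi> x)"
    by (intro locally_bounded_integrable locally_bounded_mult locally_bounded_compose[OF bd cf]
        locally_bounded_continuous[OF \<Omega> c\<phi>])
  fix i assume i: "i < N"
  have cd\<phi>: "continuous_map (subtopology (Rn N) \<Omega>) euclideanreal (partial i \<phi>)"
    using C_k_partial[OF C1 i] by simp
  have Gi: "locally_integrable N \<Omega> (\<lambda>x. G x i)" using G i by (auto simp: is_weak_grad_def)
  show loc: "locally_integrable N \<Omega> (\<lambda>x. f' (v x) * \<phi> x * G x i + f (v x) * partial i \<phi> x)"
  proof (rule locally_integrable_add[OF locally_integrable_mult[OF _ Gi] locally_bounded_integrable])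
    show "locally_bounded N \<Omega> (\<lambda>x. f (v x) * partial i \<phi> x)"
      by (intro locally_bounded_mult locally_bounded_compose[OF bd cf] locally_bounded_continuous[OF \<Omega> cd\<phi>])
    show "locally_bounded N \<Omega> (\<lambda>x. f' (v x) * \<phi> x)"
      by (intro locally_bounded_mult locally_bounded_compose[OF bd f'] locally_bounded_continuous[OF \<Omega> c\<phi>])
  qed
  fix \<eta> assume "\<eta> \<in> test_functions N \<Omega>"
  then have \<eta>: "\<eta> \<in> C_k_compact 1 N \<Omega>" by (auto simp: test_functions_def)
  obtain K where K: "compactin (Rn N) K" "K \<subseteq> \<Omega>" "\<And>x. x \<in> \<Omega> - K \<Longrightarrow> \<eta> x = 0"
    by (rule C_k_compactE[OF \<eta>]) blast
  have C\<eta>: "C_k (Suc 0) N \<Omega> \<eta>" using \<eta> by (simp add: C_k_compact_def)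
  have c\<eta>: "continuous_map (subtopology (Rn N) \<Omega>) euclideanreal \<eta>" by (rule C_k_imp_continuous[OF C\<eta>])
  have cd\<eta>: "continuous_map (subtopology (Rn N) \<Omega>) euclideanreal (partial i \<eta>)"
    using C_k_partial[OF C\<eta> i] by simp
  have i1: "set_integrable (leb N) \<Omega> (\<lambda>x. f (v x) * \<phi> x * partial i \<eta> x)"
  proof (rule compact_support_integrable[OF _ K(1,2)])
    show "locally_integrable N \<Omega> (\<lambda>x. f (v x) * \<phi> x * partial i \<eta> x)"
      by (intro locally_bounded_integrable locally_bounded_mult locally_bounded_compose[OF bd cf]
        locally_bounded_continuous[OF \<Omega> c\<phi>] locally_bounded_continuous[OF \<Omega> cd\<eta>])
    show "f (v x) * \<phi> x * partial i \<eta> x = 0" if "x \<in> \<Omega> - K" for x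
    proof -
      have "partial i \<eta> x = 0" by (rule partial_zero_outside[OF \<Omega> K(1) _ that i]) (rule K(3))
      then show ?thesis by simp
    qed
  qed
  have i2: "set_integrable (leb N) \<Omega> (\<lambda>x. (f' (v x) * \<phi> x * G x i + f (v x) * partial i \<phi> x) * \<eta> x)"
  proof (rule compact_support_integrable[OF _ K(1,2)])
    show "locally_integrable N \<Omega> (\<lambda>x. (f' (v x) * \<phi> x * G x i + f (v x) * partial i \<phi> x) * \<eta> x)"
      using locally_integrable_mult[OF locally_bounded_continuous[OF \<Omega> c\<eta>] loc] by (simp add: mult.commute)
  qed (simp add: K(3))
  have "0 = (LINT x:\<Omega>|leb N. f (v x) * partial i (\<lambda>x. \<eta> x * \<phi> x) x + f' (v x) * (\<eta> x * \<phi> x) * G x i)"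
    by (rule chain_rule_compact[OF \<Omega> i G bd f f' C_k_compact_mult[OF \<Omega> \<eta> \<phi>], symmetric])
  also have "\<dots> = (LINT x:\<Omega>|leb N. f (v x) * \<phi> x * partial i \<eta> x + (f' (v x) * \<phi> x * G x i + f (v x) * partial i \<phi> x) * \<eta> x)"
    by (rule set_lebesgue_integral_cong)
      (auto simp: leb_sets sets_open \<Omega> partial_mult[OF C\<eta> C1 _ i] algebra_simps)
  also have "\<dots> = (LINT x:\<Omega>|leb N. f (v x) * \<phi> x * partial i \<eta> x)
      + (LINT x:\<Omega>|leb N. (f' (v x) * \<phi> x * G x i + f (v x) * partial i \<phi> x) * \<eta> x)"
    by (rule set_integral_add(2)[OF i1 i2])
  finally show "(LINT x:\<Omega>|leb N. f (v x) * \<phi> x * partial i \<eta> x)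
      = - (LINT x:\<Omega>|leb N. (f' (v x) * \<phi> x * G x i + f (v x) * partial i \<phi> x) * \<eta> x)" by linarith
qed

subsection \<open>Elementary inequalities and admissible test functions\<close>

text \<open>\<open>0 powr 0 = 0\<close> in the library, so \<open>\<bar>s\<bar> powr 0\<close> is not continuous at \<open>0\<close>; this variant has \<open>0\<^sup>0 = 1\<close>.\<close>

definition abs_pow :: "real \<Rightarrow> real \<Rightarrow> real" where
  "abs_pow a s = (if a = 0 then 1 else \<bar>s\<bar> powr a)"

lemma abs_pow_nonneg: "abs_pow a s \<ge> 0" by (simp add: abs_pow_def)

lemma abs_pow_times: "abs_pow a s * s = \<bar>s\<bar> powr a * s" by (simp add: abs_pow_def)

lemma abs_pow_mult: "a \<ge> 0 \<Longrightarrow> b \<ge> 0 \<Longrightarrow> abs_pow a s * abs_pow b s = abs_pow (a + b) s"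
  by (auto simp: abs_pow_def powr_add)

lemma abs_pow_square: "a \<ge> 0 \<Longrightarrow> (abs_pow a s)\<^sup>2 = abs_pow (2 * a) s"
  using abs_pow_mult[of a a s] by (simp add: power2_eq_square)

lemma abs_pow_two: "abs_pow 2 s = s\<^sup>2"
  by (cases "s = 0") (auto simp: abs_pow_def)

lemma continuous_abs_pow: "a \<ge> 0 \<Longrightarrow> continuous_on UNIV (abs_pow a)"
proof (cases "a = 0")
  case False
  assume "a \<ge> 0"
  with False have "continuous_on UNIV (\<lambda>s::real. \<bar>s\<bar> powr a)"
    by (intro continuous_on_powr' continuous_intros) auto
  then show ?thesis using False by (simp add: abs_pow_def[abs_def])
qed (simp add: abs_pow_def[abs_def])

text \<open>Away from 0 this is the power rule. At 0 the difference quotient is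
  \<open>abs_pow a\<close> itself, which tends to 0 for a > 0; for a = 0 the function is the
  identity.\<close>

lemma abs_pow_times_DERIV:
  assumes "a \<ge> 0"
  shows "((\<lambda>s. abs_pow a s * s) has_real_derivative (a + 1) * abs_pow a s) (at s)"
proof (cases "a = 0")
  case True
  then show ?thesis by (simp add: abs_pow_def)
next
  case False
  then have a: "a > 0" using assms by simp
  consider "s > 0" | "s < 0" | "s = 0" by linarith
  then show ?thesis
  proof cases
    case 1
    have "((\<lambda>s. s powr (a + 1)) has_real_derivative (a + 1) * s powr a) (at s)"
      using has_real_derivative_powr[OF 1, of "a + 1"] by simp
    then have "((\<lambda>s. abs_pow a s * s) has_real_derivative (a + 1) * s powr a) (at s)"
      by (rule has_field_derivative_transform_within_open[of _ _ _ "{0<..}"])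
        (use 1 a in \<open>auto simp: abs_pow_def powr_add\<close>)
    then show ?thesis using 1 a by (simp add: abs_pow_def)
  next
    case 2
    have "((\<lambda>s. - ((- s) powr (a + 1))) has_real_derivative - ((a + 1) * (- s) powr a * (- 1))) (at s)"
      by (rule derivative_eq_intros DERIV_fun_powr refl | use 2 in simp)+
    then have "((\<lambda>s. abs_pow a s * s) has_real_derivative - ((a + 1) * (- s) powr a * (- 1))) (at s)"
      by (rule has_field_derivative_transform_within_open[of _ _ _ "{..<0}"])
        (use 2 a in \<open>auto simp: abs_pow_def powr_add\<close>)
    then show ?thesis using 2 a by (simp add: abs_pow_def)
  next
    case 3
    have "isCont (abs_pow a) 0"
      using continuous_abs_pow[OF assms] by (simp add: continuous_on_eq_continuous_at)
    then have "(abs_pow a \<longlongrightarrow> 0) (at 0)" using a by (simp add: isCont_def abs_pow_def)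
    then have "((\<lambda>h. (abs_pow a h * h - 0) / (h - 0)) \<longlongrightarrow> 0) (at 0)"
      by (rule Lim_transform_eventually) (auto simp: eventually_at_filter)
    then show ?thesis using 3 a by (simp add: has_field_derivative_iff abs_pow_def)
  qed
qed

text \<open>With \<open>s = (\<gamma> + 1) / 2\<close> the claim reads \<open>(s - p)\<^sup>2 < p (p - 1)\<close>.\<close>

lemma gamma_range:
  fixes p \<gamma> :: real
  assumes "p > 1" "1 \<le> \<gamma>" "\<gamma> < 2 * p + 2 * sqrt (p * (p - 1)) - 1"
  shows "((\<gamma> + 1) / 2)\<^sup>2 < p * \<gamma>"
proof -
  define s where "s = (\<gamma> + 1) / 2"
  have s: "s \<ge> 1" "s - p < sqrt (p * (p - 1))" using assms by (auto simp: s_def field_simps)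
  \<comment> \<open>The lower side of the bound on s - p: since s \<ge> 1, p - s is at most p -
    1.\<close>
  have "p - 1 < sqrt (p * (p - 1))"
    by (rule real_less_rsqrt) (use assms in \<open>simp add: power2_eq_square\<close>)
  with s have "\<bar>s - p\<bar> < sqrt (p * (p - 1))" by (auto simp: abs_if)
  then have "\<bar>s - p\<bar>\<^sup>2 < (sqrt (p * (p - 1)))\<^sup>2" by (intro power_strict_mono) auto
  then have "(s - p)\<^sup>2 < p * (p - 1)" using assms by simp
  moreover have "\<gamma> = 2 * s - 1" unfolding s_def by (simp add: field_simps)
  then have "p * \<gamma> = 2 * (s * p) - p" by (simp only: right_diff_distrib mult_1_right mult.left_commute mult.commute)
  ultimately show ?thesis unfolding s_def[symmetric] by (simp add: power2_eq_square algebra_simps)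
qed

text \<open>Multiplying the lower bound for b by p and comparing with the upper bound for p b
  eliminates b and leaves a multiple of a below a multiple of d. The constants are fixed before a, b
  and d, so they depend on p and \<gamma> alone.\<close>

lemma absorb_constants:
  fixes p \<gamma> :: real
  assumes "p > 1" "1 \<le> \<gamma>" "((\<gamma> + 1) / 2)\<^sup>2 < p * \<gamma>"
  obtains \<epsilon> C1 C2 where "\<epsilon> > 0" "C1 > 0" "C2 > 0"
    "\<And>a b d. 0 \<le> a \<Longrightarrow> 0 \<le> d \<Longrightarrow> b \<le> (\<gamma> + \<epsilon>) * a + d / \<epsilon> \<Longrightarrow> (\<gamma> - \<epsilon>) * a - d / \<epsilon> \<le> b \<Longrightarrow>
      p * b \<le> (((\<gamma> + 1) / 2)\<^sup>2 + (\<gamma> + 1) / 2 * \<epsilon>) * a + (1 + (\<gamma> + 1) / (2 * \<epsilon>)) * d \<Longrightarrow>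
      a \<le> C1 * d \<and> b \<le> C2 * d"
proof -
  define \<kappa> where "\<kappa> = p * \<gamma> - ((\<gamma> + 1) / 2)\<^sup>2"
  \<comment> \<open>The total weight of \<epsilon> in the coefficient of a: p from the equation and
    (\<gamma> + 1) / 2 from stability. With \<epsilon> \<open>L\<close> = \<kappa> / 2 half of the
    gap \<kappa> survives, and \<open>M\<close> collects the coefficients of d.\<close>
  define L where "L = p + (\<gamma> + 1) / 2"
  define \<epsilon> where "\<epsilon> = \<kappa> / (2 * L)"
  define M where "M = 1 + (\<gamma> + 1) / (2 * \<epsilon>) + p / \<epsilon>"
  have pos: "\<kappa> > 0" "L > 0" using assms by (auto simp: \<kappa>_def L_def add_pos_pos)
  then have \<epsilon>: "\<epsilon> > 0" by (simp add: \<epsilon>_def)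
  have M: "M > 0" unfolding M_def using \<epsilon> assms by (intro add_pos_pos) auto
  have \<epsilon>L: "\<epsilon> * L = \<kappa> / 2" using pos by (simp add: \<epsilon>_def)
  show ?thesis
  proof (rule that[of \<epsilon> "2 * M / \<kappa>" "(\<gamma> + \<epsilon>) * (2 * M / \<kappa>) + 1 / \<epsilon>"])
    show "\<epsilon> > 0" "2 * M / \<kappa> > 0" using \<epsilon> M pos by auto
    show "(\<gamma> + \<epsilon>) * (2 * M / \<kappa>) + 1 / \<epsilon> > 0" using \<epsilon> M pos assms by (intro add_pos_pos mult_pos_pos) auto
    fix a b d :: real
    assume h: "0 \<le> a" "0 \<le> d" "b \<le> (\<gamma> + \<epsilon>) * a + d / \<epsilon>" "(\<gamma> - \<epsilon>) * a - d / \<epsilon> \<le> b"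
      "p * b \<le> (((\<gamma> + 1) / 2)\<^sup>2 + (\<gamma> + 1) / 2 * \<epsilon>) * a + (1 + (\<gamma> + 1) / (2 * \<epsilon>)) * d"
    have "p * ((\<gamma> - \<epsilon>) * a - d / \<epsilon>) \<le> p * b" using h(4) assms by (intro mult_left_mono) auto
    with h(5) have "(\<kappa> - \<epsilon> * L) * a \<le> M * d"
      by (simp add: \<kappa>_def L_def M_def algebra_simps)
    then have "\<kappa> / 2 * a \<le> M * d" using \<epsilon>L by simp
    then have a: "a \<le> 2 * M / \<kappa> * d" using pos by (simp add: field_simps)
    have "b \<le> (\<gamma> + \<epsilon>) * (2 * M / \<kappa> * d) + d / \<epsilon>"
      using h(3) mult_left_mono[OF a, of "\<gamma> + \<epsilon>"] \<epsilon> assms by linarith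
    with a show "a \<le> 2 * M / \<kappa> * d \<and> b \<le> ((\<gamma> + \<epsilon>) * (2 * M / \<kappa>) + 1 / \<epsilon>) * d"
      by (simp add: algebra_simps)
  qed
qed

text \<open>Young's inequality with exponents \<open>(\<gamma> + p) / (\<gamma> + 1)\<close> and \<open>(p + \<gamma>) / (p - 1)\<close>. The condition on
  \<open>m\<close> makes the remaining power of \<open>P\<close> nonnegative.\<close>

lemma young_weighted:
  fixes p \<gamma> \<theta> l \<delta> r V P g :: real and m :: nat
  assumes "p > 1" "1 \<le> \<gamma>" and m: "real m \<ge> (p + \<gamma>) / (p - 1)" "m \<ge> 2" and "\<delta> > 0"
    and "r \<ge> 0" "V \<ge> 0" "0 \<le> P" "P \<le> 1" "g \<ge> 0"
  shows "r powr \<theta> * V powr (\<gamma> + 1) * P ^ (2 * m - 2) * g\<^sup>2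
    \<le> \<delta> * (r powr l * V powr (\<gamma> + p) * P ^ (2 * m))
      + \<delta> powr (- ((\<gamma> + 1) / (p - 1))) *
        (r powr ((\<theta> * (\<gamma> + p) - l * (\<gamma> + 1)) / (p - 1)) * (g\<^sup>2) powr ((p + \<gamma>) / (p - 1)))"
    (is "?D \<le> \<delta> * ?X + ?c * ?Y")
proof (cases "r = 0 \<or> V = 0 \<or> P = 0 \<or> g = 0")
  case True
  \<comment> \<open>\<open>0 powr t\<close> is 0 for every t, also for t \<le> 0, and
    \<open>m \<ge> 2\<close> keeps the exponent \<open>2 * m - 2\<close> of P positive.\<close>
  have "?D = 0" using True m(2) by auto
  moreover have "\<delta> * ?X \<ge> 0" "?c * ?Y \<ge> 0" using assms by auto
  ultimately show ?thesis by linarith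
next
  case False
  then have pos: "r > 0" "V > 0" "P > 0" "g > 0" using assms by auto
  \<comment> \<open>The weights are the reciprocals of the two Young exponents, hence \<alpha> +
    \<beta> = 1.\<close>
  define \<alpha> where "\<alpha> = (\<gamma> + 1) / (\<gamma> + p)"
  define \<beta> where "\<beta> = (p - 1) / (\<gamma> + p)"
  have ab: "\<alpha> \<ge> 0" "\<beta> > 0" "\<alpha> + \<beta> = 1" "\<alpha> \<le> 1" "\<beta> \<le> 1"
  proof -
    show "\<alpha> \<ge> 0" "\<beta> > 0" "\<alpha> \<le> 1" "\<beta> \<le> 1" using assms unfolding \<alpha>_def \<beta>_def by auto
    have "\<alpha> + \<beta> = (\<gamma> + p) / (\<gamma> + p)" by (simp add: \<alpha>_def \<beta>_def flip: add_divide_distrib)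
    then show "\<alpha> + \<beta> = 1" using assms by simp
  qed
  have XY: "?X > 0" "?Y > 0" using pos by auto
  have "?D \<le> ?X powr \<alpha> * ?Y powr \<beta>"
  proof -
    have e1: "(\<gamma> + p) * \<alpha> = \<gamma> + 1" using assms by (simp add: \<alpha>_def)
    have e2: "(p + \<gamma>) / (p - 1) * \<beta> = 1" using assms by (simp add: \<beta>_def add.commute)
    have e3: "l * \<alpha> + (\<theta> * (\<gamma> + p) - l * (\<gamma> + 1)) / (p - 1) * \<beta> = \<theta>"
    proof -
      have "(\<theta> * (\<gamma> + p) - l * (\<gamma> + 1)) / (p - 1) * \<beta> = \<theta> - l * \<alpha>"
      proof -
        have *: "x / (p - 1) * \<beta> = x / (\<gamma> + p)" for x using assms by (simp add: \<beta>_def)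
        show ?thesis unfolding * using assms by (simp add: \<alpha>_def diff_divide_distrib)
      qed
      then show ?thesis by simp
    qed
    \<comment> \<open>The condition on m says m \<beta> \<ge> 1, that is, 2 m \<alpha> = 2 m - 2 m
      \<beta> \<le> 2 m - 2. As P \<le> 1, lowering its exponent only enlarges the power.\<close>
    have m1: "real (2 * m) * \<alpha> \<le> real (2 * m - 2)"
    proof -
      have "real m * \<beta> \<ge> 1"
        using mult_right_mono[OF m(1), of \<beta>] ab(2) unfolding e2 by linarith
      moreover have "real m * \<alpha> + real m * \<beta> = real m"
        using ab(3) by (simp flip: distrib_left)
      moreover have "real (2 * m) * \<alpha> = 2 * (real m * \<alpha>)" "real (2 * m - 2) = 2 * real m - 2"
        using m(2) by (simp_all add: of_nat_diff)
      ultimately show ?thesis by linarith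
    qed
    have "?X powr \<alpha> = r powr (l * \<alpha>) * V powr (\<gamma> + 1) * P powr (real (2 * m) * \<alpha>)"
      using pos e1 by (simp add: powr_mult powr_powr flip: powr_realpow)
    moreover have "?Y powr \<beta> = r powr ((\<theta> * (\<gamma> + p) - l * (\<gamma> + 1)) / (p - 1) * \<beta>) * g\<^sup>2"
    proof -
      have "?Y powr \<beta> = r powr ((\<theta> * (\<gamma> + p) - l * (\<gamma> + 1)) / (p - 1) * \<beta>) * (g\<^sup>2) powr ((p + \<gamma>) / (p - 1) * \<beta>)"
        by (simp only: powr_mult powr_powr)
      then show ?thesis unfolding e2 using pos by simp
    qed
    ultimately have eq: "?X powr \<alpha> * ?Y powr \<beta> = r powr \<theta> * V powr (\<gamma> + 1) * P powr (real (2 * m) * \<alpha>) * g\<^sup>2"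
      using e3 by (simp add: mult_ac flip: powr_add)
    have "P ^ (2 * m - 2) = P powr real (2 * m - 2)" using pos by (simp only: powr_realpow)
    also have "\<dots> \<le> P powr (real (2 * m) * \<alpha>)" using m1 pos assms by (intro powr_mono') auto
    finally show ?thesis
      unfolding eq by (intro mult_right_mono mult_left_mono) auto
  qed
  \<comment> \<open>The power of \<delta> in the second constant is the one for which both constants
    cancel in the weighted product, so they can be inserted at no cost.\<close>
  also have "\<dots> = (\<delta> * ?X) powr \<alpha> * (?c * ?Y) powr \<beta>"
  proof -
    have "(\<gamma> + 1) / (p - 1) * \<beta> = \<alpha>" using assms by (simp add: \<alpha>_def \<beta>_def)
    then have "- ((\<gamma> + 1) / (p - 1)) * \<beta> = - \<alpha>" by linarith
    then have one: "\<delta> powr \<alpha> * ?c powr \<beta> = 1" using assms(5) by (simp only: powr_powr) (simp flip: powr_add)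
    have rearrange: "(a * s) * (b * t) = (a * b) * (s * t)" for a b s t :: real by (simp add: mult_ac)
    have "(\<delta> * ?X) powr \<alpha> * (?c * ?Y) powr \<beta> = (\<delta> powr \<alpha> * ?X powr \<alpha>) * (?c powr \<beta> * ?Y powr \<beta>)"
      by (simp only: powr_mult)
    also have "\<dots> = (\<delta> powr \<alpha> * ?c powr \<beta>) * (?X powr \<alpha> * ?Y powr \<beta>)"
      by (rule rearrange)
    finally have "(\<delta> * ?X) powr \<alpha> * (?c * ?Y) powr \<beta> = (\<delta> powr \<alpha> * ?c powr \<beta>) * (?X powr \<alpha> * ?Y powr \<beta>)" .
    then show ?thesis unfolding one by linarith
  qed
  also have "\<dots> \<le> \<alpha> * (\<delta> * ?X) + \<beta> * (?c * ?Y)"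
    using ab XY assms(5) by (intro Youngs_inequality_0) auto
  also have "\<dots> \<le> \<delta> * ?X + ?c * ?Y"
  proof -
    have "\<delta> * ?X \<ge> 0" "?c * ?Y \<ge> 0" using XY assms(5) by auto
    then show ?thesis using ab by (intro add_mono mult_left_le_one_le) auto
  qed
  finally show ?thesis .
qed

section \<open>Norms, local measurability and the weighted spaces\<close>

lemma enorm_square: "(enorm N x)\<^sup>2 = (\<Sum>i<N. (x i)\<^sup>2)"
  unfolding enorm_def L2_set_def by (simp add: sum_nonneg)

lemma enorm_nonneg: "enorm N x \<ge> 0" by (simp add: enorm_def)

lemma dotp_cong: "(\<And>i. i < N \<Longrightarrow> x i = y i) \<Longrightarrow> dotp N z x = dotp N z y"
  unfolding dotp_def by (rule sum.cong) auto

lemma enorm_powr_measurable: "(\<lambda>x. enorm N x powr s) \<in> borel_measurable (PN N)"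
proof -
  have "(\<lambda>x. enorm N x) \<in> borel_measurable (PN N)"
    unfolding enorm_def L2_set_def by measurable
  then show ?thesis by measurable
qed

text \<open>Countably many closed boxes inside \<open>\<Omega>\<close>, together with the complement
  of \<open>\<Omega>\<close>, cover the space, and measurability may be checked on each
  piece.\<close>

lemma locally_measurable:
  assumes \<Omega>: "openin (Rn N) \<Omega>"
    and g: "\<And>a b. box_closed N a b \<subseteq> \<Omega> \<Longrightarrow> (\<lambda>x. indicator (box_closed N a b) x * g x) \<in> borel_measurable (leb N)"
  shows "(\<lambda>x. indicator \<Omega> x * (g x :: real)) \<in> borel_measurable (leb N)"
proof -
  let ?B = "(\<lambda>(a, b). box_closed N a b) ` {(a, b). (a, b) \<in> rats N \<times> rats N \<and> box_closed N a b \<subseteq> \<Omega>}"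
  let ?C = "insert (space (leb N) - \<Omega>) ?B"
  have \<Omega>s: "\<Omega> \<in> sets (leb N)" by (intro leb_sets sets_open \<Omega>)
  show ?thesis
  proof (rule measurable_piecewise_restrict[where C = ?C])
    show "countable ?C" by (intro countable_insert countable_image countable_boxes)
    have bs: "box_closed N a b \<in> sets (leb N)" for a b by (intro leb_sets sets_box_closed)
    show CS: "S \<inter> space (leb N) \<in> sets (leb N)" if "S \<in> ?C" for S
    proof -
      from that have "S \<in> sets (leb N)"
      proof (rule insertE)
        assume "S \<in> ?B"
        then show ?thesis by (rule imageE) (auto simp only: bs split_beta)
      qed (simp only: sets.compl_sets[OF \<Omega>s])
      then show ?thesis by auto
    qed
    show "space (leb N) \<subseteq> \<Union>?C"
    proof
      fix x assume x: "x \<in> space (leb N)"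
      show "x \<in> \<Union>?C"
      proof (cases "x \<in> \<Omega>")
        case True
        from box_nbhd[OF \<Omega> this] obtain a b where "a \<in> rats N" "b \<in> rats N" "x \<in> obox N a b" "box_closed N a b \<subseteq> \<Omega>"
          by metis
        then have "box_closed N a b \<in> ?B" by (intro image_eqI[of _ _ "(a, b)"]) simp_all
        moreover have "x \<in> box_closed N a b" using obox_subset \<open>x \<in> obox N a b\<close> by (rule subsetD)
        ultimately show ?thesis by (intro UnionI[of "box_closed N a b"] insertI2)
      qed (use x in blast)
    qed
    fix S assume S: "S \<in> ?C"
    have Ss: "S \<inter> space (leb N) \<in> sets (leb N)" by (rule CS[OF S])
    show "(\<lambda>x. indicator \<Omega> x * g x) \<in> borel_measurable (restrict_space (leb N) S)"
      unfolding borel_measurable_restrict_space_iff[OF Ss]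
      using S
    proof (rule insertE)
      assume "S = space (leb N) - \<Omega>"
      then have "indicator S x *\<^sub>R (indicator \<Omega> x * g x) = 0" for x by (auto simp: indicator_def)
      then show "(\<lambda>x. indicator S x *\<^sub>R (indicator \<Omega> x * g x)) \<in> borel_measurable (leb N)"
        by (simp only: borel_measurable_const)
    next
      assume "S \<in> ?B"
      then obtain ab where ab: "S = box_closed N (fst ab) (snd ab)" "box_closed N (fst ab) (snd ab) \<subseteq> \<Omega>"
        by (rule imageE) (auto simp only: split_beta mem_Collect_eq)
      then have "indicator S x *\<^sub>R (indicator \<Omega> x * g x) = indicator (box_closed N (fst ab) (snd ab)) x * g x" for x
        by (auto simp: indicator_def)
      then show "(\<lambda>x. indicator S x *\<^sub>R (indicator \<Omega> x * g x)) \<in> borel_measurable (leb N)"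
        using g[OF ab(2)] by (simp only:)
    qed
  qed
qed

lemma locally_integrable_measurable:
  assumes "openin (Rn N) \<Omega>" "locally_integrable N \<Omega> g"
  shows "(\<lambda>x. indicator \<Omega> x * g x) \<in> borel_measurable (leb N)"
proof (rule locally_measurable[OF assms(1)])
  fix a b assume "box_closed N a b \<subseteq> \<Omega>"
  then have "set_integrable (leb N) (box_closed N a b) g"
    using assms(2) compactin_box unfolding locally_integrable_def by blast
  then show "(\<lambda>x. indicator (box_closed N a b) x * g x) \<in> borel_measurable (leb N)"
    unfolding set_integrable_def by (auto dest: borel_measurable_integrable)
qed

lemma locally_bounded_grad_square:
  assumes \<Omega>: "openin (Rn N) \<Omega>" and "C_k 1 N \<Omega> \<phi>"
  shows "locally_bounded N \<Omega> (\<lambda>x. (enorm N (grad \<phi> x))\<^sup>2)"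
proof -
  have C1: "C_k (Suc 0) N \<Omega> \<phi>" using assms by simp
  show ?thesis
    unfolding enorm_square grad_def
    using C_k_partial[OF C1]
    by (intro locally_bounded_continuous[OF \<Omega>] continuous_map_sum continuous_map_real_pow) auto
qed

lemma L2I:
  assumes "(\<lambda>x. indicator \<Omega> x * q x) \<in> borel_measurable (leb N)"
    and "AE x in leb N. x \<in> \<Omega> \<longrightarrow> (q x)\<^sup>2 \<le> S x" and S: "set_integrable (leb N) \<Omega> S"
  shows "q \<in> L2 N \<Omega>"
proof -
  have "integrable (leb N) (\<lambda>x. indicator \<Omega> x *\<^sub>R (q x)\<^sup>2)"
  proof (rule Bochner_Integration.integrable_bound[OF S[unfolded set_integrable_def]])
    have "(\<lambda>x. (indicator \<Omega> x * q x)\<^sup>2) \<in> borel_measurable (leb N)" using assms(1) by measurable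
    moreover have "(indicator \<Omega> x * q x)\<^sup>2 = indicator \<Omega> x *\<^sub>R (q x)\<^sup>2" for x by (simp add: indicator_def)
    ultimately show "(\<lambda>x. indicator \<Omega> x *\<^sub>R (q x)\<^sup>2) \<in> borel_measurable (leb N)" by simp
    show "AE x in leb N. norm (indicator \<Omega> x *\<^sub>R (q x)\<^sup>2) \<le> norm (indicator \<Omega> x *\<^sub>R S x)"
      using assms(2) by eventually_elim (auto simp: indicator_def)
  qed
  then show ?thesis using assms(1) by (simp add: L2_def set_borel_measurable_def set_integrable_def)
qed

lemma H1_loc_integrable:
  assumes "v \<in> H1_loc N \<theta> \<Omega>"
  shows "locally_integrable N \<Omega> (\<lambda>x. enorm N x powr \<theta> * (v x)\<^sup>2)"
    and "locally_integrable N \<Omega> (\<lambda>x. enorm N x powr \<theta> * (enorm N (weak_grad N \<Omega> v x))\<^sup>2)"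
proof -
  have sq: "(enorm N x powr (\<theta>/2) * w)\<^sup>2 = enorm N x powr \<theta> * w\<^sup>2" for x w
    by (simp add: power_mult_distrib power2_eq_square flip: powr_add)
  show "locally_integrable N \<Omega> (\<lambda>x. enorm N x powr \<theta> * (v x)\<^sup>2)"
    "locally_integrable N \<Omega> (\<lambda>x. enorm N x powr \<theta> * (enorm N (weak_grad N \<Omega> v x))\<^sup>2)"
    using assms unfolding H1_loc_def locally_integrable_def L2_def by (auto simp: sq)
qed

lemma weak_grad_is: "weakly_differentiable N \<Omega> u \<Longrightarrow> is_weak_grad N \<Omega> u (weak_grad N \<Omega> u)"
  unfolding weakly_differentiable_def weak_grad_def by (erule exE) (rule someI[of "is_weak_grad N \<Omega> u"])

lemma weak_grad_measurable:
  assumes \<Omega>: "openin (Rn N) \<Omega>" and "weakly_differentiable N \<Omega> u"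
  shows "(\<lambda>x. indicator \<Omega> x * enorm N (weak_grad N \<Omega> u x)) \<in> borel_measurable (leb N)"
proof -
  have *: "(\<lambda>x. indicator \<Omega> x * weak_grad N \<Omega> u x i) \<in> borel_measurable (leb N)" if "i < N" for i
    using weak_grad_is[OF assms(2)] that
    by (intro locally_integrable_measurable[OF \<Omega>]) (auto simp: is_weak_grad_def)
  have "(\<lambda>x. sqrt (\<Sum>i<N. (indicator \<Omega> x * weak_grad N \<Omega> u x i)\<^sup>2)) \<in> borel_measurable (leb N)"
  proof -
    have "(\<lambda>x. \<Sum>i<N. (indicator \<Omega> x * weak_grad N \<Omega> u x i)\<^sup>2) \<in> borel_measurable (leb N)"
      using * by (intro borel_measurable_sum borel_measurable_power) auto
    then show ?thesis by measurable
  qed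
  moreover have "sqrt (\<Sum>i<N. (indicator \<Omega> x * weak_grad N \<Omega> u x i)\<^sup>2) = indicator \<Omega> x * enorm N (weak_grad N \<Omega> u x)" for x
    by (simp add: indicator_def enorm_def L2_set_def)
  ultimately show ?thesis by simp
qed

section \<open>Powers of v times a cutoff as test functions\<close>

lemma square_sum_le: "(a + b)\<^sup>2 \<le> 2 * a\<^sup>2 + 2 * (b\<^sup>2 :: real)"
  using sum_squares_bound[of a b] by (simp add: power2_sum)

text \<open>The chain rule for \<open>abs_pow a s * s\<close>, which is continuously differentiable
  for a \<ge> 0. In the function the factor v hides the difference between \<open>powr\<close> and
  \<open>abs_pow\<close>; in the gradient it does not, so \<open>abs_pow\<close> stays
  there.\<close>

lemma power_product_weak_grad:
  assumes \<Omega>: "openin (Rn N) \<Omega>" and v: "weakly_differentiable N \<Omega> v" "v \<in> Linf_loc N \<Omega>"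
    and \<phi>: "C_k 1 N \<Omega> \<phi>" and a: "a \<ge> 0"
  shows "weakly_differentiable N \<Omega> (\<lambda>x. \<bar>v x\<bar> powr a * v x * \<phi> x)"
    and "AE x in leb N. x \<in> \<Omega> \<longrightarrow> (\<forall>i<N. weak_grad N \<Omega> (\<lambda>x. \<bar>v x\<bar> powr a * v x * \<phi> x) x i
      = (a + 1) * abs_pow a (v x) * \<phi> x * weak_grad N \<Omega> v x i + abs_pow a (v x) * v x * partial i \<phi> x)"
proof -
  have "is_weak_grad N \<Omega> (\<lambda>x. abs_pow a (v x) * v x * \<phi> x) (\<lambda>x i. (a + 1) * abs_pow a (v x) * \<phi> x * weak_grad N \<Omega> v x i
      + abs_pow a (v x) * v x * partial i \<phi> x)"
    by (rule weak_grad_chain_product[OF \<Omega> weak_grad_is[OF v(1)] Linf_loc_bounded[OF \<Omega> v(2)], where f = "\<lambda>s. abs_pow a s * s"])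
      (auto intro!: abs_pow_times_DERIV continuous_intros continuous_abs_pow a \<phi> simp del: C_k.simps One_nat_def)
  then have W: "is_weak_grad N \<Omega> (\<lambda>x. \<bar>v x\<bar> powr a * v x * \<phi> x) (\<lambda>x i. (a + 1) * abs_pow a (v x) * \<phi> x * weak_grad N \<Omega> v x i
      + abs_pow a (v x) * v x * partial i \<phi> x)"
    by (simp only: abs_pow_times)
  then show "weakly_differentiable N \<Omega> (\<lambda>x. \<bar>v x\<bar> powr a * v x * \<phi> x)"
    unfolding weakly_differentiable_def by blast
  show "AE x in leb N. x \<in> \<Omega> \<longrightarrow> (\<forall>i<N. weak_grad N \<Omega> (\<lambda>x. \<bar>v x\<bar> powr a * v x * \<phi> x) x i
      = (a + 1) * abs_pow a (v x) * \<phi> x * weak_grad N \<Omega> v x i + abs_pow a (v x) * v x * partial i \<phi> x)"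
    by (rule weak_grad_unique[OF \<Omega> W])
qed

text \<open>Every weighted square is dominated by a compactly supported bounded multiplier times
  |x|^\<theta> v^2 or |x|^\<theta> |\<nabla>v|^2, both locally integrable by assumption. The weight
  is never separated from v or its gradient, so its behaviour at the origin does no harm.\<close>

lemma power_product_admissible:
  assumes \<Omega>: "openin (Rn N) \<Omega>" and v: "v \<in> H1_loc N \<theta> \<Omega>" "v \<in> Linf_loc N \<Omega>"
    and \<phi>: "\<phi> \<in> C_k_compact 1 N \<Omega>" and a: "a \<ge> 0"
  shows "(\<lambda>x. \<bar>v x\<bar> powr a * v x * \<phi> x) \<in> H1_c N \<theta> \<Omega> \<inter> Linf_loc N \<Omega>"
proof -
  let ?u = "\<lambda>x. \<bar>v x\<bar> powr a * v x * \<phi> x"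
  obtain K where C1: "C_k 1 N \<Omega> \<phi>" and K: "compactin (Rn N) K" "K \<subseteq> \<Omega>" "\<And>x. x \<in> \<Omega> - K \<Longrightarrow> \<phi> x = 0"
    by (rule C_k_compactE[OF \<phi>]) blast
  have C1': "C_k (Suc 0) N \<Omega> \<phi>" using C1 by simp
  have wd: "weakly_differentiable N \<Omega> v" using v(1) by (simp add: H1_loc_def)
  note wg = power_product_weak_grad[OF \<Omega> wd v(2) C1 a]
  have bv: "locally_bounded N \<Omega> v" by (rule Linf_loc_bounded[OF \<Omega> v(2)])
  have bp: "locally_bounded N \<Omega> (\<lambda>x. abs_pow a (v x))"
    by (rule locally_bounded_compose[OF bv continuous_abs_pow[OF a]])
  have b\<phi>: "locally_bounded N \<Omega> \<phi>"
    by (rule locally_bounded_continuous[OF \<Omega> C_k_imp_continuous[OF C1]])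
  have bu: "locally_bounded N \<Omega> ?u"
    unfolding abs_pow_times[symmetric] by (intro locally_bounded_mult bp bv b\<phi>)
  have um: "(\<lambda>x. indicator \<Omega> x * ?u x) \<in> borel_measurable (leb N)"
    by (rule locally_integrable_measurable[OF \<Omega> locally_bounded_integrable[OF bu]])
  have em: "(\<lambda>x. enorm N x powr s) \<in> borel_measurable (leb N)" for s
    by (intro leb_measurable enorm_powr_measurable)
  have sq: "(enorm N x powr (\<theta>/2) * w)\<^sup>2 = enorm N x powr \<theta> * w\<^sup>2" for x w
    by (simp add: power_mult_distrib power2_eq_square flip: powr_add)
  have L1: "(\<lambda>x. enorm N x powr (\<theta>/2) * ?u x) \<in> L2 N \<Omega>"
  proof (rule L2I)
    have "(\<lambda>x. enorm N x powr (\<theta>/2) * (indicator \<Omega> x * ?u x)) \<in> borel_measurable (leb N)"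
      by (intro borel_measurable_times um em)
    then show "(\<lambda>x. indicator \<Omega> x * (enorm N x powr (\<theta>/2) * ?u x)) \<in> borel_measurable (leb N)"
      by (simp add: mult.left_commute)
    show "AE x in leb N. x \<in> \<Omega> \<longrightarrow> (enorm N x powr (\<theta>/2) * ?u x)\<^sup>2
      \<le> (abs_pow a (v x) * abs_pow a (v x) * \<phi> x * \<phi> x) * (enorm N x powr \<theta> * (v x)\<^sup>2)"
      unfolding sq abs_pow_times[symmetric] by (simp add: power_mult_distrib power2_eq_square mult_ac)
    show "set_integrable (leb N) \<Omega> (\<lambda>x. (abs_pow a (v x) * abs_pow a (v x) * \<phi> x * \<phi> x) * (enorm N x powr \<theta> * (v x)\<^sup>2))"
    proof (rule compact_support_integrable[OF _ K(1,2)])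
      show "locally_integrable N \<Omega> (\<lambda>x. (abs_pow a (v x) * abs_pow a (v x) * \<phi> x * \<phi> x) * (enorm N x powr \<theta> * (v x)\<^sup>2))"
        by (rule locally_integrable_mult[OF _ H1_loc_integrable(1)[OF v(1)]]) (intro locally_bounded_mult bp b\<phi>)
    qed (simp add: K(3))
  qed
  have L2: "(\<lambda>x. enorm N x powr (\<theta>/2) * enorm N (weak_grad N \<Omega> ?u x)) \<in> L2 N \<Omega>"
  proof (rule L2I)
    have "(\<lambda>x. enorm N x powr (\<theta>/2) * (indicator \<Omega> x * enorm N (weak_grad N \<Omega> ?u x))) \<in> borel_measurable (leb N)"
      by (intro borel_measurable_times em weak_grad_measurable[OF \<Omega> wg(1)])
    then show "(\<lambda>x. indicator \<Omega> x * (enorm N x powr (\<theta>/2) * enorm N (weak_grad N \<Omega> ?u x))) \<in> borel_measurable (leb N)"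
      by (simp add: mult.left_commute)
    \<comment> \<open>The majorant from (a + b)^2 \<le> 2 a^2 + 2 b^2, applied to the two terms of
      the product rule in each coordinate.\<close>
    let ?S = "\<lambda>x. (2 * (a + 1)\<^sup>2 * (abs_pow a (v x) * abs_pow a (v x) * \<phi> x * \<phi> x)) * (enorm N x powr \<theta> * (enorm N (weak_grad N \<Omega> v x))\<^sup>2)
       + (2 * (abs_pow a (v x) * abs_pow a (v x) * (enorm N (grad \<phi> x))\<^sup>2)) * (enorm N x powr \<theta> * (v x)\<^sup>2)"
    show "AE x in leb N. x \<in> \<Omega> \<longrightarrow> (enorm N x powr (\<theta>/2) * enorm N (weak_grad N \<Omega> ?u x))\<^sup>2 \<le> ?S x"
      using wg(2)
    proof eventually_elim
      case (elim x)
      show ?case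
      proof
        assume x: "x \<in> \<Omega>"
        let ?A = "(a + 1) * abs_pow a (v x) * \<phi> x" and ?B = "abs_pow a (v x) * v x"
        have "(enorm N (weak_grad N \<Omega> ?u x))\<^sup>2 = (\<Sum>i<N. (?A * weak_grad N \<Omega> v x i + ?B * partial i \<phi> x)\<^sup>2)"
          unfolding enorm_square using elim x by (intro sum.cong) auto
        also have "\<dots> \<le> (\<Sum>i<N. 2 * (?A * weak_grad N \<Omega> v x i)\<^sup>2 + 2 * (?B * partial i \<phi> x)\<^sup>2)"
          by (intro sum_mono square_sum_le)
        also have "\<dots> = 2 * ?A\<^sup>2 * (enorm N (weak_grad N \<Omega> v x))\<^sup>2 + 2 * ?B\<^sup>2 * (enorm N (grad \<phi> x))\<^sup>2"
          unfolding enorm_square grad_def by (simp add: sum.distrib sum_distrib_left power_mult_distrib mult.assoc)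
        finally have "(enorm N x powr (\<theta>/2) * enorm N (weak_grad N \<Omega> ?u x))\<^sup>2
          \<le> enorm N x powr \<theta> * (2 * ?A\<^sup>2 * (enorm N (weak_grad N \<Omega> v x))\<^sup>2 + 2 * ?B\<^sup>2 * (enorm N (grad \<phi> x))\<^sup>2)"
          unfolding sq by (intro mult_left_mono) auto
        also have "\<dots> = ?S x" by (simp add: power2_eq_square algebra_simps)
        finally show "(enorm N x powr (\<theta>/2) * enorm N (weak_grad N \<Omega> ?u x))\<^sup>2 \<le> ?S x" .
      qed
    qed
    have bc: "locally_bounded N \<Omega> (\<lambda>x. c)" for c
      by (rule locally_bounded_continuous[OF \<Omega>]) simp
    have "locally_integrable N \<Omega> ?S"
    proof (rule locally_integrable_add[OF locally_integrable_mult[OF _ H1_loc_integrable(2)[OF v(1)]]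
          locally_integrable_mult[OF _ H1_loc_integrable(1)[OF v(1)]]])
      show "locally_bounded N \<Omega> (\<lambda>x. 2 * (a + 1)\<^sup>2 * (abs_pow a (v x) * abs_pow a (v x) * \<phi> x * \<phi> x))"
        by (intro locally_bounded_mult bp b\<phi> bc)
      show "locally_bounded N \<Omega> (\<lambda>x. 2 * (abs_pow a (v x) * abs_pow a (v x) * (enorm N (grad \<phi> x))\<^sup>2))"
        by (intro locally_bounded_mult bp bc locally_bounded_grad_square[OF \<Omega> C1])
    qed
    then show "set_integrable (leb N) \<Omega> ?S"
    proof (rule compact_support_integrable[OF _ K(1,2)])
      fix x assume x: "x \<in> \<Omega> - K"
      have "partial i \<phi> x = 0" if "i < N" for i by (rule partial_zero_outside[OF \<Omega> K(1) _ x that]) (rule K(3))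
      then have "(enorm N (grad \<phi> x))\<^sup>2 = 0" unfolding enorm_square grad_def by simp
      then show "?S x = 0" by (simp add: K(3)[OF x])
    qed
  qed
  have "?u \<in> H1_c N \<theta> \<Omega>"
    unfolding H1_c_def H1_def using wg(1) L1 L2 K by auto
  moreover have "?u \<in> Linf_loc N \<Omega>"
    using um bu unfolding Linf_loc_def locally_bounded_def by (auto simp: set_borel_measurable_def)
  ultimately show ?thesis by blast
qed

subsection \<open>Energy estimates\<close>

lemma set_integral_mono_combination:
  fixes A D F B :: "point \<Rightarrow> real"
  assumes "set_integrable M \<Omega> A" "set_integrable M \<Omega> D" "set_integrable M \<Omega> F" "set_integrable M \<Omega> B"
    and "AE x in M. x \<in> \<Omega> \<longrightarrow> k * B x \<le> a * A x + d * D x + c * F x"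
  shows "k * (LINT x:\<Omega>|M. B x) \<le> a * (LINT x:\<Omega>|M. A x) + d * (LINT x:\<Omega>|M. D x) + c * (LINT x:\<Omega>|M. F x)"
proof -
  have "(LINT x:\<Omega>|M. k * B x) \<le> (LINT x:\<Omega>|M. a * A x + d * D x + c * F x)"
    using assms by (intro set_integral_mono_AE set_integral_add set_integrable_mult_right) auto
  also have "\<dots> = a * (LINT x:\<Omega>|M. A x) + d * (LINT x:\<Omega>|M. D x) + c * (LINT x:\<Omega>|M. F x)"
    using assms by (simp add: set_integral_add set_integrable_mult_right)
  finally show ?thesis by simp
qed

text \<open>The weighted inequality 2 X Y \<le> X^2 + Y^2 is used in each coordinate and summed. No
  factor N arises, in keeping with a constant that is independent of the dimension.\<close>

lemma cross_term_bound:
  fixes \<epsilon> s w :: real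
  assumes "\<epsilon> > 0"
  shows "\<bar>2 * (s * w) * dotp N x y\<bar> \<le> \<epsilon> * (s\<^sup>2 * (enorm N x)\<^sup>2) + 1 / \<epsilon> * (w\<^sup>2 * (enorm N y)\<^sup>2)"
proof -
  have "\<bar>2 * (s * w) * dotp N x y\<bar> \<le> (\<Sum>i<N. \<bar>2 * (s * w) * (x i * y i)\<bar>)"
    unfolding dotp_def sum_distrib_left by (rule sum_abs)
  also have "\<dots> \<le> (\<Sum>i<N. \<epsilon> * (s * x i)\<^sup>2 + 1 / \<epsilon> * (w * y i)\<^sup>2)"
  proof (rule sum_mono)
    fix i
    define X Y where "X = sqrt \<epsilon> * \<bar>s * x i\<bar>" and "Y = \<bar>w * y i\<bar> / sqrt \<epsilon>"
    have "2 * X * Y \<le> X\<^sup>2 + Y\<^sup>2" by (rule sum_squares_bound)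
    moreover have "2 * X * Y = \<bar>2 * (s * w) * (x i * y i)\<bar>"
      using assms by (simp add: X_def Y_def abs_mult)
    moreover have "X\<^sup>2 = \<epsilon> * (s * x i)\<^sup>2" "Y\<^sup>2 = 1 / \<epsilon> * (w * y i)\<^sup>2"
      using assms by (simp_all add: X_def Y_def power_mult_distrib power_divide)
    ultimately show "\<bar>2 * (s * w) * (x i * y i)\<bar> \<le> \<epsilon> * (s * x i)\<^sup>2 + 1 / \<epsilon> * (w * y i)\<^sup>2" by simp
  qed
  also have "\<dots> = \<epsilon> * (s\<^sup>2 * (enorm N x)\<^sup>2) + 1 / \<epsilon> * (w\<^sup>2 * (enorm N y)\<^sup>2)"
    unfolding enorm_square by (simp add: sum.distrib sum_distrib_left power_mult_distrib)
  finally show ?thesis .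
qed

lemma abs_pow_powr_eqs:
  fixes p \<gamma> s :: real
  assumes "p > 1" "\<gamma> \<ge> 1"
  shows "abs_pow (\<gamma> - 1) s * s\<^sup>2 = \<bar>s\<bar> powr (\<gamma> + 1)"
    and "\<bar>s\<bar> powr (p - 1) * (abs_pow (\<gamma> - 1) s * s\<^sup>2) = \<bar>s\<bar> powr (\<gamma> + p)"
proof -
  show 1: "abs_pow (\<gamma> - 1) s * s\<^sup>2 = \<bar>s\<bar> powr (\<gamma> + 1)"
    using abs_pow_mult[of "\<gamma> - 1" 2 s] assms by (simp add: abs_pow_two) (simp add: abs_pow_def add.commute)
  show "\<bar>s\<bar> powr (p - 1) * (abs_pow (\<gamma> - 1) s * s\<^sup>2) = \<bar>s\<bar> powr (\<gamma> + p)"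
    unfolding 1 by (simp flip: powr_add add: add.commute)
qed

text \<open>With \<open>E\<close> the cross term, the equation says that \<gamma> \<open>A\<close> +
  \<open>E\<close> - \<open>B\<close> has integral 0, and stability that ((\<gamma> + 1) / 2)^2
  \<open>A\<close> + (\<gamma> + 1) / 2 \<open>E\<close> + \<open>D\<close> - p \<open>B\<close> has
  nonnegative integral. The three inequalities follow from |\<open>E\<close>| \<le> \<epsilon>
  \<open>A\<close> + \<open>D\<close> / \<epsilon>.\<close>

lemma energy_estimates:
  fixes p \<theta> l \<gamma> \<epsilon> :: real
  assumes p: "p > 1" and \<gamma>: "\<gamma> \<ge> 1" and \<epsilon>: "\<epsilon> > 0" and \<Omega>: "openin (Rn N) \<Omega>"
    and sol: "is_solution N p \<theta> l \<Omega> v" and stab: "is_stable N p \<theta> l \<Omega> v"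
    and \<phi>: "\<phi> \<in> C_k_compact 1 N \<Omega>"
  defines "A \<equiv> \<lambda>x. enorm N x powr \<theta> * (abs_pow (\<gamma> - 1) (v x) * (\<phi> x)\<^sup>2 * (enorm N (weak_grad N \<Omega> v x))\<^sup>2)"
    and "B \<equiv> \<lambda>x. enorm N x powr l * (\<bar>v x\<bar> powr (\<gamma> + p) * (\<phi> x)\<^sup>2)"
    and "D \<equiv> \<lambda>x. enorm N x powr \<theta> * (\<bar>v x\<bar> powr (\<gamma> + 1) * (enorm N (grad \<phi> x))\<^sup>2)"
  shows "set_integrable (leb N) \<Omega> A" "set_integrable (leb N) \<Omega> B" "set_integrable (leb N) \<Omega> D"
    and "(LINT x:\<Omega>|leb N. B x) \<le> (\<gamma> + \<epsilon>) * (LINT x:\<Omega>|leb N. A x) + (LINT x:\<Omega>|leb N. D x) / \<epsilon>"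
    and "(\<gamma> - \<epsilon>) * (LINT x:\<Omega>|leb N. A x) - (LINT x:\<Omega>|leb N. D x) / \<epsilon> \<le> (LINT x:\<Omega>|leb N. B x)"
    and "p * (LINT x:\<Omega>|leb N. B x) \<le> (((\<gamma> + 1) / 2)\<^sup>2 + (\<gamma> + 1) / 2 * \<epsilon>) * (LINT x:\<Omega>|leb N. A x)
      + (1 + (\<gamma> + 1) / (2 * \<epsilon>)) * (LINT x:\<Omega>|leb N. D x)"
proof -
  let ?G = "weak_grad N \<Omega> v"
  have v: "v \<in> H1_loc N \<theta> \<Omega>" "v \<in> Linf_loc N \<Omega>" using sol by (auto simp: is_solution_def)
  have wd: "weakly_differentiable N \<Omega> v" using v(1) by (simp add: H1_loc_def)
  obtain K where C1: "C_k 1 N \<Omega> \<phi>" and K: "compactin (Rn N) K" "K \<subseteq> \<Omega>" "\<And>x. x \<in> \<Omega> - K \<Longrightarrow> \<phi> x = 0"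
    by (rule C_k_compactE[OF \<phi>]) blast
  have C1': "C_k (Suc 0) N \<Omega> \<phi>" using C1 by simp
  have \<phi>2: "(\<lambda>x. \<phi> x * \<phi> x) \<in> C_k_compact 1 N \<Omega>" by (rule C_k_compact_mult[OF \<Omega> \<phi> C1])
  have bv: "locally_bounded N \<Omega> v" by (rule Linf_loc_bounded[OF \<Omega> v(2)])
  have bp: "locally_bounded N \<Omega> (\<lambda>x. abs_pow a (v x))" if "a \<ge> 0" for a
    by (rule locally_bounded_compose[OF bv continuous_abs_pow[OF that]])
  have b\<phi>: "locally_bounded N \<Omega> \<phi>"
    by (rule locally_bounded_continuous[OF \<Omega> C_k_imp_continuous[OF C1]])
  have grad0: "(enorm N (grad \<phi> x))\<^sup>2 = 0" if x: "x \<in> \<Omega> - K" for x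
  proof -
    have "partial i \<phi> x = 0" if "i < N" for i by (rule partial_zero_outside[OF \<Omega> K(1) _ x that]) (rule K(3))
    then show ?thesis unfolding enorm_square grad_def by simp
  qed
  note eqs = abs_pow_powr_eqs[OF p \<gamma>]
  show iA: "set_integrable (leb N) \<Omega> A"
  proof (rule compact_support_integrable[OF _ K(1,2)])
    have "locally_integrable N \<Omega> (\<lambda>x. abs_pow (\<gamma> - 1) (v x) * (\<phi> x * \<phi> x) * (enorm N x powr \<theta> * (enorm N (?G x))\<^sup>2))"
      using \<gamma> by (intro locally_integrable_mult H1_loc_integrable(2)[OF v(1)] locally_bounded_mult bp b\<phi>) simp
    then show "locally_integrable N \<Omega> A" unfolding A_def by (simp add: power2_eq_square mult_ac)
  qed (simp add: A_def K(3))
  show iD: "set_integrable (leb N) \<Omega> D"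
  proof (rule compact_support_integrable[OF _ K(1,2)])
    have "locally_integrable N \<Omega> (\<lambda>x. abs_pow (\<gamma> - 1) (v x) * (enorm N (grad \<phi> x))\<^sup>2 * (enorm N x powr \<theta> * (v x)\<^sup>2))"
      using \<gamma> by (intro locally_integrable_mult H1_loc_integrable(1)[OF v(1)] locally_bounded_mult bp
          locally_bounded_grad_square[OF \<Omega> C1]) simp
    then show "locally_integrable N \<Omega> D" unfolding D_def eqs(1)[symmetric] by (simp add: mult_ac)
  qed (simp add: D_def grad0)
  \<comment> \<open>Both tests produce this same term: from the derivative of \<phi>^2 in the
    equation, and from the mixed term of the square in the stability form.\<close>
  define E where "E x = enorm N x powr \<theta> * (abs_pow (\<gamma> - 1) (v x) * (2 * (\<phi> x * v x) * dotp N (?G x) (grad \<phi> x)))" for x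
  have E: "\<bar>E x\<bar> \<le> \<epsilon> * A x + 1 / \<epsilon> * D x" for x
  proof -
    have "\<bar>E x\<bar> = enorm N x powr \<theta> * (abs_pow (\<gamma> - 1) (v x) * \<bar>2 * (\<phi> x * v x) * dotp N (?G x) (grad \<phi> x)\<bar>)"
      unfolding E_def by (simp add: abs_mult abs_pow_nonneg)
    also have "\<dots> \<le> enorm N x powr \<theta> * (abs_pow (\<gamma> - 1) (v x) *
        (\<epsilon> * ((\<phi> x)\<^sup>2 * (enorm N (?G x))\<^sup>2) + 1 / \<epsilon> * ((v x)\<^sup>2 * (enorm N (grad \<phi> x))\<^sup>2)))"
      by (intro mult_left_mono cross_term_bound \<epsilon>) (auto simp: abs_pow_nonneg)
    also have "\<dots> = \<epsilon> * A x + 1 / \<epsilon> * D x"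
      unfolding A_def D_def eqs(1)[symmetric] by (simp add: algebra_simps)
    finally show ?thesis .
  qed
  let ?u = "\<lambda>x. \<bar>v x\<bar> powr (\<gamma> - 1) * v x * (\<phi> x * \<phi> x)"
  let ?w = "\<lambda>x. \<bar>v x\<bar> powr ((\<gamma> - 1) / 2) * v x * \<phi> x"
  define F where "F x = enorm N x powr \<theta> * dotp N (?G x) (weak_grad N \<Omega> ?u x)
                     - enorm N x powr l * \<bar>v x\<bar> powr (p - 1) * v x * ?u x" for x
  define H where "H x = enorm N x powr \<theta> * (enorm N (weak_grad N \<Omega> ?w x))\<^sup>2
                     - p * enorm N x powr l * \<bar>v x\<bar> powr (p - 1) * (?w x)\<^sup>2" for x
  have "?u \<in> H1_c N \<theta> \<Omega> \<inter> Linf_loc N \<Omega>" "?w \<in> H1_c N \<theta> \<Omega> \<inter> Linf_loc N \<Omega>"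
    using \<gamma> by (intro power_product_admissible[OF \<Omega> v] \<phi> \<phi>2; simp)+
  then have iF: "set_integrable (leb N) \<Omega> F" "(LINT x:\<Omega>|leb N. F x) = 0"
    and iH: "set_integrable (leb N) \<Omega> H" "(LINT x:\<Omega>|leb N. H x) \<ge> 0"
    using sol stab unfolding is_solution_def is_stable_def Let_def F_def[abs_def] H_def[abs_def] by blast+
  have F_eq: "AE x in leb N. x \<in> \<Omega> \<longrightarrow> F x = \<gamma> * A x + E x - B x"
  proof -
    have "AE x in leb N. x \<in> \<Omega> \<longrightarrow> (\<forall>i<N. weak_grad N \<Omega> ?u x i
      = ((\<gamma> - 1) + 1) * abs_pow (\<gamma> - 1) (v x) * (\<phi> x * \<phi> x) * ?G x i + abs_pow (\<gamma> - 1) (v x) * v x * partial i (\<lambda>x. \<phi> x * \<phi> x) x)"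
      using \<gamma> by (intro power_product_weak_grad(2)[OF \<Omega> wd v(2)] C_k_mult \<Omega> C1) simp
    then show ?thesis
    proof eventually_elim
      case (elim x)
      show ?case
      proof
        assume x: "x \<in> \<Omega>"
        let ?P = "abs_pow (\<gamma> - 1) (v x)"
        have "dotp N (?G x) (weak_grad N \<Omega> ?u x)
          = dotp N (?G x) (\<lambda>i. \<gamma> * ?P * (\<phi> x * \<phi> x) * ?G x i + ?P * v x * (2 * \<phi> x * grad \<phi> x i))"
          using elim x by (intro dotp_cong) (simp add: partial_mult[OF C1' C1' x] grad_def)
        also have "\<dots> = \<gamma> * ?P * (\<phi> x)\<^sup>2 * (enorm N (?G x))\<^sup>2 + ?P * (2 * (\<phi> x * v x) * dotp N (?G x) (grad \<phi> x))"
          unfolding dotp_def enorm_square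
          by (simp add: distrib_left sum.distrib sum_distrib_left power2_eq_square mult_ac)
        finally have 1: "enorm N x powr \<theta> * dotp N (?G x) (weak_grad N \<Omega> ?u x) = \<gamma> * A x + E x"
          unfolding A_def E_def by (simp add: algebra_simps)
        have "enorm N x powr l * \<bar>v x\<bar> powr (p - 1) * v x * ?u x = enorm N x powr l * (\<bar>v x\<bar> powr (p - 1) * (?P * (v x)\<^sup>2) * (\<phi> x)\<^sup>2)"
          unfolding abs_pow_times[symmetric] by (simp add: power2_eq_square mult_ac)
        also have "\<dots> = B x" unfolding eqs(2) B_def ..
        finally show "F x = \<gamma> * A x + E x - B x" using 1 by (simp add: F_def)
      qed
    qed
  qed
  have H_eq: "AE x in leb N. x \<in> \<Omega> \<longrightarrow> H x = ((\<gamma> + 1) / 2)\<^sup>2 * A x + (\<gamma> + 1) / 2 * E x + D x - p * B x"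
  proof -
    have "AE x in leb N. x \<in> \<Omega> \<longrightarrow> (\<forall>i<N. weak_grad N \<Omega> ?w x i
      = ((\<gamma> - 1) / 2 + 1) * abs_pow ((\<gamma> - 1) / 2) (v x) * \<phi> x * ?G x i + abs_pow ((\<gamma> - 1) / 2) (v x) * v x * partial i \<phi> x)"
      using \<gamma> by (intro power_product_weak_grad(2)[OF \<Omega> wd v(2) C1]) simp
    then show ?thesis
    proof eventually_elim
      case (elim x)
      show ?case
      proof
        assume x: "x \<in> \<Omega>"
        let ?P = "abs_pow (\<gamma> - 1) (v x)" and ?R = "abs_pow ((\<gamma> - 1) / 2) (v x)" and ?s = "(\<gamma> + 1) / 2"
        have RP: "?R\<^sup>2 = ?P"
        proof -
          have "2 * ((\<gamma> - 1) / 2) = \<gamma> - 1" by (simp add: field_simps)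
          moreover have "?R\<^sup>2 = abs_pow (2 * ((\<gamma> - 1) / 2)) (v x)" using \<gamma> by (intro abs_pow_square) simp
          ultimately show ?thesis by (simp only:)
        qed
        have "(enorm N (weak_grad N \<Omega> ?w x))\<^sup>2 = (\<Sum>i<N. (?s * ?R * \<phi> x * ?G x i + ?R * v x * grad \<phi> x i)\<^sup>2)"
        proof -
          have half: "(\<gamma> - 1) / 2 + 1 = ?s" by (simp add: field_simps)
          show ?thesis
            unfolding enorm_square using elim x unfolding half by (intro sum.cong) (simp_all add: grad_def)
        qed
        also have "\<dots> = (\<Sum>i<N. ?R\<^sup>2 * (?s\<^sup>2 * (\<phi> x)\<^sup>2 * (?G x i)\<^sup>2 + ?s * (2 * (\<phi> x * v x)) * (?G x i * grad \<phi> x i) + (v x)\<^sup>2 * (grad \<phi> x i)\<^sup>2))"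
          by (intro sum.cong refl) (simp add: power2_eq_square algebra_simps)
        also have "\<dots> = ?P * (?s\<^sup>2 * (\<phi> x)\<^sup>2 * (enorm N (?G x))\<^sup>2 + ?s * (2 * (\<phi> x * v x)) * dotp N (?G x) (grad \<phi> x) + (v x)\<^sup>2 * (enorm N (grad \<phi> x))\<^sup>2)"
          unfolding RP enorm_square dotp_def by (simp add: sum.distrib flip: sum_distrib_left)
        finally have 1: "enorm N x powr \<theta> * (enorm N (weak_grad N \<Omega> ?w x))\<^sup>2 = ?s\<^sup>2 * A x + ?s * E x + D x"
          unfolding A_def E_def D_def eqs(1)[symmetric] by (simp add: algebra_simps)
        have "p * enorm N x powr l * \<bar>v x\<bar> powr (p - 1) * (?w x)\<^sup>2 = p * (enorm N x powr l * (\<bar>v x\<bar> powr (p - 1) * (?R\<^sup>2 * (v x)\<^sup>2) * (\<phi> x)\<^sup>2))"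
          unfolding abs_pow_times[symmetric] by (simp add: power2_eq_square mult_ac)
        also have "\<dots> = p * B x" unfolding RP eqs(2) B_def ..
        finally show "H x = ?s\<^sup>2 * A x + ?s * E x + D x - p * B x" using 1 by (simp add: H_def)
      qed
    qed
  qed
  have B0: "B x \<ge> 0" for x unfolding B_def by simp
  have F_bd: "AE x in leb N. x \<in> \<Omega> \<longrightarrow> 1 * B x \<le> (\<gamma> + \<epsilon>) * A x + 1 / \<epsilon> * D x + (- 1) * F x"
    using F_eq
  proof eventually_elim
    case (elim x)
    have E2: "0 \<le> \<epsilon> * A x + 1 / \<epsilon> * D x - E x" "0 \<le> \<epsilon> * A x + 1 / \<epsilon> * D x + E x"
      using E[of x] by (simp_all add: abs_le_iff)
    show ?case
    proof
      assume "x \<in> \<Omega>"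
      then have F: "F x = \<gamma> * A x + E x - B x" using elim by simp
      show "1 * B x \<le> (\<gamma> + \<epsilon>) * A x + 1 / \<epsilon> * D x + (- 1) * F x" unfolding F using E2 by (simp add: algebra_simps)
    qed
  qed
  \<comment> \<open>\<open>B\<close> carries the weight |x|^l, of which the space containing v says
    nothing. Integrability comes from the equation: \<open>F\<close> is integrable by definition of
    a solution, and \<open>B\<close> is dominated by a combination of \<open>A\<close>,
    \<open>D\<close> and \<open>F\<close>.\<close>
  show iB: "set_integrable (leb N) \<Omega> B"
    unfolding set_integrable_def
  proof (rule Bochner_Integration.integrable_bound)
    have "set_integrable (leb N) \<Omega> (\<lambda>x. (\<gamma> + \<epsilon>) * A x + 1 / \<epsilon> * D x + (- 1) * F x)"
      by (intro set_integral_add set_integrable_mult_right iA iD iF)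
    then show "integrable (leb N) (\<lambda>x. indicator \<Omega> x *\<^sub>R ((\<gamma> + \<epsilon>) * A x + 1 / \<epsilon> * D x + (- 1) * F x))"
      by (simp add: set_integrable_def)
    have "locally_bounded N \<Omega> (\<lambda>x. abs_pow (\<gamma> + p) (v x) * (\<phi> x * \<phi> x))"
      using p \<gamma> by (intro locally_bounded_mult bp b\<phi>) simp
    then have "(\<lambda>x. indicator \<Omega> x * (abs_pow (\<gamma> + p) (v x) * (\<phi> x * \<phi> x))) \<in> borel_measurable (leb N)"
      by (intro locally_integrable_measurable[OF \<Omega>] locally_bounded_integrable)
    then have "(\<lambda>x. enorm N x powr l * (indicator \<Omega> x * (abs_pow (\<gamma> + p) (v x) * (\<phi> x * \<phi> x)))) \<in> borel_measurable (leb N)"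
      by (rule borel_measurable_times[OF leb_measurable[OF enorm_powr_measurable]])
    moreover have "abs_pow (\<gamma> + p) s = \<bar>s\<bar> powr (\<gamma> + p)" for s using p \<gamma> by (simp add: abs_pow_def)
    ultimately show "(\<lambda>x. indicator \<Omega> x *\<^sub>R B x) \<in> borel_measurable (leb N)"
      unfolding B_def by (simp add: power2_eq_square mult.left_commute)
    show "AE x in leb N. norm (indicator \<Omega> x *\<^sub>R B x) \<le> norm (indicator \<Omega> x *\<^sub>R ((\<gamma> + \<epsilon>) * A x + 1 / \<epsilon> * D x + (- 1) * F x))"
      using F_bd
    proof eventually_elim
      case (elim x)
      then show ?case using B0[of x] by (cases "x \<in> \<Omega>") auto
    qed
  qed
  show "(LINT x:\<Omega>|leb N. B x) \<le> (\<gamma> + \<epsilon>) * (LINT x:\<Omega>|leb N. A x) + (LINT x:\<Omega>|leb N. D x) / \<epsilon>"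
    using set_integral_mono_combination[OF iA iD iF(1) iB F_bd] iF(2) by simp
  \<comment> \<open>The equation is an identity and is used in both directions. This lower bound for
    \<open>B\<close> is the one that is multiplied by p when \<open>B\<close> is eliminated.\<close>
  have "AE x in leb N. x \<in> \<Omega> \<longrightarrow> (- 1) * B x \<le> (- (\<gamma> - \<epsilon>)) * A x + 1 / \<epsilon> * D x + 1 * F x"
    using F_eq
  proof eventually_elim
    case (elim x)
    have E2: "0 \<le> \<epsilon> * A x + 1 / \<epsilon> * D x - E x" "0 \<le> \<epsilon> * A x + 1 / \<epsilon> * D x + E x"
      using E[of x] by (simp_all add: abs_le_iff)
    show ?case
    proof
      assume "x \<in> \<Omega>"
      then have F: "F x = \<gamma> * A x + E x - B x" using elim by simp
      show "(- 1) * B x \<le> (- (\<gamma> - \<epsilon>)) * A x + 1 / \<epsilon> * D x + 1 * F x" unfolding F using E2 by (simp add: algebra_simps)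
    qed
  qed
  from set_integral_mono_combination[OF iA iD iF(1) iB this] iF(2)
  show "(\<gamma> - \<epsilon>) * (LINT x:\<Omega>|leb N. A x) - (LINT x:\<Omega>|leb N. D x) / \<epsilon> \<le> (LINT x:\<Omega>|leb N. B x)"
    by (simp add: algebra_simps)
  have "AE x in leb N. x \<in> \<Omega> \<longrightarrow> p * B x \<le> (((\<gamma> + 1) / 2)\<^sup>2 + (\<gamma> + 1) / 2 * \<epsilon>) * A x + (1 + (\<gamma> + 1) / (2 * \<epsilon>)) * D x + (- 1) * H x"
    using H_eq
  proof eventually_elim
    case (elim x)
    have "(\<gamma> + 1) / 2 * E x \<le> (\<gamma> + 1) / 2 * (\<epsilon> * A x + 1 / \<epsilon> * D x)"
      using E[of x] \<gamma> by (intro mult_left_mono) auto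
    with elim show ?case by (simp add: algebra_simps)
  qed
  from set_integral_mono_combination[OF iA iD iH(1) iB this] iH(2)
  show "p * (LINT x:\<Omega>|leb N. B x) \<le> (((\<gamma> + 1) / 2)\<^sup>2 + (\<gamma> + 1) / 2 * \<epsilon>) * (LINT x:\<Omega>|leb N. A x)
      + (1 + (\<gamma> + 1) / (2 * \<epsilon>)) * (LINT x:\<Omega>|leb N. D x)"
    by linarith
qed

section \<open>Absorption of the gradient term and passage to extended integrals\<close>

lemma nn_set_integral_eq:
  assumes "set_integrable M \<Omega> f" "\<And>x. f x \<ge> (0::real)"
  shows "(\<integral>\<^sup>+x\<in>\<Omega>. ennreal (f x) \<partial>M) = ennreal (LINT x:\<Omega>|M. f x)"
proof -
  have "(\<integral>\<^sup>+x\<in>\<Omega>. ennreal (f x) \<partial>M) = (\<integral>\<^sup>+x. ennreal (indicator \<Omega> x *\<^sub>R f x) \<partial>M)"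
    by (intro nn_integral_cong) (simp add: indicator_def)
  also have "\<dots> = ennreal (LINT x:\<Omega>|M. f x)"
    unfolding set_lebesgue_integral_def
    using assms by (intro nn_integral_eq_integral) (auto simp: set_integrable_def)
  finally show ?thesis .
qed

lemma power_C_k_compact:
  assumes "openin (Rn N) \<Omega>" "\<psi> \<in> C_k_compact 2 N \<Omega>" "m \<ge> 1"
  shows "(\<lambda>x. \<psi> x ^ m) \<in> C_k_compact 1 N \<Omega>"
proof -
  obtain K where *: "C_k 2 N \<Omega> \<psi>" "compactin (Rn N) K" "K \<subseteq> \<Omega>" "\<And>x. x \<in> \<Omega> - K \<Longrightarrow> \<psi> x = 0"
    by (rule C_k_compactE[OF assms(2)]) blast
  have "C_k (Suc 1) N \<Omega> \<psi>" using *(1) by (simp only: Suc_1)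
  then have "C_k 1 N \<Omega> \<psi>" by (rule C_k_SucD)
  then have "C_k 1 N \<Omega> (\<lambda>x. \<psi> x ^ m)" by (rule C_k_power[OF assms(1)])
  moreover have "\<forall>x\<in>\<Omega> - K. \<psi> x ^ m = 0" using *(4) assms(3) by simp
  ultimately show ?thesis using *(2,3) unfolding C_k_compact_def by blast
qed

text \<open>Both sides are integrals with values in [0, \<infinity>], so a non-integrable right-hand
  side counts as \<infinity> and not as 0. \<open>C\<close> precedes N, \<Omega>, v and \<psi> in
  the quantifiers; this expresses on what it may depend.\<close>

theorem proposition1p5:
  fixes p \<theta> l \<gamma> :: real and m :: nat
  assumes "p > 1"
    and "1 \<le> \<gamma>" and "\<gamma> < 2 * p + 2 * sqrt (p * (p - 1)) - 1"
    and "real m \<ge> max ((p + \<gamma>) / (p - 1)) 2"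
  shows "\<exists>C::real. C > 0 \<and>
    (\<forall>(N::nat) (\<Omega>::point set) (v::point \<Rightarrow> real).
       N \<ge> 2 \<and> is_domain N \<Omega> \<and> is_solution N p \<theta> l \<Omega> v \<and> is_stable N p \<theta> l \<Omega> v \<longrightarrow>
       weakly_differentiable N \<Omega> (\<lambda>x. \<bar>v x\<bar> powr ((\<gamma> - 1) / 2) * v x) \<and>
       (\<forall>\<psi> \<in> C_k_compact 2 N \<Omega>. (\<forall>x\<in>\<Omega>. \<bar>\<psi> x\<bar> \<le> 1) \<longrightarrow>
          (\<integral>\<^sup>+x\<in>\<Omega>. ennreal
             ((enorm N x powr \<theta> *
                 (enorm N (weak_grad N \<Omega> (\<lambda>y. \<bar>v y\<bar> powr ((\<gamma> - 1) / 2) * v y) x))\<^sup>2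
               + enorm N x powr l * \<bar>v x\<bar> powr (\<gamma> + p)) * \<bar>\<psi> x\<bar> ^ (2 * m)) \<partial>leb N)
          \<le> ennreal C *
            (\<integral>\<^sup>+x\<in>\<Omega>. ennreal
               (enorm N x powr ((\<theta> * (\<gamma> + p) - l * (\<gamma> + 1)) / (p - 1)) *
                ((enorm N (grad \<psi> x))\<^sup>2 + \<bar>\<psi> x\<bar> * \<bar>laplacian N \<psi> x\<bar>
                  + \<bar>\<psi> x\<bar> * (enorm N (grad \<psi> x) / enorm N x)) powr ((p + \<gamma>) / (p - 1))) \<partial>leb N)))"
proof -
  have p: "p > 1" and \<gamma>: "\<gamma> \<ge> 1" by fact+
  have m: "real m \<ge> (p + \<gamma>) / (p - 1)" "m \<ge> 2" using assms(4) by auto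
  obtain \<epsilon> C1 C2 where \<epsilon>: "\<epsilon> > 0" and C12: "C1 > 0" "C2 > 0" and
    absorb: "\<And>a b d. 0 \<le> a \<Longrightarrow> 0 \<le> d \<Longrightarrow> b \<le> (\<gamma> + \<epsilon>) * a + d / \<epsilon> \<Longrightarrow> (\<gamma> - \<epsilon>) * a - d / \<epsilon> \<le> b \<Longrightarrow>
      p * b \<le> (((\<gamma> + 1) / 2)\<^sup>2 + (\<gamma> + 1) / 2 * \<epsilon>) * a + (1 + (\<gamma> + 1) / (2 * \<epsilon>)) * d \<Longrightarrow>
      a \<le> C1 * d \<and> b \<le> C2 * d"
    using absorb_constants[OF p \<gamma> gamma_range[OF assms(1-3)]] by blast
  define s where "s = (\<gamma> + 1) / 2"
  \<comment> \<open>Differentiating \<psi>^m brings a factor m^2, so Young's inequality leaves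
    \<open>B\<close> with coefficient m^2 \<delta> = 1 / (2 \<open>C2\<close>); by
    \<open>b \<le> C2 * d\<close> this part is at most d / 2.\<close>
  define \<delta> where "\<delta> = 1 / (2 * C2 * (real m)\<^sup>2)"
  define c where "c = (real m)\<^sup>2 * \<delta> powr (- ((\<gamma> + 1) / (p - 1)))"
  \<comment> \<open>The factor s^2 is the square of the exponent in the gradient of
    |v|^((\<gamma>-1)/2) v, and the 2 makes up for the half of d that is absorbed.\<close>
  define C where "C = 2 * (s\<^sup>2 * C1 + C2) * c"
  have m0: "(real m)\<^sup>2 > 0" using m(2) by simp
  then have \<delta>: "\<delta> > 0" using C12 by (simp add: \<delta>_def)
  then have c: "c > 0" using m0 by (simp add: c_def)
  have C3: "s\<^sup>2 * C1 + C2 > 0" using C12 by (intro add_nonneg_pos) auto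
  then have "C > 0" using c by (simp add: C_def)
  show ?thesis
  proof (intro exI[of _ C] conjI allI impI ballI \<open>C > 0\<close>; (elim conjE)?)
    fix N \<Omega> v
    assume dom: "is_domain N \<Omega>" and sol: "is_solution N p \<theta> l \<Omega> v" and stab: "is_stable N p \<theta> l \<Omega> v"
    have \<Omega>: "openin (Rn N) \<Omega>" using dom by (simp add: is_domain_def)
    have v: "v \<in> H1_loc N \<theta> \<Omega>" "v \<in> Linf_loc N \<Omega>" using sol by (auto simp: is_solution_def)
    have wd: "weakly_differentiable N \<Omega> v" using v(1) by (simp add: H1_loc_def)
    let ?w = "\<lambda>y. \<bar>v y\<bar> powr ((\<gamma> - 1) / 2) * v y"
    have a0: "(\<gamma> - 1) / 2 \<ge> 0" using \<gamma> by simp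
    \<comment> \<open>The cutoff 1 turns the product rule into the weak gradient of
      |v|^((\<gamma>-1)/2) v itself.\<close>
    note wg = power_product_weak_grad[OF \<Omega> wd v(2) C_k_const[OF \<Omega>, of 1 1] a0, unfolded mult_1_right]
    show "weakly_differentiable N \<Omega> ?w" by (rule wg(1))
    fix \<psi> assume \<psi>: "\<psi> \<in> C_k_compact 2 N \<Omega>" and \<psi>1: "\<forall>x\<in>\<Omega>. \<bar>\<psi> x\<bar> \<le> 1"
    let ?\<phi> = "\<lambda>x. \<psi> x ^ m"
    have \<phi>: "?\<phi> \<in> C_k_compact 1 N \<Omega>" using m(2) by (intro power_C_k_compact[OF \<Omega> \<psi>]) simp
    have C\<psi>: "C_k (Suc 1) N \<Omega> \<psi>" using \<psi> unfolding C_k_compact_def Suc_1 by blast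
    then have C\<psi>1: "C_k (Suc 0) N \<Omega> \<psi>" unfolding One_nat_def by (rule C_k_SucD)
    define A where "A = (\<lambda>x. enorm N x powr \<theta> * (abs_pow (\<gamma> - 1) (v x) * (?\<phi> x)\<^sup>2 * (enorm N (weak_grad N \<Omega> v x))\<^sup>2))"
    define B where "B = (\<lambda>x. enorm N x powr l * (\<bar>v x\<bar> powr (\<gamma> + p) * (?\<phi> x)\<^sup>2))"
    define D where "D = (\<lambda>x. enorm N x powr \<theta> * (\<bar>v x\<bar> powr (\<gamma> + 1) * (enorm N (grad ?\<phi> x))\<^sup>2))"
    define Y where "Y = (\<lambda>x. enorm N x powr ((\<theta> * (\<gamma> + p) - l * (\<gamma> + 1)) / (p - 1)) *
       ((enorm N (grad \<psi> x))\<^sup>2) powr ((p + \<gamma>) / (p - 1)))"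
    note est = energy_estimates[OF p \<gamma> \<epsilon> \<Omega> sol stab \<phi>, folded A_def B_def D_def]
    have nonneg: "A x \<ge> 0" "B x \<ge> 0" "D x \<ge> 0" "Y x \<ge> 0" for x
      unfolding A_def B_def D_def Y_def by (simp_all add: abs_pow_nonneg)
    define a b d where "a = (LINT x:\<Omega>|leb N. A x)" and "b = (LINT x:\<Omega>|leb N. B x)" and "d = (LINT x:\<Omega>|leb N. D x)"
    have abd0: "a \<ge> 0" "b \<ge> 0" "d \<ge> 0"
      unfolding a_def b_def d_def set_lebesgue_integral_def by (simp_all add: nonneg)
    have ad: "a \<le> C1 * d" "b \<le> C2 * d"
      using absorb[of a d b] abd0 est(4-6) unfolding a_def b_def d_def by blast+
    define L where "L x = (enorm N x powr \<theta> * (enorm N (weak_grad N \<Omega> ?w x))\<^sup>2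
        + enorm N x powr l * \<bar>v x\<bar> powr (\<gamma> + p)) * \<bar>\<psi> x\<bar> ^ (2 * m)" for x
    have L_eq: "AE x in leb N. x \<in> \<Omega> \<longrightarrow> L x = s\<^sup>2 * A x + B x"
      using wg(2)
    proof eventually_elim
      case (elim x)
      show ?case
      proof
        assume x: "x \<in> \<Omega>"
        let ?R = "abs_pow ((\<gamma> - 1) / 2) (v x)"
        have "2 * ((\<gamma> - 1) / 2) = \<gamma> - 1" by (simp add: field_simps)
        then have RP: "?R\<^sup>2 = abs_pow (\<gamma> - 1) (v x)" using abs_pow_square[OF a0, of "v x"] by (simp only:)
        have "(\<gamma> - 1) / 2 + 1 = s" by (simp add: s_def field_simps)
        moreover have "partial i (\<lambda>_. 1) x = 0" for i by (simp add: partial_def)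
        ultimately have "weak_grad N \<Omega> ?w x i = s * ?R * weak_grad N \<Omega> v x i" if "i < N" for i
          using elim x that by simp
        then have "(enorm N (weak_grad N \<Omega> ?w x))\<^sup>2 = s\<^sup>2 * abs_pow (\<gamma> - 1) (v x) * (enorm N (weak_grad N \<Omega> v x))\<^sup>2"
          unfolding enorm_square RP[symmetric] by (simp add: power_mult_distrib sum_distrib_left mult.assoc)
        moreover have "\<bar>\<psi> x\<bar> ^ (2 * m) = (\<psi> x ^ m)\<^sup>2"
          by (simp add: power_mult power2_eq_square flip: power_mult_distrib)
        ultimately show "L x = s\<^sup>2 * A x + B x"
          unfolding L_def A_def B_def by (simp add: algebra_simps)
      qed
    qed
    have "(\<integral>\<^sup>+x\<in>\<Omega>. ennreal (L x) \<partial>leb N) = (\<integral>\<^sup>+x\<in>\<Omega>. ennreal (s\<^sup>2 * A x + B x) \<partial>leb N)"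
      using L_eq by (intro nn_integral_cong_AE, eventually_elim) (auto simp: indicator_def)
    also have "\<dots> = ennreal (s\<^sup>2 * a + b)"
      using est(1,2) nonneg unfolding a_def b_def
      by (subst nn_set_integral_eq) (auto simp: set_integral_add set_integrable_mult_right)
    also have "\<dots> \<le> ennreal ((s\<^sup>2 * C1 + C2) * d)"
    proof (rule ennreal_leI)
      have "s\<^sup>2 * a \<le> s\<^sup>2 * (C1 * d)" using ad(1) by (intro mult_left_mono) auto
      with ad(2) show "s\<^sup>2 * a + b \<le> (s\<^sup>2 * C1 + C2) * d" by (simp add: algebra_simps)
    qed
    \<comment> \<open>Written with d / 2, which is what remains of d after absorption and is bounded
      directly by the right-hand side.\<close>
    also have "(s\<^sup>2 * C1 + C2) * d = 2 * (s\<^sup>2 * C1 + C2) * (d / 2)" by simp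
    also have "ennreal \<dots> = ennreal (2 * (s\<^sup>2 * C1 + C2)) * ennreal (d / 2)"
      using C3 abd0 by (intro ennreal_mult) auto
    also have "\<dots> \<le> ennreal (2 * (s\<^sup>2 * C1 + C2)) * (ennreal c * (\<integral>\<^sup>+x\<in>\<Omega>. ennreal (Y x) \<partial>leb N))"
    proof (rule mult_left_mono)
      \<comment> \<open>Young's inequality at a point, with r = |x|, V = |v|, P = |\<psi>| and g =
        |\<nabla>\<psi>|. The bound |\<psi>| \<le> 1 is used here.\<close>
      have DY: "D x \<le> 1 / (2 * C2) * B x + c * Y x" if x: "x \<in> \<Omega>" for x
      proof -
        have grad: "(enorm N (grad ?\<phi> x))\<^sup>2 = (real m)\<^sup>2 * (\<bar>\<psi> x\<bar> ^ (2 * m - 2) * (enorm N (grad \<psi> x))\<^sup>2)"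
        proof -
          have "2 * m - 2 = 2 * (m - 1)" by simp
          then have "\<bar>\<psi> x\<bar> ^ (2 * m - 2) = (\<psi> x ^ (m - 1))\<^sup>2"
            by (simp only: power_mult power2_abs) (simp add: power2_eq_square flip: power_mult_distrib)
          then show ?thesis
            unfolding enorm_square grad_def
            by (simp add: partial_power[OF C\<psi>1 x] power_mult_distrib sum_distrib_left mult.assoc)
        qed
        have "\<bar>\<psi> x\<bar> ^ (2 * m) = (\<psi> x ^ m)\<^sup>2"
          by (simp add: power_mult power2_eq_square flip: power_mult_distrib)
        then have BX: "B x = enorm N x powr l * \<bar>v x\<bar> powr (\<gamma> + p) * \<bar>\<psi> x\<bar> ^ (2 * m)" by (simp add: B_def)
        have "D x = (real m)\<^sup>2 * (enorm N x powr \<theta> * \<bar>v x\<bar> powr (\<gamma> + 1) * \<bar>\<psi> x\<bar> ^ (2 * m - 2) * (enorm N (grad \<psi> x))\<^sup>2)"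
          unfolding D_def grad by (simp add: mult_ac)
        also have "\<dots> \<le> (real m)\<^sup>2 * (\<delta> * B x + \<delta> powr (- ((\<gamma> + 1) / (p - 1))) * Y x)"
          unfolding BX Y_def using \<psi>1 x
          by (intro mult_left_mono young_weighted[OF p \<gamma> m \<delta>]) (auto simp: enorm_nonneg)
        also have "\<dots> = (real m)\<^sup>2 * \<delta> * B x + c * Y x" by (simp add: c_def algebra_simps)
        also have "(real m)\<^sup>2 * \<delta> = 1 / (2 * C2)" using m0 C12 by (simp add: \<delta>_def)
        finally show ?thesis .
      qed
      have Bm: "(\<lambda>x. ennreal (1 / (2 * C2) * B x) * indicator \<Omega> x) \<in> borel_measurable (leb N)"
      proof -
        have [measurable]: "(\<lambda>x. indicator \<Omega> x *\<^sub>R B x) \<in> borel_measurable (leb N)"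
          using est(2) unfolding set_integrable_def by (rule borel_measurable_integrable)
        have "(\<lambda>x. ennreal (1 / (2 * C2) * (indicator \<Omega> x *\<^sub>R B x))) \<in> borel_measurable (leb N)" by measurable
        then show ?thesis by (rule measurable_cong[THEN iffD1, rotated]) (simp add: indicator_def)
      qed
      have Ym: "(\<lambda>x. ennreal (Y x) * indicator \<Omega> x) \<in> borel_measurable (leb N)"
      proof -
        have [measurable]: "(\<lambda>x. indicator \<Omega> x * (enorm N (grad \<psi> x))\<^sup>2) \<in> borel_measurable (leb N)"
          using C\<psi>1 by (intro locally_integrable_measurable[OF \<Omega>] locally_bounded_integrable locally_bounded_grad_square[OF \<Omega>])
            (simp only: One_nat_def)
        have [measurable]: "(\<lambda>x. enorm N x powr t) \<in> borel_measurable (leb N)" for t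
          by (intro leb_measurable enorm_powr_measurable)
        have [measurable]: "\<Omega> \<in> sets (leb N)" by (intro leb_sets sets_open \<Omega>)
        have "(\<lambda>x. ennreal (enorm N x powr ((\<theta> * (\<gamma> + p) - l * (\<gamma> + 1)) / (p - 1)) *
            (indicator \<Omega> x * (enorm N (grad \<psi> x))\<^sup>2) powr ((p + \<gamma>) / (p - 1))) * indicator \<Omega> x) \<in> borel_measurable (leb N)"
          by measurable
        then show ?thesis
          by (rule measurable_cong[THEN iffD1, rotated]) (simp add: indicator_def Y_def)
      qed
      let ?T = "ennreal c * (\<integral>\<^sup>+x\<in>\<Omega>. ennreal (Y x) \<partial>leb N)"
      have "ennreal d = (\<integral>\<^sup>+x\<in>\<Omega>. ennreal (D x) \<partial>leb N)"
        unfolding d_def by (rule nn_set_integral_eq[OF est(3) nonneg(3), symmetric])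
      also have "\<dots> \<le> (\<integral>\<^sup>+x. ennreal (1 / (2 * C2) * B x) * indicator \<Omega> x + ennreal c * (ennreal (Y x) * indicator \<Omega> x) \<partial>leb N)"
      proof (rule nn_integral_mono)
        fix x
        show "ennreal (D x) * indicator \<Omega> x \<le> ennreal (1 / (2 * C2) * B x) * indicator \<Omega> x + ennreal c * (ennreal (Y x) * indicator \<Omega> x)"
        proof (cases "x \<in> \<Omega>")
          case True
          have "ennreal (D x) \<le> ennreal (1 / (2 * C2) * B x + c * Y x)" by (rule ennreal_leI[OF DY[OF True]])
          also have "\<dots> = ennreal (1 / (2 * C2) * B x) + ennreal (c * Y x)"
            using nonneg C12 c by (intro ennreal_plus) auto
          also have "ennreal (c * Y x) = ennreal c * ennreal (Y x)"
            using nonneg c by (intro ennreal_mult) auto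
          finally show ?thesis using True by simp
        qed simp
      qed
      also have "\<dots> = (\<integral>\<^sup>+x\<in>\<Omega>. ennreal (1 / (2 * C2) * B x) \<partial>leb N) + ?T"
        using Bm Ym by (simp add: nn_integral_add nn_integral_cmult)
      also have "(\<integral>\<^sup>+x\<in>\<Omega>. ennreal (1 / (2 * C2) * B x) \<partial>leb N) = ennreal (1 / (2 * C2) * b)"
      proof -
        have "(LINT x:\<Omega>|leb N. 1 / (2 * C2) * B x) = 1 / (2 * C2) * b"
          unfolding b_def by (rule set_integral_mult_right)
        moreover have "(\<integral>\<^sup>+x\<in>\<Omega>. ennreal (1 / (2 * C2) * B x) \<partial>leb N) = ennreal (LINT x:\<Omega>|leb N. 1 / (2 * C2) * B x)"
          using est(2) nonneg(2) C12 by (intro nn_set_integral_eq set_integrable_mult_right) simp_all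
        ultimately show ?thesis by (simp only:)
      qed
      also have "ennreal (1 / (2 * C2) * b) \<le> ennreal (d / 2)"
        using ad(2) C12 by (intro ennreal_leI) (simp add: field_simps)
      finally have T: "ennreal d \<le> ennreal (d / 2) + ?T" by (simp add: add_right_mono)
      \<comment> \<open>An infinite \<open>?T\<close> makes the claim trivial; otherwise d, a finite
        real number, allows d / 2 to be subtracted.\<close>
      show "ennreal (d / 2) \<le> ?T"
      proof (cases ?T)
        case (real t)
        with T have "ennreal d \<le> ennreal (d / 2 + t)" using abd0 by simp
        then have "d \<le> d / 2 + t" using abd0 real(1) by (subst (asm) ennreal_le_iff) auto
        then show ?thesis unfolding real(2) by (intro ennreal_leI) simp
      qed simp
    qed simp
    also have "\<dots> = ennreal C * (\<integral>\<^sup>+x\<in>\<Omega>. ennreal (Y x) \<partial>leb N)"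
      unfolding C_def using C3 c by (simp add: ennreal_mult' mult.assoc)
    \<comment> \<open>The added terms are nonnegative and the exponent is positive, so enlarging the
      base enlarges the power.\<close>
    also have "\<dots> \<le> ennreal C * (\<integral>\<^sup>+x\<in>\<Omega>. ennreal
               (enorm N x powr ((\<theta> * (\<gamma> + p) - l * (\<gamma> + 1)) / (p - 1)) *
                ((enorm N (grad \<psi> x))\<^sup>2 + \<bar>\<psi> x\<bar> * \<bar>laplacian N \<psi> x\<bar>
                  + \<bar>\<psi> x\<bar> * (enorm N (grad \<psi> x) / enorm N x)) powr ((p + \<gamma>) / (p - 1))) \<partial>leb N)"
      unfolding Y_def using p \<gamma>
      by (intro mult_left_mono nn_integral_mono mult_right_mono ennreal_leI powr_mono2)
        (auto simp: enorm_nonneg add.assoc)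
    finally show "(\<integral>\<^sup>+x\<in>\<Omega>. ennreal
             ((enorm N x powr \<theta> * (enorm N (weak_grad N \<Omega> ?w x))\<^sup>2
               + enorm N x powr l * \<bar>v x\<bar> powr (\<gamma> + p)) * \<bar>\<psi> x\<bar> ^ (2 * m)) \<partial>leb N)
          \<le> ennreal C *
            (\<integral>\<^sup>+x\<in>\<Omega>. ennreal
               (enorm N x powr ((\<theta> * (\<gamma> + p) - l * (\<gamma> + 1)) / (p - 1)) *
                ((enorm N (grad \<psi> x))\<^sup>2 + \<bar>\<psi> x\<bar> * \<bar>laplacian N \<psi> x\<bar>
                  + \<bar>\<psi> x\<bar> * (enorm N (grad \<psi> x) / enorm N x)) powr ((p + \<gamma>) / (p - 1))) \<partial>leb N)"
      unfolding L_def .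
  qed
qed

end
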